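(* Let $E_O$ be an out-split of a graph $E$ at a regular vertex $w\in\mathrm{reg}(E)$, let $E_{\widehat O}$ be the maximal out-split of $E$ at the same vertex, let $f\colon E_O\to E$ be the multi-out-split homomorphism and $f^*\colon C^*(E)\to C^*(E_O)$ the contravariantly induced $*$-isomorphism. Let $\varphi\colon S(E_{\widehat O})\to S(E)$ be the regular extended path homomorphism determined by $\varphi(w^i,w^i)=(e_i,e_i)$ for $1\le i\le n$, $\varphi(v^1,v^1)=(v,v)$ for $v\neq w$, $\varphi(e^1,t_{E_{\widehat O}}(e^1))=(e,t_E(e))$ if $t_E(e)\ne w$, and $\varphi(e^i,w^i)=(ee_i,e_i)$ if $t_E(e)=w$, where $s_E^{-1}(w)=\{e_1,\dots,e_n\}$. Then there is a multi-out-split homomorphism $g\colon E_{\widehat O}\to E_O$ (up to isomorphism of graph homomorphisms over $E_O$) such that $$(f^* )^{-1}=\varphi_*\circ g^*.$$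
   Context: A graph $E=(E^0,E^1,s_E,t_E)$ consists of arbitrary sets of vertices and edges with source and target maps. A vertex $v$ is regular if $s_E^{-1}(v)$ is finite and nonempty; $\mathrm{reg}(E)$ is the set of regular vertices. $\mathrm{FP}(E)$ is the set of finite paths (vertices, of length $0$, and sequences $e_1\ldots e_n$ of edges with $t_E(e_i)=s_E(e_{i+1})$); vertices act as units for concatenation. Multi-out-split: for every $v\in E^0$ emitting at least one edge, partition $s_E^{-1}(v)$ into finitely many nonempty disjoint sets $\epsilon_v^1,\dots,\epsilon_v^{m(v)}$, $m(v)\ge1$, at most one of them infinite; for sinks put $m(v)=1$. The multi-out-split $E_O$ is $E_O^0=\{v^i\mid v\in E^0,1\le i\le m(v)\}$, $E_O^1=\{e^i\mid e\in E^1,1\le i\le m(t_E(e))\}$, $s_{E_O}(e^i)=s_E(e)^j$ for $e\in\epsilon^j_{s_E(e)}$, $t_{E_O}(e^i)=t_E(e)^i$. The multi-out-split homomorphism is $E_O\to E$, $v^i\mapsto v$, $e^i\mapsto e$. An out-split at $w$ is a multi-out-split with $m(v)=1$ for all $v\ne w$; the maximal out-split $E_{\widehat O}$ at $w\in\mathrm{reg}(E)$ with $s_E^{-1}(w)=\{e_1,\dots,e_n\}$ is the out-split at $w$ with $\epsilon_w^i=\{e_i\}$, $1\le i\le n$. Graph homomorphisms $p\colon G\to H$ and $p'\colon G'\to H$ are isomorphic over $H$ if $p=p'\circ\sigma$ for some graph isomorphism $\sigma\colon G\to G'$. $C^*(E)$ is the universal C*-algebra generated by mutually orthogonal projections $S_v$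 ($v\in E^0$) and elements $S_e$ ($e\in E^1$) with $S_e^*S_{e'}=\delta_{e,e'}S_{t_E(e)}$, $S_{s_E(e)}S_e=S_e$, and $S_v=\sum_{e\in s_E^{-1}(v)}S_eS_e^*$ for $v\in\mathrm{reg}(E)$. For paths, $S_{e_1\ldots e_n}=S_{e_1}\cdots S_{e_n}$; put $S_{(\alpha,\beta)}=S_\alpha S_\beta^*$, $S_0=0$. A multi-out-split homomorphism $h\colon G\to H$ induces the $*$-homomorphism $h^*\colon C^*(H)\to C^*(G)$, $S_v\mapsto\sum_{u\in h^{-1}(v)}S_u$, $S_e\mapsto\sum_{x\in h^{-1}(e)}S_x$; for out-splits it is known to be a $*$-isomorphism. The graph inverse semigroup is $S(E)=\{(\alpha,\beta)\in \mathrm{FP}(E)^2\mid t_E(\alpha)=t_E(\beta)\}\cup\{0\}$ with $(\alpha,\beta)(\gamma,\delta)=(\alpha\gamma',\delta)$ if $\gamma=\beta\gamma'$, $=(\alpha,\delta\beta')$ if $\beta=\gamma\beta'$, and $=0$ otherwise; $0$ is a zero element; $(\alpha,\beta)^*=(\beta,\alpha)$; $s\le t\iff ss^*t=s$. An extended path homomorphism from $E$ to $F$ is a semigroup homomorphism $\varphi\colon S(E)\to S(F)$ with $\varphi(0)=0$; it is regular if whenever $u\in\mathrm{reg}(E)$, $0\ne t\in S(F)$ and $t\le\varphi(u,u)$, there exists $e\in s_E^{-1}(u)$ with $t\varphi(e,e)\neq0$. A regular $\varphi$ induces the $*$-homomorphism $\varphi_*\colon C^*(E)\to C^*(F)$,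 $S_v\mapsto S_{\varphi(v,v)}$, $S_e\mapsto S_{\varphi(e,t_E(e))}$. *)

theory Defs
  imports
    Complex_Main
    "HOL-Library.FuncSet"
    "HOL-Library.Sublist"
    "HOL-Library.Poly_Mapping"
    "HOL-Algebra.Ring"
    "Graph_Theory.Graph_Theory"
begin

section \<open>Graphs, out-splits and their homomorphisms\<close>

text \<open>Graphs are the possibly infinite multigraphs \<^term>\<open>wf_digraph\<close>, with source \<^term>\<open>tail\<close> and
  target \<^term>\<open>head\<close>.\<close>

definition regular_verts :: "('v, 'e) pre_digraph \<Rightarrow> 'v set" where
  "regular_verts E = {v \<in> verts E. finite (out_arcs E v) \<and> out_arcs E v \<noteq> {}}"

text \<open>\<open>m v\<close> is the number of classes at \<open>v\<close> and \<open>\<epsilon> v 1, \<dots>, \<epsilon> v (m v)\<close> are the classes.  The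
  value of \<open>\<epsilon>\<close> at sinks is irrelevant.\<close>

definition multi_split_data ::
  "('v, 'e) pre_digraph \<Rightarrow> ('v \<Rightarrow> nat) \<Rightarrow> ('v \<Rightarrow> nat \<Rightarrow> 'e set) \<Rightarrow> bool" where
  "multi_split_data E m \<epsilon> \<longleftrightarrow>
     (\<forall>v \<in> verts E.
        if out_arcs E v = {} then m v = 1
        else 1 \<le> m v
           \<and> (\<Union>i \<in> {1..m v}. \<epsilon> v i) = out_arcs E v
           \<and> (\<forall>i \<in> {1..m v}. \<epsilon> v i \<noteq> {})
           \<and> (\<forall>i \<in> {1..m v}. \<forall>j \<in> {1..m v}. i \<noteq> j \<longrightarrow> \<epsilon> v i \<inter> \<epsilon> v j = {})
           \<and> (\<forall>i \<in> {1..m v}. \<forall>j \<in> {1..m v}. infinite (\<epsilon> v i) \<and> infinite (\<epsilon> v j) \<longrightarrow> i = j))"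

definition multi_out_split ::
  "('v, 'e) pre_digraph \<Rightarrow> ('v \<Rightarrow> nat) \<Rightarrow> ('v \<Rightarrow> nat \<Rightarrow> 'e set)
     \<Rightarrow> ('v \<times> nat, 'e \<times> nat) pre_digraph" where
  "multi_out_split E m \<epsilon> =
     \<lparr> verts = {(v, i). v \<in> verts E \<and> 1 \<le> i \<and> i \<le> m v},
       arcs = {(e, i). e \<in> arcs E \<and> 1 \<le> i \<and> i \<le> m (head E e)},
       tail = (\<lambda>(e, i). (tail E e, THE j. 1 \<le> j \<and> j \<le> m (tail E e) \<and> e \<in> \<epsilon> (tail E e) j)),
       head = (\<lambda>(e, i). (head E e, i)) \<rparr>"

definition out_split_data ::
  "('v, 'e) pre_digraph \<Rightarrow> 'v \<Rightarrow> ('v \<Rightarrow> nat) \<Rightarrow> ('v \<Rightarrow> nat \<Rightarrow> 'e set) \<Rightarrow> bool" where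
  "out_split_data E w m \<epsilon> \<longleftrightarrow>
     w \<in> verts E \<and> multi_split_data E m \<epsilon> \<and> (\<forall>v \<in> verts E. v \<noteq> w \<longrightarrow> m v = 1)"

text \<open>The maximal out-split at \<open>w\<close>, where \<open>en 1, \<dots>, en n\<close> enumerate the edges emitted by \<open>w\<close>.\<close>

definition maximal_out_split ::
  "('v, 'e) pre_digraph \<Rightarrow> 'v \<Rightarrow> nat \<Rightarrow> (nat \<Rightarrow> 'e) \<Rightarrow> ('v \<times> nat, 'e \<times> nat) pre_digraph" where
  "maximal_out_split E w n en =
     multi_out_split E (\<lambda>v. if v = w then n else 1)
       (\<lambda>v i. if v = w then {en i} else out_arcs E v)"

text \<open>A graph homomorphism is given by its maps on vertices and on edges; only the values on the
  vertices and edges of its domain matter.\<close>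

type_synonym ('v, 'e, 'v2, 'e2) graph_map = "('v \<Rightarrow> 'v2) \<times> ('e \<Rightarrow> 'e2)"

definition split_proj :: "('v \<times> nat, 'e \<times> nat, 'v, 'e) graph_map" where
  "split_proj = (fst, fst)"

definition isomorphic_over ::
  "('v1, 'e1) pre_digraph \<Rightarrow> ('v1, 'e1, 'v, 'e) graph_map
     \<Rightarrow> ('v2, 'e2) pre_digraph \<Rightarrow> ('v2, 'e2, 'v, 'e) graph_map \<Rightarrow> bool" where
  "isomorphic_over G p G' p' \<longleftrightarrow>
     (\<exists>\<sigma>. pre_digraph.digraph_isomorphism G \<sigma> \<and> app_iso \<sigma> G = G'
        \<and> (\<forall>v \<in> verts G. fst p v = fst p' (iso_verts \<sigma> v))
        \<and> (\<forall>e \<in> arcs G. snd p e = snd p' (iso_arcs \<sigma> e)))"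

text \<open>Multi-out-split homomorphisms to \<open>H\<close>, up to isomorphism over \<open>H\<close>.\<close>

definition multi_out_split_hom ::
  "('v1, 'e1) pre_digraph \<Rightarrow> ('v, 'e) pre_digraph \<Rightarrow> ('v1, 'e1, 'v, 'e) graph_map \<Rightarrow> bool" where
  "multi_out_split_hom G H p \<longleftrightarrow>
     (\<exists>m \<epsilon>. multi_split_data H m \<epsilon> \<and> isomorphic_over G p (multi_out_split H m \<epsilon>) split_proj)"


section \<open>The graph inverse semigroup\<close>

text \<open>A finite path is its initial vertex together with its list of edges, so that paths of length
  \<open>0\<close> are vertices.\<close>

type_synonym ('v, 'e) path = "'v \<times> 'e list"

definition FP :: "('v, 'e) pre_digraph \<Rightarrow> ('v, 'e) path set" where
  "FP E = {(u, p). \<exists>v. pre_digraph.awalk E u p v}"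

definition path_target :: "('v, 'e) pre_digraph \<Rightarrow> ('v, 'e) path \<Rightarrow> 'v" where
  "path_target E \<alpha> = pre_digraph.awlast E (fst \<alpha>) (snd \<alpha>)"

definition vert_path :: "'v \<Rightarrow> ('v, 'e) path" where
  "vert_path v = (v, [])"

definition arc_path :: "('v, 'e) pre_digraph \<Rightarrow> 'e \<Rightarrow> ('v, 'e) path" where
  "arc_path E e = (tail E e, [e])"

text \<open>\<^term>\<open>None\<close> is the zero element.\<close>

type_synonym ('v, 'e) gis = "(('v, 'e) path \<times> ('v, 'e) path) option"

definition gis_carrier :: "('v, 'e) pre_digraph \<Rightarrow> ('v, 'e) gis set" where
  "gis_carrier E =
     insert None (Some ` {(\<alpha>, \<beta>). \<alpha> \<in> FP E \<and> \<beta> \<in> FP E \<and> path_target E \<alpha> = path_target E \<beta>})"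

text \<open>\<open>path_prefix \<beta> \<gamma>\<close> says \<open>\<gamma> = \<beta>\<gamma>'\<close> for a path \<open>\<gamma>'\<close>, and \<open>path_append \<alpha> \<beta> \<gamma>\<close> is then \<open>\<alpha>\<gamma>'\<close>.\<close>

definition path_prefix :: "('v, 'e) path \<Rightarrow> ('v, 'e) path \<Rightarrow> bool" where
  "path_prefix \<beta> \<gamma> \<longleftrightarrow> fst \<beta> = fst \<gamma> \<and> prefix (snd \<beta>) (snd \<gamma>)"

definition path_append :: "('v, 'e) path \<Rightarrow> ('v, 'e) path \<Rightarrow> ('v, 'e) path \<Rightarrow> ('v, 'e) path" where
  "path_append \<alpha> \<beta> \<gamma> = (fst \<alpha>, snd \<alpha> @ drop (length (snd \<beta>)) (snd \<gamma>))"

fun gis_mult :: "('v, 'e) gis \<Rightarrow> ('v, 'e) gis \<Rightarrow> ('v, 'e) gis" where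
  "gis_mult (Some (\<alpha>, \<beta>)) (Some (\<gamma>, \<delta>)) =
     (if path_prefix \<beta> \<gamma> then Some (path_append \<alpha> \<beta> \<gamma>, \<delta>)
      else if path_prefix \<gamma> \<beta> then Some (\<alpha>, path_append \<delta> \<gamma> \<beta>)
      else None)"
| "gis_mult _ _ = None"

definition gis_star :: "('v, 'e) gis \<Rightarrow> ('v, 'e) gis" where
  "gis_star = map_option (\<lambda>(\<alpha>, \<beta>). (\<beta>, \<alpha>))"

definition gis_le :: "('v, 'e) gis \<Rightarrow> ('v, 'e) gis \<Rightarrow> bool" where
  "gis_le s t \<longleftrightarrow> gis_mult (gis_mult s (gis_star s)) t = s"

definition extended_path_hom ::
  "('v1, 'e1) pre_digraph \<Rightarrow> ('v2, 'e2) pre_digraph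
     \<Rightarrow> (('v1, 'e1) gis \<Rightarrow> ('v2, 'e2) gis) \<Rightarrow> bool" where
  "extended_path_hom E F \<phi> \<longleftrightarrow>
     \<phi> \<in> gis_carrier E \<rightarrow> gis_carrier F
   \<and> (\<forall>s \<in> gis_carrier E. \<forall>t \<in> gis_carrier E. \<phi> (gis_mult s t) = gis_mult (\<phi> s) (\<phi> t))
   \<and> \<phi> None = None"

definition regular_extended_path_hom ::
  "('v1, 'e1) pre_digraph \<Rightarrow> ('v2, 'e2) pre_digraph
     \<Rightarrow> (('v1, 'e1) gis \<Rightarrow> ('v2, 'e2) gis) \<Rightarrow> bool" where
  "regular_extended_path_hom E F \<phi> \<longleftrightarrow>
     extended_path_hom E F \<phi>
   \<and> (\<forall>u \<in> regular_verts E. \<forall>t \<in> gis_carrier F.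
        t \<noteq> None \<and> gis_le t (\<phi> (Some (vert_path u, vert_path u))) \<longrightarrow>
        (\<exists>e \<in> out_arcs E u. gis_mult t (\<phi> (Some (arc_path E e, arc_path E e))) \<noteq> None))"


section \<open>*-algebras\<close>

text \<open>C*-algebras need not be unital: the field \<^term>\<open>one\<close> inherited from \<^typ>\<open>'a ring\<close> is never
  used.  \<open>*\<close>-homomorphisms are purely algebraic, their continuity being automatic.\<close>

record 'a star_algebra = "'a ring" +
  scale :: "complex \<Rightarrow> 'a \<Rightarrow> 'a"
  star :: "'a \<Rightarrow> 'a"
  cnorm :: "'a \<Rightarrow> real"

definition star_hom ::
  "('a, 'r) star_algebra_scheme \<Rightarrow> ('b, 's) star_algebra_scheme \<Rightarrow> ('a \<Rightarrow> 'b) \<Rightarrow> bool" where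
  "star_hom A B \<psi> \<longleftrightarrow>
     \<psi> \<in> carrier A \<rightarrow> carrier B
   \<and> (\<forall>x \<in> carrier A. \<forall>y \<in> carrier A. \<psi> (x \<oplus>\<^bsub>A\<^esub> y) = \<psi> x \<oplus>\<^bsub>B\<^esub> \<psi> y)
   \<and> (\<forall>x \<in> carrier A. \<forall>y \<in> carrier A. \<psi> (x \<otimes>\<^bsub>A\<^esub> y) = \<psi> x \<otimes>\<^bsub>B\<^esub> \<psi> y)
   \<and> (\<forall>c. \<forall>x \<in> carrier A. \<psi> (scale A c x) = scale B c (\<psi> x))
   \<and> (\<forall>x \<in> carrier A. \<psi> (star A x) = star B (\<psi> x))"

definition star_iso ::
  "('a, 'r) star_algebra_scheme \<Rightarrow> ('b, 's) star_algebra_scheme \<Rightarrow> ('a \<Rightarrow> 'b) \<Rightarrow> bool" where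
  "star_iso A B \<psi> \<longleftrightarrow> star_hom A B \<psi> \<and> bij_betw \<psi> (carrier A) (carrier B)"


section \<open>The free *-algebra on the vertices and edges\<close>

datatype 'x word = Word (letters: "'x list")

instantiation word :: (type) monoid_add
begin

definition zero_word :: "'a word" where
  "zero_word = Word []"

definition plus_word :: "'a word \<Rightarrow> 'a word \<Rightarrow> 'a word" where
  "plus_word a b = Word (letters a @ letters b)"

instance
  by standard (simp_all add: zero_word_def plus_word_def)

end

datatype ('v, 'e) gen = Vert 'v | Arc 'e

text \<open>The letter \<open>(x, True)\<close> stands for the adjoint of the generator \<open>x\<close>.  Multiplication in
  \<open>free_alg\<close> is that of the monoid algebra of \<^typ>\<open>'x word\<close>, hence noncommutative.  The free (not
  necessarily unital) *-algebra on the generators of \<open>E\<close> is \<open>free_carrier E\<close>, in which the empty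
  word does not occur.\<close>

type_synonym ('v, 'e) free_alg = "(('v, 'e) gen \<times> bool) word \<Rightarrow>\<^sub>0 complex"

definition free_carrier :: "('v, 'e) pre_digraph \<Rightarrow> ('v, 'e) free_alg set" where
  "free_carrier E =
     {x. \<forall>k \<in> Poly_Mapping.keys x. letters k \<noteq> []
           \<and> fst ` set (letters k) \<subseteq> Vert ` verts E \<union> Arc ` arcs E}"

definition free_scale :: "complex \<Rightarrow> ('v, 'e) free_alg \<Rightarrow> ('v, 'e) free_alg" where
  "free_scale c x = Poly_Mapping.map ((*) c) x"

definition word_star :: "('x \<times> bool) word \<Rightarrow> ('x \<times> bool) word" where
  "word_star k = Word (rev (map (\<lambda>(x, b). (x, \<not> b)) (letters k)))"

definition free_star :: "('v, 'e) free_alg \<Rightarrow> ('v, 'e) free_alg" where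
  "free_star x = Poly_Mapping.map_key word_star (Poly_Mapping.map cnj x)"

definition gen_vert :: "'v \<Rightarrow> ('v, 'e) free_alg" where
  "gen_vert v = Poly_Mapping.single (Word [(Vert v, False)]) 1"

definition gen_arc :: "'e \<Rightarrow> ('v, 'e) free_alg" where
  "gen_arc e = Poly_Mapping.single (Word [(Arc e, False)]) 1"

definition graph_relations :: "('v, 'e) pre_digraph \<Rightarrow> ('v, 'e) free_alg set" where
  "graph_relations E =
     {free_star (gen_vert v) - gen_vert v | v. v \<in> verts E}
   \<union> {gen_vert v * gen_vert v - gen_vert v | v. v \<in> verts E}
   \<union> {gen_vert u * gen_vert v | u v. u \<in> verts E \<and> v \<in> verts E \<and> u \<noteq> v}
   \<union> {free_star (gen_arc e) * gen_arc e - gen_vert (head E e) | e. e \<in> arcs E}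
   \<union> {free_star (gen_arc e) * gen_arc e' | e e'. e \<in> arcs E \<and> e' \<in> arcs E \<and> e \<noteq> e'}
   \<union> {gen_vert (tail E e) * gen_arc e - gen_arc e | e. e \<in> arcs E}
   \<union> {gen_vert v - (\<Sum>e \<in> out_arcs E v. gen_arc e * free_star (gen_arc e)) | v. v \<in> regular_verts E}"


section \<open>The graph C*-algebra\<close>

text \<open>The universal C*-algebra on the above generators and relations is the Hausdorff completion of
  the free *-algebra in the largest C*-seminorm in which the relations vanish.  The supremum is
  finite because the generators are sent to partial isometries.\<close>

definition graph_seminorm :: "('v, 'e) pre_digraph \<Rightarrow> (('v, 'e) free_alg \<Rightarrow> real) \<Rightarrow> bool" where
  "graph_seminorm E p \<longleftrightarrow>
     (\<forall>x \<in> free_carrier E. 0 \<le> p x)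
   \<and> (\<forall>x \<in> free_carrier E. \<forall>y \<in> free_carrier E. p (x + y) \<le> p x + p y)
   \<and> (\<forall>c. \<forall>x \<in> free_carrier E. p (free_scale c x) = cmod c * p x)
   \<and> (\<forall>x \<in> free_carrier E. \<forall>y \<in> free_carrier E. p (x * y) \<le> p x * p y)
   \<and> (\<forall>x \<in> free_carrier E. p (free_star x * x) = (p x)\<^sup>2)
   \<and> (\<forall>r \<in> graph_relations E. p r = 0)"

definition graph_norm :: "('v, 'e) pre_digraph \<Rightarrow> ('v, 'e) free_alg \<Rightarrow> real" where
  "graph_norm E x = (SUP p \<in> {p. graph_seminorm E p}. p x)"

definition cauchy_seqs :: "('v, 'e) pre_digraph \<Rightarrow> (nat \<Rightarrow> ('v, 'e) free_alg) set" where
  "cauchy_seqs E =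
     {s. (\<forall>i. s i \<in> free_carrier E)
       \<and> (\<forall>r > 0. \<exists>N. \<forall>i \<ge> N. \<forall>j \<ge> N. graph_norm E (s i - s j) < r)}"

definition cauchy_rel ::
  "('v, 'e) pre_digraph \<Rightarrow> ((nat \<Rightarrow> ('v, 'e) free_alg) \<times> (nat \<Rightarrow> ('v, 'e) free_alg)) set" where
  "cauchy_rel E =
     {(s, t). s \<in> cauchy_seqs E \<and> t \<in> cauchy_seqs E
        \<and> (\<lambda>i. graph_norm E (s i - t i)) \<longlonglongrightarrow> 0}"

type_synonym ('v, 'e) cstar_elem = "(nat \<Rightarrow> ('v, 'e) free_alg) set"

definition graph_cstar :: "('v, 'e) pre_digraph \<Rightarrow> ('v, 'e) cstar_elem star_algebra" where
  "graph_cstar E =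
     \<lparr> carrier = cauchy_seqs E // cauchy_rel E,
       monoid.mult = (\<lambda>a b. \<Union>s \<in> a. \<Union>t \<in> b. cauchy_rel E `` {\<lambda>i. s i * t i}),
       one = undefined,
       zero = cauchy_rel E `` {\<lambda>_. 0},
       add = (\<lambda>a b. \<Union>s \<in> a. \<Union>t \<in> b. cauchy_rel E `` {\<lambda>i. s i + t i}),
       scale = (\<lambda>c a. \<Union>s \<in> a. cauchy_rel E `` {\<lambda>i. free_scale c (s i)}),
       star = (\<lambda>a. \<Union>s \<in> a. cauchy_rel E `` {\<lambda>i. free_star (s i)}),
       cnorm = (\<lambda>a. THE r. \<forall>s \<in> a. (\<lambda>i. graph_norm E (s i)) \<longlonglongrightarrow> r) \<rparr>"

definition S_vert :: "('v, 'e) pre_digraph \<Rightarrow> 'v \<Rightarrow> ('v, 'e) cstar_elem" where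
  "S_vert E v = cauchy_rel E `` {\<lambda>_. gen_vert v}"

definition S_arc :: "('v, 'e) pre_digraph \<Rightarrow> 'e \<Rightarrow> ('v, 'e) cstar_elem" where
  "S_arc E e = cauchy_rel E `` {\<lambda>_. gen_arc e}"

fun S_path :: "('v, 'e) pre_digraph \<Rightarrow> ('v, 'e) path \<Rightarrow> ('v, 'e) cstar_elem" where
  "S_path E (u, []) = S_vert E u"
| "S_path E (u, [e]) = S_arc E e"
| "S_path E (u, e # e' # es) = S_arc E e \<otimes>\<^bsub>graph_cstar E\<^esub> S_path E (head E e, e' # es)"

fun S_gis :: "('v, 'e) pre_digraph \<Rightarrow> ('v, 'e) gis \<Rightarrow> ('v, 'e) cstar_elem" where
  "S_gis E None = \<zero>\<^bsub>graph_cstar E\<^esub>"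
| "S_gis E (Some (\<alpha>, \<beta>)) = S_path E \<alpha> \<otimes>\<^bsub>graph_cstar E\<^esub> star (graph_cstar E) (S_path E \<beta>)"


section \<open>Induced *-homomorphisms\<close>

text \<open>The *-homomorphism sending \<open>S\<^sub>v\<close> to \<open>tv v\<close> and \<open>S\<^sub>e\<close> to \<open>te e\<close>.\<close>

definition cstar_hom_of ::
  "('v, 'e) pre_digraph \<Rightarrow> ('b, 's) star_algebra_scheme \<Rightarrow> ('v \<Rightarrow> 'b) \<Rightarrow> ('e \<Rightarrow> 'b)
     \<Rightarrow> ('v, 'e) cstar_elem \<Rightarrow> 'b" where
  "cstar_hom_of E B tv te =
     (THE \<psi>. \<psi> \<in> extensional (carrier (graph_cstar E))
        \<and> star_hom (graph_cstar E) B \<psi>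
        \<and> (\<forall>v \<in> verts E. \<psi> (S_vert E v) = tv v)
        \<and> (\<forall>e \<in> arcs E. \<psi> (S_arc E e) = te e))"

definition cstar_pullback ::
  "('v1, 'e1) pre_digraph \<Rightarrow> ('v, 'e) pre_digraph \<Rightarrow> ('v1, 'e1, 'v, 'e) graph_map
     \<Rightarrow> ('v, 'e) cstar_elem \<Rightarrow> ('v1, 'e1) cstar_elem" where
  "cstar_pullback G H h =
     cstar_hom_of H (graph_cstar G)
       (\<lambda>v. \<Oplus>\<^bsub>graph_cstar G\<^esub>u \<in> {u \<in> verts G. fst h u = v}. S_vert G u)
       (\<lambda>e. \<Oplus>\<^bsub>graph_cstar G\<^esub>x \<in> {x \<in> arcs G. snd h x = e}. S_arc G x)"

definition cstar_pushforward ::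
  "('v1, 'e1) pre_digraph \<Rightarrow> ('v2, 'e2) pre_digraph \<Rightarrow> (('v1, 'e1) gis \<Rightarrow> ('v2, 'e2) gis)
     \<Rightarrow> ('v1, 'e1) cstar_elem \<Rightarrow> ('v2, 'e2) cstar_elem" where
  "cstar_pushforward E F \<phi> =
     cstar_hom_of E (graph_cstar F)
       (\<lambda>v. S_gis F (\<phi> (Some (vert_path v, vert_path v))))
       (\<lambda>e. S_gis F (\<phi> (Some (arc_path E e, vert_path (head E e)))))"

end

theory Submission
  imports Defs "HOL-Library.Function_Algebras"
begin

text \<open>
  The inverse of \<open>f\<^sup>*\<close> is verified on generators: \<open>\<phi>\<^sub>* \<circ> g\<^sup>* \<circ> f\<^sup>*\<close> and \<open>f\<^sup>* \<circ> \<phi>\<^sub>* \<circ> g\<^sup>*\<close> both fix the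
  vertex projections and the edge partial isometries.  This uses only that \<open>S\<^sub>w\<close> is the sum of the range
  projections of \<open>e\<^sub>1, \<dots>, e\<^sub>n\<close> in \<open>C\<^sup>*(E)\<close>, and the same relation at the regular vertices \<open>w\<^sup>i\<close> of
  \<open>E\<^sub>O\<close>.  Here \<open>g\<close> sends \<open>w\<^sup>k\<close> to the \<open>w\<^sup>i\<close> whose class contains \<open>e\<^sub>k\<close>; it exhibits the maximal out-split
  as the multi-out-split of \<open>E\<^sub>O\<close> in which all copies of one edge emitted by \<open>w\<close> form a class.

  That a \<open>*\<close>-homomorphism is determined by its values on generators needs its continuity.  If
  \<open>a = a\<^sup>*\<close> has norm \<open>< 1\<close>, then \<open>1 - a\<^sup>2 = b\<^sup>2\<close> for a self-adjoint \<open>b\<close> commuting with \<open>a\<close>, so that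
  \<open>a + \<i> b\<close> is unitary; hence every \<open>*\<close>-homomorphism maps \<open>a\<close> to an element of norm at most \<open>1\<close>.
\<close>

section \<open>Automatic continuity of *-homomorphisms\<close>

text \<open>The obstacle is that \<open>star_hom\<close> is purely algebraic while
  \<open>cstar_hom_of\<close> is a definite description: before f^* and \<phi>_* can even be
  evaluated, there must be exactly one algebraic *-homomorphism with the prescribed values on
  generators. Hence continuity is proved for all of them, by comparing C*-seminorms: the norm of the
  image is a C*-seminorm q on the source, and q is bounded by any complete C*-seminorm p whose null
  elements it annihilates. The square root is a limit, so p has to be complete; the free algebra is
  not known to be, and the comparison takes place on its Cauchy sequences. No quotient and no unit
  enter there. Identities hold modulo elements of seminorm zero, and the carrier is a subset of an
  ambient ring on all of which the algebraic laws hold (a monoid algebra, or sequences in it). For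
  existence, the relations are checked on polynomials in the generators. Both f and g are treated as
  one kind of map, \<open>graph_cover\<close>, whose fibre sums satisfy the relations.\<close>

locale star_alg =
  fixes C :: "'a::ring set" and sc :: "complex \<Rightarrow> 'a \<Rightarrow> 'a" and st :: "'a \<Rightarrow> 'a"
  assumes zero_in: "0 \<in> C"
    and add_in: "x \<in> C \<Longrightarrow> y \<in> C \<Longrightarrow> x + y \<in> C"
    and mult_in: "x \<in> C \<Longrightarrow> y \<in> C \<Longrightarrow> x * y \<in> C"
    and sc_in: "x \<in> C \<Longrightarrow> sc c x \<in> C"
    and st_in: "x \<in> C \<Longrightarrow> st x \<in> C"
    and sc_add: "sc c (x + y) = sc c x + sc c y"
    and add_sc: "sc (c + d) x = sc c x + sc d x"
    and sc_sc: "sc c (sc d x) = sc (c * d) x"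
    and sc_one: "sc 1 x = x"
    and sc_mult: "sc c x * y = sc c (x * y)"
    and mult_sc: "x * sc c y = sc c (x * y)"
    and st_add: "st (x + y) = st x + st y"
    and st_mult: "st (x * y) = st y * st x"
    and st_st: "st (st x) = x"
    and st_sc: "st (sc c x) = sc (cnj c) (st x)"
begin

lemma sc_zero_left [simp]: "sc 0 x = 0"
  using add_sc[of 0 0 x] by simp

lemma sc_zero_right [simp]: "sc c 0 = 0"
  using sc_add[of c 0 0] by simp

lemma sc_minus_left: "sc (- c) x = - sc c x"
  using add_sc[of c "- c" x] by (simp add: eq_neg_iff_add_eq_0 add.commute)

lemma sc_minus_one: "sc (- 1) x = - x"
  by (simp add: sc_minus_left sc_one)

lemma sc_minus: "sc c (- x) = - sc c x"
  using sc_add[of c x "- x"] by (simp add: eq_neg_iff_add_eq_0 add.commute)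

lemma sc_diff: "sc c (x - y) = sc c x - sc c y"
  using sc_add[of c x "- y"] by (simp add: sc_minus)

lemma sc_half: "sc (1/2) (x + x) = x"
  using add_sc[of "1/2" "1/2" x] by (simp add: sc_add sc_one)

lemma st_zero [simp]: "st 0 = 0"
  using st_add[of 0 0] by simp

lemma st_minus: "st (- x) = - st x"
  using st_add[of x "- x"] by (simp add: eq_neg_iff_add_eq_0 add.commute)

lemma st_diff: "st (x - y) = st x - st y"
  using st_add[of x "- y"] by (simp add: st_minus)

lemma st_sum: "st (sum f A) = (\<Sum>i\<in>A. st (f i))"
  by (induction A rule: infinite_finite_induct) (simp_all add: st_add)

lemma uminus_in: "x \<in> C \<Longrightarrow> - x \<in> C"
  using sc_in[of x "- 1"] by (simp add: sc_minus_one)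

lemma diff_in: "x \<in> C \<Longrightarrow> y \<in> C \<Longrightarrow> x - y \<in> C"
  using add_in[of x "- y"] by (simp add: uminus_in)

lemma sum_in: "(\<And>i. i \<in> A \<Longrightarrow> f i \<in> C) \<Longrightarrow> sum f A \<in> C"
  by (induction A rule: infinite_finite_induct) (simp_all add: zero_in add_in)

lemmas closed = zero_in add_in mult_in sc_in st_in uminus_in diff_in sum_in

end

section \<open>C*-seminorms and equality modulo null elements\<close>

locale cstar_seminorm = star_alg C sc st
  for C :: "'a::ring set" and sc :: "complex \<Rightarrow> 'a \<Rightarrow> 'a" and st :: "'a \<Rightarrow> 'a" +
  fixes p :: "'a \<Rightarrow> real"
  assumes p_nonneg: "x \<in> C \<Longrightarrow> 0 \<le> p x"
    and p_add: "x \<in> C \<Longrightarrow> y \<in> C \<Longrightarrow> p (x + y) \<le> p x + p y"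
    and p_sc: "x \<in> C \<Longrightarrow> p (sc c x) = cmod c * p x"
    and p_mult: "x \<in> C \<Longrightarrow> y \<in> C \<Longrightarrow> p (x * y) \<le> p x * p y"
    and p_cstar: "x \<in> C \<Longrightarrow> p (st x * x) = (p x)\<^sup>2"
begin

lemma p_zero [simp]: "p 0 = 0"
  using p_sc[OF zero_in, of 0] by simp

lemma p_minus: "x \<in> C \<Longrightarrow> p (- x) = p x"
  using p_sc[of x "- 1"] by (simp add: sc_minus_one)

lemma p_diff: "x \<in> C \<Longrightarrow> y \<in> C \<Longrightarrow> p (x - y) \<le> p x + p y"
  using p_add[of x "- y"] by (simp add: uminus_in p_minus)

lemma p_diff_commute: "x \<in> C \<Longrightarrow> y \<in> C \<Longrightarrow> p (x - y) = p (y - x)"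
  using p_minus[of "x - y"] by (simp add: diff_in)

lemma p_triangle: "x \<in> C \<Longrightarrow> y \<in> C \<Longrightarrow> z \<in> C \<Longrightarrow> p (x - z) \<le> p (x - y) + p (y - z)"
  using p_add[of "x - y" "y - z"] by (simp add: diff_in)

lemma p_le_diff: "x \<in> C \<Longrightarrow> y \<in> C \<Longrightarrow> p x \<le> p y + p (x - y)"
  using p_add[of y "x - y"] by (simp add: diff_in)

lemma abs_p_diff: "x \<in> C \<Longrightarrow> y \<in> C \<Longrightarrow> \<bar>p x - p y\<bar> \<le> p (x - y)"
  using p_le_diff[of x y] p_le_diff[of y x] p_diff_commute[of x y] by linarith

text \<open>The C*-identity and submultiplicativity bound the square of \<open>p y\<close> by
  \<open>p (st y) * p y\<close>; after cancelling \<open>p y\<close>, this is applied to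
  \<open>x\<close> and to \<open>st x\<close>.\<close>

lemma p_st: assumes "x \<in> C" shows "p (st x) = p x"
proof -
  have le: "p y \<le> p (st y)" if "y \<in> C" for y
  proof (cases "p y = 0")
    case True
    then show ?thesis using p_nonneg[OF st_in[OF that]] by simp
  next
    case False
    have "p y * p y \<le> p (st y) * p y"
      using p_cstar[OF that] p_mult[OF st_in[OF that] that] by (simp add: power2_eq_square)
    with False p_nonneg[OF that] show ?thesis by simp
  qed
  from le[OF assms] le[OF st_in[OF assms]] show ?thesis by (simp add: st_st)
qed

text \<open>Equality in the Hausdorff quotient. Membership in \<open>C\<close> is included so that
  chains of \<open>\<approx>\<close> carry the closure conditions along.\<close>

definition eqv :: "'a \<Rightarrow> 'a \<Rightarrow> bool" (infix "\<approx>" 50) where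
  "x \<approx> y \<longleftrightarrow> x \<in> C \<and> y \<in> C \<and> p (x - y) = 0"

lemma eqvI: "x \<in> C \<Longrightarrow> y \<in> C \<Longrightarrow> p (x - y) \<le> 0 \<Longrightarrow> x \<approx> y"
  using p_nonneg[of "x - y"] by (auto simp: eqv_def diff_in)

lemma eqv_refl: "x \<in> C \<Longrightarrow> x \<approx> x"
  by (simp add: eqv_def)

lemma eqv_sym: "x \<approx> y \<Longrightarrow> y \<approx> x"
  by (simp add: eqv_def p_diff_commute)

lemma eqv_trans [trans]: "x \<approx> y \<Longrightarrow> y \<approx> z \<Longrightarrow> x \<approx> z"
  using p_triangle[of x y z] by (auto simp: eqv_def intro!: eqvI[unfolded eqv_def] antisym p_nonneg diff_in)

lemma eqv_p: "x \<approx> y \<Longrightarrow> p x = p y"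
  using abs_p_diff[of x y] by (auto simp: eqv_def)

lemma eqv_zero_iff: "x \<approx> 0 \<longleftrightarrow> x \<in> C \<and> p x = 0"
  by (auto simp: eqv_def zero_in)

lemma eqv_diff_zero_iff: "x \<approx> y \<longleftrightarrow> x \<in> C \<and> y \<in> C \<and> x - y \<approx> 0"
  by (auto simp: eqv_def zero_in diff_in)

lemma eqv_add:
  assumes "x \<approx> x'" "y \<approx> y'" shows "x + y \<approx> x' + y'"
proof (rule eqvI)
  have "p ((x - x') + (y - y')) \<le> p (x - x') + p (y - y')"
    using assms by (intro p_add diff_in) (auto simp: eqv_def)
  then show "p (x + y - (x' + y')) \<le> 0"
    using assms by (simp add: eqv_def algebra_simps)
qed (use assms in \<open>auto simp: eqv_def add_in\<close>)

lemma eqv_mult: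
  assumes "x \<approx> x'" "y \<approx> y'" shows "x * y \<approx> x' * y'"
proof (rule eqvI)
  note [simp] = diff_in mult_in
  have C: "x \<in> C" "x' \<in> C" "y \<in> C" "y' \<in> C" using assms by (auto simp: eqv_def)
  have "p (x * y - x' * y') \<le> p ((x - x') * y) + p (x' * (y - y'))"
    using C p_add[of "(x - x') * y" "x' * (y - y')"] by (simp add: algebra_simps)
  also have "\<dots> \<le> p (x - x') * p y + p x' * p (y - y')"
    using C by (intro add_mono p_mult) auto
  finally show "p (x * y - x' * y') \<le> 0" using assms by (simp add: eqv_def)
qed (use assms in \<open>auto simp: eqv_def mult_in\<close>)

lemma eqv_st: "x \<approx> y \<Longrightarrow> st x \<approx> st y"
  using p_st[of "x - y"] by (auto simp: eqv_def st_in diff_in st_diff)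

lemma eqv_sc: "x \<approx> y \<Longrightarrow> sc c x \<approx> sc c y"
  using p_sc[of "x - y" c] by (auto simp: eqv_def sc_in diff_in sc_diff)

lemma eqv_minus: "x \<approx> y \<Longrightarrow> - x \<approx> - y"
  using eqv_sc[of x y "- 1"] by (simp add: sc_minus_one)

lemma eqv_diff: "x \<approx> x' \<Longrightarrow> y \<approx> y' \<Longrightarrow> x - y \<approx> x' - y'"
  using eqv_add[of x x' "- y" "- y'"] by (simp add: eqv_minus)

lemma eqv_sum: "(\<And>i. i \<in> A \<Longrightarrow> f i \<approx> g i) \<Longrightarrow> sum f A \<approx> sum g A"
  by (induction A rule: infinite_finite_induct) (simp_all add: eqv_refl zero_in eqv_add)

end

section \<open>Square roots under a complete C*-seminorm, and domination of other seminorms\<close>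

locale complete_cstar_seminorm = cstar_seminorm C sc st p
  for C :: "'a::ring set" and sc :: "complex \<Rightarrow> 'a \<Rightarrow> 'a" and st :: "'a \<Rightarrow> 'a" and p :: "'a \<Rightarrow> real" +
  assumes complete: "(\<And>i. s i \<in> C) \<Longrightarrow>
    (\<And>r. r > 0 \<Longrightarrow> \<exists>M. \<forall>i\<ge>M. \<forall>j\<ge>M. p (s i - s j) < r) \<Longrightarrow>
    \<exists>l\<in>C. (\<lambda>i. p (s i - l)) \<longlonglongrightarrow> 0"
begin

lemma geometric_convergent:
  assumes s: "\<And>i. s i \<in> C" and r: "0 \<le> r" "r < 1"
    and step: "\<And>i. p (s (Suc i) - s i) \<le> r ^ i"
  shows "\<exists>l\<in>C. (\<lambda>i. p (s i - l)) \<longlonglongrightarrow> 0"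
proof (rule complete[OF s])
  fix \<epsilon> :: real assume \<epsilon>: "\<epsilon> > 0"
  \<comment> \<open>The subtracted term is the exact remainder of the geometric sum; with it the
    bound closes under induction on \<open>k\<close>.\<close>
  have far: "p (s (i + k) - s i) \<le> r ^ i / (1 - r) - r ^ (i + k) / (1 - r)" for i k
  proof (induction k)
    case (Suc k)
    have "p (s (Suc (i + k)) - s i) \<le> p (s (Suc (i + k)) - s (i + k)) + p (s (i + k) - s i)"
      by (intro p_triangle s)
    also have "\<dots> \<le> r ^ (i + k) + (r ^ i / (1 - r) - r ^ (i + k) / (1 - r))"
      by (intro add_mono step Suc)
    also have "\<dots> = r ^ i / (1 - r) - r ^ (i + Suc k) / (1 - r)"
    proof -
      have "r ^ (i + k) = r ^ (i + k) * (1 - r) / (1 - r)" using r by simp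
      also have "\<dots> = r ^ (i + k) / (1 - r) - r ^ (i + Suc k) / (1 - r)"
        by (simp add: left_diff_distrib right_diff_distrib diff_divide_distrib)
      finally show ?thesis by linarith
    qed
    finally show ?case by simp
  qed simp
  have "(\<lambda>i. r ^ i) \<longlonglongrightarrow> 0" using r by (intro LIMSEQ_realpow_zero) auto
  then have "(\<lambda>i. r ^ i / (1 - r)) \<longlonglongrightarrow> 0 / (1 - r)" using r by (intro tendsto_intros) auto
  then have "\<forall>\<^sub>F i in sequentially. r ^ i / (1 - r) < \<epsilon>"
    using \<epsilon> by (intro order_tendstoD(2)[of _ 0]) auto
  then obtain M where M: "\<And>i. i \<ge> M \<Longrightarrow> r ^ i / (1 - r) < \<epsilon>"
    unfolding eventually_sequentially by blast
  have "p (s j - s i) < \<epsilon>" if le: "i \<ge> M" "i \<le> j" for i j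
  proof -
    obtain k where k: "j = i + k" using le_Suc_ex[OF le(2)] by blast
    have "0 \<le> r ^ (i + k) / (1 - r)" using r by simp
    then show ?thesis using far[of i k] M[OF le(1)] unfolding k by linarith
  qed
  then have "p (s i - s j) < \<epsilon>" if "i \<ge> M" "j \<ge> M" for i j
    using that p_diff_commute[OF s s, of i j] by (metis linear)
  then show "\<exists>M. \<forall>i\<ge>M. \<forall>j\<ge>M. p (s i - s j) < \<epsilon>" by blast
qed

text \<open>In unital terms, \<open>(1 - c)\<^sup>2 = 1 - a\<^sup>2\<close>; \<open>c\<close> is the fixed point of
  \<open>c \<mapsto> (a\<^sup>2 + c\<^sup>2) / 2\<close> on a ball of radius \<open>\<rho> < 1\<close>.\<close>

lemma exists_sqrt:
  assumes a: "a \<in> C" "st a = a" "p a < 1"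
  shows "\<exists>c\<in>C. st c \<approx> c \<and> c * a \<approx> a * c \<and> c + c - c * c \<approx> a * a"
proof -
  \<comment> \<open>The smaller root of t = ((p a)^2 + t^2) / 2, the scalar majorant of
    \<open>f\<close>: the ball of this radius is mapped into itself, and \<open>\<rho> < 1\<close>
    makes \<open>f\<close> a contraction there.\<close>
  define \<rho> where "\<rho> = 1 - sqrt (1 - (p a)\<^sup>2)"
  define f where "f c = sc (1/2) (a * a + c * c)" for c
  define s where "s k = (f ^^ k) 0" for k
  have pa: "0 \<le> p a" by (rule p_nonneg[OF a(1)])
  have q1: "(p a)\<^sup>2 < 1" using a(3) pa by (simp add: power_less_one_iff)
  have \<rho>: "0 \<le> \<rho>" "\<rho> < 1" using q1 by (auto simp: \<rho>_def)
  have \<rho>_fix: "((p a)\<^sup>2 + \<rho>\<^sup>2) / 2 = \<rho>"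
    using q1 by (simp add: \<rho>_def power2_eq_square[of "1 - _"] algebra_simps diff_divide_distrib)
  have s0: "s 0 = 0" and s_Suc: "s (Suc k) = f (s k)" for k by (simp_all add: s_def)
  have sC: "s k \<in> C" for k by (induction k) (auto simp: s0 s_Suc f_def a closed)
  have st_s: "st (s k) = s k" for k
    by (induction k) (auto simp: s0 s_Suc f_def a st_sc st_add st_mult)
  have s_a: "s k * a = a * s k" for k
  proof (induction k)
    case (Suc k)
    have "s k * s k * a = a * (s k * s k)" by (metis Suc mult.assoc)
    then show ?case
      by (simp add: s_Suc f_def sc_mult mult_sc distrib_left distrib_right mult.assoc)
  qed (simp add: s0)
  have p_s: "p (s k) \<le> \<rho>" for k
  proof (induction k)
    case (Suc k)
    have "p (f (s k)) = p (a * a + s k * s k) / 2"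
      by (simp add: f_def p_sc closed a sC)
    also have "\<dots> \<le> (p (a * a) + p (s k * s k)) / 2"
      by (intro divide_right_mono p_add) (auto simp: closed a sC)
    also have "\<dots> \<le> (p a * p a + p (s k) * p (s k)) / 2"
      by (intro divide_right_mono add_mono p_mult) (auto simp: a sC)
    also have "\<dots> \<le> (p a * p a + \<rho> * \<rho>) / 2"
      by (intro divide_right_mono add_mono mult_mono Suc p_nonneg sC \<rho>) (auto simp: a)
    also have "\<dots> = \<rho>" using \<rho>_fix by (simp add: power2_eq_square)
    finally show ?case by (simp add: s_Suc)
  qed (simp add: s0 \<rho>)
  have step: "p (s (Suc k) - s k) \<le> \<rho> ^ k" for k
  proof (induction k)
    case 0
    show ?case using p_s[of 1] \<rho> by (simp add: s0)
  next
    case (Suc k)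
    let ?d = "s (Suc k) - s k"
    have d: "?d \<in> C" by (simp add: sC closed)
    \<comment> \<open>Noncommutative difference of squares, x^2 - y^2 = x (x - y) + (x - y) y; the
      factors next to \<open>?d\<close> have seminorm at most \<open>\<rho>\<close>.\<close>
    have "s (Suc (Suc k)) - s (Suc k) = sc (1/2) (s (Suc k) * ?d + ?d * s k)"
    proof -
      have "s (Suc (Suc k)) = sc (1/2) (a * a + s (Suc k) * s (Suc k))"
        by (simp only: s_Suc[of "Suc k"] f_def)
      moreover have "s (Suc k) = sc (1/2) (a * a + s k * s k)"
        by (simp only: s_Suc[of k] f_def)
      ultimately have "s (Suc (Suc k)) - s (Suc k)
          = sc (1/2) (a * a + s (Suc k) * s (Suc k)) - sc (1/2) (a * a + s k * s k)"
        by (rule arg_cong2)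
      also have "\<dots> = sc (1/2) (s (Suc k) * ?d + ?d * s k)"
        by (simp only: sc_diff[symmetric]) (simp add: algebra_simps)
      finally show ?thesis .
    qed
    then have "p (s (Suc (Suc k)) - s (Suc k)) = p (s (Suc k) * ?d + ?d * s k) / 2"
      by (simp add: p_sc closed sC)
    also have "\<dots> \<le> (p (s (Suc k)) * p ?d + p ?d * p (s k)) / 2"
      by (intro divide_right_mono order.trans[OF p_add] add_mono p_mult) (auto simp: sC closed)
    also have "\<dots> \<le> (\<rho> * p ?d + p ?d * \<rho>) / 2"
      by (intro divide_right_mono add_mono mult_right_mono mult_left_mono p_s p_nonneg d) auto
    also have "\<dots> = \<rho> * p ?d" by simp
    also have "\<dots> \<le> \<rho> * \<rho> ^ k" by (intro mult_left_mono Suc \<rho>)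
    finally show ?case by simp
  qed
  obtain c where c: "c \<in> C" and lim: "(\<lambda>i. p (s i - c)) \<longlonglongrightarrow> 0"
    using geometric_convergent[OF sC \<rho> step] by blast
  have small: "x \<approx> y" if xy: "x \<in> C" "y \<in> C" and g: "g \<longlonglongrightarrow> 0" and "\<And>i. p (x - y) \<le> g i"
    for x y and g :: "nat \<Rightarrow> real"
    using that by (intro eqvI) (auto intro: LIMSEQ_le_const)
  have lim1: "(\<lambda>i. p (s (Suc i) - c)) \<longlonglongrightarrow> 0" using lim by (rule LIMSEQ_Suc)
  \<comment> \<open>The iterates are self-adjoint, commute with \<open>a\<close> and satisfy the
    recursion exactly, so each defect at \<open>c\<close> is bounded by distances from
    \<open>c\<close> to iterates, which tend to 0.\<close>
  have "st c \<approx> c"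
  proof (rule small)
    show "(\<lambda>i. p (s i - c) + p (s i - c)) \<longlonglongrightarrow> 0" using tendsto_add[OF lim lim] by simp
    fix i
    have "p (st c - c) \<le> p (st c - s i) + p (s i - c)" by (intro p_triangle sC c st_in)
    also have "p (st c - s i) = p (s i - c)"
      using p_st[of "c - s i"] p_diff_commute[OF c sC, of i] by (simp add: st_diff st_s c sC closed)
    finally show "p (st c - c) \<le> p (s i - c) + p (s i - c)" .
  qed (auto simp: c closed)
  moreover have "c * a \<approx> a * c"
  proof (rule small)
    show "(\<lambda>i. p a * p (s i - c) + p (s i - c) * p a) \<longlonglongrightarrow> 0"
      using tendsto_add[OF tendsto_mult_left[OF lim, of "p a"] tendsto_mult_right[OF lim, of "p a"]] by simp
    fix i
    have "p (c * a - a * c) = p (a * (s i - c) - (s i - c) * a)"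
      by (simp add: right_diff_distrib left_diff_distrib s_a)
    also have "\<dots> \<le> p a * p (s i - c) + p (s i - c) * p a"
      by (intro order.trans[OF p_diff] add_mono p_mult) (auto simp: a sC c closed)
    finally show "p (c * a - a * c) \<le> p a * p (s i - c) + p (s i - c) * p a" .
  qed (auto simp: a c closed)
  moreover have "c + c - c * c \<approx> a * a"
  proof (rule small)
    show "(\<lambda>i. 2 * p (s (Suc i) - c) + (\<rho> * p (s i - c) + p (s i - c) * p c)) \<longlonglongrightarrow> 0"
      using tendsto_add[OF tendsto_mult_left[OF lim1, of 2]
          tendsto_add[OF tendsto_mult_left[OF lim, of \<rho>] tendsto_mult_right[OF lim, of "p c"]]] by simp
    fix i
    let ?d = "s i - c" and ?e = "s (Suc i) - c"
    have "s (Suc i) + s (Suc i) = sc (1/2) (a * a + s i * s i) + sc (1/2) (a * a + s i * s i)"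
      by (simp add: s_Suc f_def)
    also have "\<dots> = a * a + s i * s i" by (simp add: sc_add[symmetric] sc_half)
    finally have two: "s (Suc i) + s (Suc i) = a * a + s i * s i" .
    \<comment> \<open>The defect of the fixed point equation, written through the errors
      \<open>?d\<close> and \<open>?e\<close> by the same difference of squares.\<close>
    have "s i * ?d + ?d * c - (?e + ?e) = s i * s i - c * c + (c + c) - (s (Suc i) + s (Suc i))"
      by (simp add: algebra_simps)
    also have "\<dots> = c + c - c * c - a * a" unfolding two by (simp add: algebra_simps)
    finally have "p (c + c - c * c - a * a) = p (s i * ?d + ?d * c - (?e + ?e))"
      by (rule arg_cong[OF sym])
    also have "\<dots> \<le> (p (s i) * p ?d + p ?d * p c) + (p ?e + p ?e)"
      by (intro order.trans[OF p_diff] order.trans[OF p_add] add_mono p_mult order_refl)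
         (auto simp: sC c closed)
    also have "p (s i) * p ?d \<le> \<rho> * p ?d"
      by (intro mult_right_mono p_s p_nonneg) (auto simp: sC c closed)
    finally show "p (c + c - c * c - a * a)
        \<le> 2 * p ?e + (\<rho> * p ?d + p ?d * p c)" by simp
  qed (auto simp: a c closed)
  ultimately show ?thesis using c by blast
qed

text \<open>With \<open>(1 - c)\<^sup>2 = 1 - a\<^sup>2\<close>, the unitary of the argument is \<open>a + \<i> (1 - c)\<close>; letting it act on
  elements \<open>y\<close> avoids adjoining a unit.\<close>

theorem dominates:
  assumes q: "cstar_seminorm C sc st q"
    and null: "\<And>x. x \<in> C \<Longrightarrow> p x = 0 \<Longrightarrow> q x = 0"
    and x: "x \<in> C"
  shows "q x \<le> p x"
proof -
  interpret q: cstar_seminorm C sc st q by (rule q)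
  \<comment> \<open>Null elements of \<open>p\<close> are null for \<open>q\<close>, so the
    \<open>c\<close> obtained from the completeness of \<open>p\<close> satisfies its identities
    modulo \<open>q\<close> as well.\<close>
  have eqv: "q.eqv x y" if "x \<approx> y" for x y
    using that null[of "x - y"] by (auto simp: eqv_def q.eqv_def diff_in)
  have unit: "q a \<le> 1" if a: "a \<in> C" "st a = a" "p a < 1" for a
  proof -
    obtain c where c: "c \<in> C" and c1: "q.eqv (st c) c" and c2: "q.eqv (c * a) (a * c)"
      and c3: "q.eqv (c + c - c * c) (a * a)"
      using exists_sqrt[OF a] eqv by blast
    have c2': "q.eqv (c * a - a * c) 0" and c3': "q.eqv (a * a - (c + c - c * c)) 0"
      using c2 q.eqv_sym[OF c3] by (auto simp: q.eqv_diff_zero_iff[of "c * a"] q.eqv_diff_zero_iff[of "a * a"])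
    \<comment> \<open>With u = a + j (1 - c) the claim is q (u y) = q y. In unital terms u^* u = a^2
      + (1 - c)^2 + j (c a - a c), which is 1 modulo null elements, and the C*-identity turns this
      into an isometry.\<close>
    have iso: "q (a * y + sc j (y - c * y)) = q y" if y: "y \<in> C" and j: "j = \<i> \<or> j = - \<i>" for y j
    proof -
      let ?z = "y - c * y" and ?z' = "st y - st y * c"
      have jj: "cnj j = - j" "j * j = -1" using j by auto
      \<comment> \<open>The product once \<open>st c\<close> has been replaced by \<open>c\<close>,
        sorted so that each correction contains a factor that is null for \<open>q\<close>.\<close>
      let ?w = "st y * y + st y * (a * a - (c + c - c * c)) * y + sc j (st y * (c * a - a * c) * y)"
      have expand: "(A + sc (- j) Z') * (B + sc j Z) = A * B + sc j (A * Z - Z' * B) + Z' * Z"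
        for A B Z Z'
      proof -
        have "j * - j = 1" "- j * j = 1" using j by auto
        then have 1: "sc (- j) Z' * sc j Z = Z' * Z" by (simp only: sc_mult mult_sc sc_sc sc_one)
        have 2: "sc (- j) Z' * B = - sc j (Z' * B)" unfolding sc_mult by (rule sc_minus_left)
        have 3: "A * sc j Z = sc j (A * Z)" by (rule mult_sc)
        have "(A + sc (- j) Z') * (B + sc j Z)
            = A * B + A * sc j Z + (sc (- j) Z' * B + sc (- j) Z' * sc j Z)"
          by (simp only: distrib_left distrib_right ac_simps)
        also have "\<dots> = A * B + sc j (A * Z) + (- sc j (Z' * B) + Z' * Z)"
          unfolding 1 2 3 ..
        also have "\<dots> = A * B + sc j (A * Z - Z' * B) + Z' * Z"
          by (simp only: sc_diff) simp
        finally show ?thesis .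
      qed
      have "q.eqv (st ?z) ?z'"
        unfolding st_diff st_mult by (intro q.eqv_diff q.eqv_mult q.eqv_refl c1) (auto simp: y closed)
      then have "q.eqv (st (a * y + sc j ?z) * (a * y + sc j ?z))
          ((st y * a + sc (- j) ?z') * (a * y + sc j ?z))"
        unfolding st_add st_mult st_sc jj a(2)
        by (intro q.eqv_mult q.eqv_add q.eqv_sc q.eqv_refl) (auto simp: y a c closed)
      also have "(st y * a + sc (- j) ?z') * (a * y + sc j ?z)
          = st y * a * a * y + sc j (st y * a * ?z - ?z' * a * y) + ?z' * ?z"
        unfolding expand by (simp only: mult.assoc)
      also have "\<dots> = ?w"
        by (simp add: algebra_simps sc_add sc_diff)
      also have "q.eqv ?w (st y * y + st y * 0 * y + sc j (st y * 0 * y))"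
        using c2' c3' by (intro q.eqv_mult q.eqv_add q.eqv_sc q.eqv_refl) (auto simp: y a c closed)
      finally have "q.eqv (st (a * y + sc j ?z) * (a * y + sc j ?z)) (st y * y)" by simp
      from q.eqv_p[OF this] have "(q (a * y + sc j ?z))\<^sup>2 = (q y)\<^sup>2"
        by (simp add: q.p_cstar y a c closed)
      then show ?thesis by (simp add: power2_eq_iff_nonneg q.p_nonneg y a c closed)
    qed
    let ?z = "a - c * a"
    \<comment> \<open>\<open>a\<close> is the mean of the two unitaries with j = \<i> and j = -
      \<i>. Acting on \<open>a\<close> itself, they bound q (a a) = (q a)^2 by q a.\<close>
    have "2 * q (a * a) = q (a * a + a * a)"
      using q.p_sc[of "a * a" 2] add_sc[of 1 1 "a * a"] by (simp add: sc_one a closed)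
    also have "\<dots> = q ((a * a + sc \<i> ?z) + (a * a + sc (- \<i>) ?z))"
      by (simp add: sc_minus_left)
    also have "\<dots> \<le> q (a * a + sc \<i> ?z) + q (a * a + sc (- \<i>) ?z)"
      by (intro q.p_add) (auto simp: a c closed)
    also have "\<dots> = 2 * q a" by (simp add: iso a)
    finally have "(q a)\<^sup>2 \<le> q a" using q.p_cstar[OF a(1)] a(2) by simp
    then show ?thesis using q.p_nonneg[OF a(1)]
      by (cases "q a = 0") (auto simp: power2_eq_square)
  qed
  have sa: "q a \<le> p a" if a: "a \<in> C" "st a = a" for a
  proof (rule dense_ge)
    fix t assume t: "p a < t"
    then have t0: "0 < t" using p_nonneg[OF a(1)] by linarith
    \<comment> \<open>Every t > p a scales \<open>a\<close> into the open unit ball, and t may be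
      taken arbitrarily close to p a.\<close>
    have "q (sc (of_real (1 / t)) a) \<le> 1"
      by (rule unit) (use t t0 a in \<open>auto simp: closed st_sc p_sc norm_divide\<close>)
    then show "q a \<le> t" using t0 a by (simp add: q.p_sc norm_divide field_simps)
  qed
  have "(q x)\<^sup>2 = q (st x * x)" by (simp add: q.p_cstar x)
  also have "\<dots> \<le> p (st x * x)" by (rule sa) (auto simp: x closed st_mult st_st)
  also have "\<dots> = (p x)\<^sup>2" by (simp add: p_cstar x)
  finally show ?thesis using p_nonneg[OF x] by (rule power2_le_imp_le)
qed

end


section \<open>Completion of a C*-seminorm\<close>

text \<open>Squaring is monotone on nonnegative reals, so the C*-identity passes to the supremum.
  For scalars, one inequality comes from bounding \<open>p (sc c x)\<close>, the other by dividing
  by \<open>cmod c\<close>.\<close>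

lemma cstar_seminorm_SUP:
  assumes "P \<noteq> {}" and P: "\<And>p. p \<in> P \<Longrightarrow> cstar_seminorm C sc st p"
    and bdd: "\<And>x. x \<in> C \<Longrightarrow> bdd_above ((\<lambda>p. p x) ` P)"
  shows "cstar_seminorm C sc st (\<lambda>x. SUP p\<in>P. p x)"
proof -
  define S where "S x = (SUP p\<in>P. p x)" for x
  obtain p0 where p0: "p0 \<in> P" using \<open>P \<noteq> {}\<close> by blast
  interpret p0: cstar_seminorm C sc st p0 by (rule P[OF p0])
  note cl = p0.closed
  have up: "p x \<le> S x" if "p \<in> P" "x \<in> C" for p x
    unfolding S_def using that by (intro cSUP_upper bdd)
  have least: "S x \<le> b" if "\<And>p. p \<in> P \<Longrightarrow> p x \<le> b" for x b
    unfolding S_def using that \<open>P \<noteq> {}\<close> by (intro cSUP_least)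
  have S_nonneg: "0 \<le> S x" if "x \<in> C" for x
    using up[OF p0 that] p0.p_nonneg[OF that] by linarith
  have "cstar_seminorm C sc st S"
  proof
    show "S (x + y) \<le> S x + S y" if "x \<in> C" "y \<in> C" for x y
    proof (rule least)
      fix p assume p: "p \<in> P"
      interpret cstar_seminorm C sc st p by (rule P[OF p])
      show "p (x + y) \<le> S x + S y"
        using p_add[OF that] up[OF p that(1)] up[OF p that(2)] by linarith
    qed
    show "S (sc c x) = cmod c * S x" if x: "x \<in> C" for c x
    proof (rule antisym)
      show "S (sc c x) \<le> cmod c * S x"
      proof (rule least)
        fix p assume p: "p \<in> P"
        interpret cstar_seminorm C sc st p by (rule P[OF p])
        show "p (sc c x) \<le> cmod c * S x"
          using up[OF p x] by (simp add: p_sc x mult_left_mono)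
      qed
      show "cmod c * S x \<le> S (sc c x)"
      proof (cases "c = 0")
        case False
        have "S x \<le> S (sc c x) / cmod c"
        proof (rule least)
          fix p assume p: "p \<in> P"
          interpret cstar_seminorm C sc st p by (rule P[OF p])
          show "p x \<le> S (sc c x) / cmod c"
            using up[OF p p0.sc_in[OF x], of c] False by (simp add: p_sc x field_simps)
        qed
        with False show ?thesis by (simp add: field_simps)
      qed (simp add: S_nonneg p0.zero_in)
    qed
    show "S (x * y) \<le> S x * S y" if "x \<in> C" "y \<in> C" for x y
    proof (rule least)
      fix p assume p: "p \<in> P"
      interpret cstar_seminorm C sc st p by (rule P[OF p])
      have "p x * p y \<le> S x * S y"
        using that by (intro mult_mono up p p_nonneg S_nonneg)
      with p_mult[OF that] show "p (x * y) \<le> S x * S y" by linarith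
    qed
    show "S (st x * x) = (S x)\<^sup>2" if x: "x \<in> C" for x
    proof (rule antisym)
      show "S (st x * x) \<le> (S x)\<^sup>2"
      proof (rule least)
        fix p assume p: "p \<in> P"
        interpret cstar_seminorm C sc st p by (rule P[OF p])
        show "p (st x * x) \<le> (S x)\<^sup>2"
          using up[OF p x] p_nonneg[OF x] by (simp add: p_cstar x power_mono)
      qed
      have "S x \<le> sqrt (S (st x * x))"
      proof (rule least)
        fix p assume p: "p \<in> P"
        interpret cstar_seminorm C sc st p by (rule P[OF p])
        show "p x \<le> sqrt (S (st x * x))"
          using up[OF p, of "st x * x"] x by (intro real_le_rsqrt) (simp add: p_cstar cl)
      qed
      then show "(S x)\<^sup>2 \<le> S (st x * x)"
        using S_nonneg[OF x] S_nonneg[of "st x * x"] x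
        by (simp add: cl real_le_rsqrt sqrt_ge_absD)
    qed
  qed (auto intro: S_nonneg)
  then show ?thesis by (simp add: S_def[abs_def])
qed

section \<open>The algebra of Cauchy sequences and its completeness\<close>

context cstar_seminorm
begin

definition seqs :: "(nat \<Rightarrow> 'a) set" where
  "seqs = {s. (\<forall>i. s i \<in> C) \<and> (\<forall>r>0. \<exists>N. \<forall>i\<ge>N. \<forall>j\<ge>N. p (s i - s j) < r)}"

text \<open>The norm of the point of the completion that the sequence represents; on
  \<open>seqs\<close> the limit exists because \<open>p\<close> is 1-Lipschitz.\<close>

definition seqs_norm :: "(nat \<Rightarrow> 'a) \<Rightarrow> real" where
  "seqs_norm s = lim (\<lambda>i. p (s i))"

lemma seqsD: "s \<in> seqs \<Longrightarrow> s i \<in> C"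
  by (simp add: seqs_def)

lemma const_seqs: "x \<in> C \<Longrightarrow> (\<lambda>_. x) \<in> seqs"
  by (simp add: seqs_def)

lemma seqs_normI: "(\<lambda>i. p (s i)) \<longlonglongrightarrow> r \<Longrightarrow> seqs_norm s = r"
  by (simp add: seqs_norm_def limI)

lemma seqs_norm_lim:
  assumes "s \<in> seqs"
  shows "(\<lambda>i. p (s i)) \<longlonglongrightarrow> seqs_norm s"
proof -
  have "Cauchy (\<lambda>i. p (s i))"
  proof (rule CauchyI)
    fix e :: real assume "0 < e"
    then obtain N where N: "\<forall>i\<ge>N. \<forall>j\<ge>N. p (s i - s j) < e" using assms unfolding seqs_def by blast
    have "norm (p (s i) - p (s j)) < e" if "i \<ge> N" "j \<ge> N" for i j
      using abs_p_diff[OF seqsD[OF assms] seqsD[OF assms], of i j] N that by fastforce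
    then show "\<exists>M. \<forall>m\<ge>M. \<forall>n\<ge>M. norm (p (s m) - p (s n)) < e" by blast
  qed
  then have "convergent (\<lambda>i. p (s i))" by (rule Cauchy_convergent)
  then show ?thesis unfolding seqs_norm_def by (simp add: convergent_LIMSEQ_iff)
qed

lemma seqs_const_norm: "seqs_norm (\<lambda>_. x) = p x"
  by (rule seqs_normI) simp

lemma seqs_bounded:
  assumes "s \<in> seqs"
  obtains B where "B > 0" "\<And>i. p (s i) \<le> B"
proof -
  have "Bseq (\<lambda>i. p (s i))"
    using seqs_norm_lim[OF assms] convergent_imp_Bseq convergentI by blast
  then obtain B where "B > 0" "\<forall>i. norm (p (s i)) \<le> B" by (auto simp: Bseq_def)
  with that[of B] show ?thesis by (metis abs_le_D1 real_norm_def)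
qed

text \<open>One Cauchy criterion for sums, scalar multiples, adjoints and products; for products the
  constant comes from bounds on the two factors.\<close>

lemma seqs_dominated:
  assumes s: "s \<in> seqs" and t: "t \<in> seqs" and u: "\<And>i. u i \<in> C" and K: "0 \<le> K"
    and le: "\<And>i j. p (u i - u j) \<le> K * (p (s i - s j) + p (t i - t j))"
  shows "u \<in> seqs"
proof -
  have "\<exists>N. \<forall>i\<ge>N. \<forall>j\<ge>N. p (u i - u j) < r" if r: "r > 0" for r
  proof -
    \<comment> \<open>The summand 1 keeps the denominator positive when \<open>K\<close> is 0 and
      makes the final estimate strict.\<close>
    have r': "r / (2 * (K + 1)) > 0" using r K by simp
    obtain N where N: "\<forall>i\<ge>N. \<forall>j\<ge>N. p (s i - s j) < r / (2 * (K + 1))"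
      using s r' unfolding seqs_def by blast
    obtain M where M: "\<forall>i\<ge>M. \<forall>j\<ge>M. p (t i - t j) < r / (2 * (K + 1))"
      using t r' unfolding seqs_def by blast
    have "p (u i - u j) < r" if "i \<ge> max N M" "j \<ge> max N M" for i j
    proof -
      have "p (s i - s j) + p (t i - t j) \<le> r / (2 * (K + 1)) + r / (2 * (K + 1))"
        using N M that by (intro add_mono less_imp_le) auto
      also have "\<dots> = 2 * r / (2 * (K + 1))" by simp
      also have "\<dots> = r / (K + 1)" by (rule mult_divide_mult_cancel_left) simp
      finally have "K * (p (s i - s j) + p (t i - t j)) \<le> K * (r / (K + 1))"
        using K by (rule mult_left_mono)
      also have "\<dots> < r" using K r by (simp add: field_simps)
      finally show ?thesis using le[of i j] by linarith
    qed
    then show ?thesis by blast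
  qed
  with u show ?thesis by (simp add: seqs_def)
qed

lemma seqs_add:
  assumes "s \<in> seqs" "t \<in> seqs" shows "(\<lambda>i. s i + t i) \<in> seqs"
proof (rule seqs_dominated[OF assms, of _ 1])
  fix i j
  show "p (s i + t i - (s j + t j)) \<le> 1 * (p (s i - s j) + p (t i - t j))"
    using p_add[of "s i - s j" "t i - t j"] assms by (simp add: closed seqsD algebra_simps)
qed (use assms in \<open>auto simp: closed seqsD\<close>)

lemma seqs_sc:
  assumes "s \<in> seqs" shows "(\<lambda>i. sc c (s i)) \<in> seqs"
  using assms
  by (intro seqs_dominated[OF assms assms, of _ "cmod c"])
     (auto simp: closed seqsD sc_diff[symmetric] p_sc intro!: mult_nonneg_nonneg p_nonneg)

lemma seqs_st:
  assumes "s \<in> seqs" shows "(\<lambda>i. st (s i)) \<in> seqs"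
  using assms
  by (intro seqs_dominated[OF assms assms, of _ 1])
     (auto simp: closed seqsD st_diff[symmetric] p_st intro!: p_nonneg)

lemma seqs_mult:
  assumes "s \<in> seqs" "t \<in> seqs" shows "(\<lambda>i. s i * t i) \<in> seqs"
proof -
  obtain A where A: "A > 0" "\<And>i. p (s i) \<le> A" using seqs_bounded[OF assms(1)] by blast
  obtain B where B: "B > 0" "\<And>i. p (t i) \<le> B" using seqs_bounded[OF assms(2)] by blast
  have [simp]: "s i \<in> C" "t i \<in> C" for i using assms by (auto simp: seqsD)
  show ?thesis
  proof (rule seqs_dominated[OF assms, of _ "A + B"])
    fix i j
    have "p (s i * t i - s j * t j) = p ((s i - s j) * t i + s j * (t i - t j))"
      by (simp add: algebra_simps)
    also have "\<dots> \<le> p (s i - s j) * p (t i) + p (s j) * p (t i - t j)"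
      by (intro order.trans[OF p_add] add_mono p_mult) (auto simp: closed)
    also have "\<dots> \<le> p (s i - s j) * (A + B) + (A + B) * p (t i - t j)"
      using A(1) B(1) add_increasing2[OF _ A(2)[of j], of B] add_increasing[OF _ B(2)[of i], of A]
      by (intro add_mono mult_left_mono mult_right_mono p_nonneg) (auto simp: closed)
    finally show "p (s i * t i - s j * t j) \<le> (A + B) * (p (s i - s j) + p (t i - t j))"
      by (simp add: algebra_simps)
  qed (use A B in \<open>auto simp: closed\<close>)
qed

lemma seqs_diff:
  assumes "s \<in> seqs" "t \<in> seqs" shows "(\<lambda>i. s i - t i) \<in> seqs"
  using seqs_add[OF assms(1) seqs_sc[OF assms(2), of "- 1"]] by (simp add: sc_minus_one)

text \<open>Density of the constant sequences: a Cauchy sequence is approximated by its own late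
  terms. Completeness and the uniqueness of homomorphisms both rest on it.\<close>

lemma seqs_norm_tail:
  assumes s: "s \<in> seqs" and "r > 0"
  shows "\<exists>N. \<forall>k\<ge>N. seqs_norm (\<lambda>i. s i - s k) < r"
proof -
  obtain N where N: "\<forall>i\<ge>N. \<forall>j\<ge>N. p (s i - s j) < r / 2"
    using s \<open>r > 0\<close> unfolding seqs_def by (auto dest!: spec[of _ "r / 2"])
  have "seqs_norm (\<lambda>i. s i - s k) \<le> r / 2" if "k \<ge> N" for k
  proof (rule LIMSEQ_le_const2)
    show "(\<lambda>i. p (s i - s k)) \<longlonglongrightarrow> seqs_norm (\<lambda>i. s i - s k)"
      by (intro seqs_norm_lim seqs_diff s const_seqs seqsD)
    show "\<exists>M. \<forall>i\<ge>M. p (s i - s k) \<le> r / 2" using N that by (meson less_imp_le)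
  qed
  moreover have "r / 2 < r" using \<open>r > 0\<close> by simp
  ultimately show ?thesis by (meson order.strict_trans1)
qed

text \<open>A diagonal argument: each member \<open>x k\<close> of a Cauchy sequence of sequences is
  replaced by a constant \<open>y k\<close> within 1 / (k + 1) of it; \<open>y\<close> is then
  itself Cauchy, and it is the limit.\<close>

theorem complete_seqs:
  "complete_cstar_seminorm seqs (\<lambda>c s i. sc c (s i)) (\<lambda>s i. st (s i)) seqs_norm"
proof -
  interpret L: star_alg seqs "\<lambda>c s i. sc c (s i)" "\<lambda>s i. st (s i)"
    by standard
       (simp_all add: seqs_add seqs_mult seqs_sc seqs_st const_seqs zero_in plus_fun_def times_fun_def
         zero_fun_def sc_add add_sc sc_sc sc_one sc_mult mult_sc st_add st_mult st_st st_sc)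
  interpret L: cstar_seminorm seqs "\<lambda>c s i. sc c (s i)" "\<lambda>s i. st (s i)" seqs_norm
  proof
    fix s t assume s: "s \<in> seqs"
    note lim = seqs_norm_lim[OF s]
    show "0 \<le> seqs_norm s"
      using lim by (rule LIMSEQ_le_const) (auto simp: p_nonneg seqsD s)
    show "seqs_norm (\<lambda>i. sc c (s i)) = cmod c * seqs_norm s" for c
      by (rule seqs_normI) (simp add: p_sc seqsD[OF s] tendsto_mult_left[OF lim])
    show "seqs_norm ((\<lambda>i. st (s i)) * s) = (seqs_norm s)\<^sup>2"
      unfolding times_fun_def
      by (rule seqs_normI) (simp add: p_cstar seqsD[OF s] tendsto_power[OF lim])
    assume t: "t \<in> seqs"
    note lim' = seqs_norm_lim[OF t]
    show "seqs_norm (s + t) \<le> seqs_norm s + seqs_norm t"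
      unfolding plus_fun_def
      by (rule LIMSEQ_le[OF seqs_norm_lim[OF seqs_add[OF s t]] tendsto_add[OF lim lim']])
         (auto simp: p_add seqsD s t)
    show "seqs_norm (s * t) \<le> seqs_norm s * seqs_norm t"
      unfolding times_fun_def
      by (rule LIMSEQ_le[OF seqs_norm_lim[OF seqs_mult[OF s t]] tendsto_mult[OF lim lim']])
         (auto simp: p_mult seqsD s t)
  qed
  show ?thesis
  proof
    fix x :: "nat \<Rightarrow> nat \<Rightarrow> 'a"
    assume x: "\<And>k. x k \<in> seqs"
      and Cauchy: "\<And>r. r > 0 \<Longrightarrow> \<exists>M. \<forall>i\<ge>M. \<forall>j\<ge>M. seqs_norm (x i - x j) < r"
    have "\<exists>m. seqs_norm (x k - (\<lambda>_. x k m)) < inverse (real (Suc k))" for k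
      using seqs_norm_tail[OF x, of "inverse (real (Suc k))" k] by (auto simp: fun_diff_def)
    then obtain m where m: "\<And>k. seqs_norm (x k - (\<lambda>_. x k (m k))) < inverse (real (Suc k))"
      by metis
    define y where "y k = x k (m k)" for k
    have yC: "y k \<in> C" for k by (simp add: y_def seqsD[OF x])
    have cy: "(\<lambda>_. y k) \<in> seqs" for k by (rule const_seqs[OF yC])
    have m: "seqs_norm (x k - (\<lambda>_. y k)) < inverse (real (Suc k))" for k
      using m by (simp add: y_def)
    have y: "y \<in> seqs"
      unfolding seqs_def
    proof (intro CollectI conjI allI impI yC)
      fix r :: real assume "r > 0"
      then have r3: "r / 3 > 0" by simp
      obtain M where M: "\<forall>i\<ge>M. \<forall>j\<ge>M. seqs_norm (x i - x j) < r / 3" using Cauchy[OF r3] by blast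
      obtain n where n: "inverse (real (Suc n)) < r / 3" using reals_Archimedean[OF r3] by blast
      have inv: "inverse (real (Suc k)) < r / 3" if "k \<ge> n" for k
      proof -
        have "inverse (real (Suc k)) \<le> inverse (real (Suc n))" using that by simp
        with n show ?thesis by linarith
      qed
      have "p (y i - y j) < r" if "i \<ge> max M n" "j \<ge> max M n" for i j
      proof -
        have "p (y i - y j) = seqs_norm ((\<lambda>_. y i) - (\<lambda>_. y j))"
          by (simp add: fun_diff_def seqs_const_norm)
        also have "\<dots> \<le> seqs_norm ((\<lambda>_. y i) - x i) + seqs_norm (x i - (\<lambda>_. y j))"
          by (intro L.p_triangle cy x)
        also have "\<dots> \<le> seqs_norm ((\<lambda>_. y i) - x i) + (seqs_norm (x i - x j) + seqs_norm (x j - (\<lambda>_. y j)))"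
          by (intro add_mono L.p_triangle cy x) auto
        also have "seqs_norm ((\<lambda>_. y i) - x i) = seqs_norm (x i - (\<lambda>_. y i))"
          by (intro L.p_diff_commute cy x)
        also have "\<dots> + (seqs_norm (x i - x j) + seqs_norm (x j - (\<lambda>_. y j))) < r"
        proof -
          have "seqs_norm (x i - x j) < r / 3" using M that by simp
          moreover have "inverse (real (Suc i)) < r / 3" "inverse (real (Suc j)) < r / 3"
            using inv that by auto
          ultimately show ?thesis using m[of i] m[of j] by linarith
        qed
        finally show ?thesis .
      qed
      then show "\<exists>N. \<forall>i\<ge>N. \<forall>j\<ge>N. p (y i - y j) < r" by blast
    qed
    have "(\<lambda>k. seqs_norm (x k - y)) \<longlonglongrightarrow> 0"
    proof (rule LIMSEQ_I)
      fix r :: real assume "r > 0"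
      then have r2: "r / 2 > 0" by simp
      obtain N where N: "\<forall>k\<ge>N. seqs_norm (\<lambda>i. y i - y k) < r / 2"
        using seqs_norm_tail[OF y r2] by blast
      obtain n where n: "inverse (real (Suc n)) < r / 2" using reals_Archimedean[OF r2] by blast
      have "norm (seqs_norm (x k - y) - 0) < r" if "k \<ge> max N n" for k
      proof -
        have "inverse (real (Suc k)) \<le> inverse (real (Suc n))" using that by simp
        moreover have "seqs_norm ((\<lambda>_. y k) - y) = seqs_norm (y - (\<lambda>_. y k))"
          by (intro L.p_diff_commute cy y)
        moreover have "\<dots> < r / 2" using N that by (simp add: fun_diff_def)
        moreover have "seqs_norm (x k - y) \<le> seqs_norm (x k - (\<lambda>_. y k)) + seqs_norm ((\<lambda>_. y k) - y)"
          by (intro L.p_triangle cy x y)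
        moreover have "0 \<le> seqs_norm (x k - y)" by (intro L.p_nonneg L.diff_in x y)
        ultimately show ?thesis using m[of k] n by (simp only: real_norm_def diff_0_right abs_of_nonneg)
      qed
      then show "\<exists>no. \<forall>k\<ge>no. norm (seqs_norm (x k - y) - 0) < r" by blast
    qed
    with y show "\<exists>l\<in>seqs. (\<lambda>k. seqs_norm (x k - l)) \<longlonglongrightarrow> 0" by blast
  qed
qed

end


section \<open>The universal seminorm on the free *-algebra\<close>

text \<open>Monomials are required only at words that occur in \<open>x\<close>; thanks to this,
  \<open>free_carrier_induct\<close> may use that these words are legal.\<close>

lemma poly_mapping_induct_add [case_names zero single add]:
  assumes "P 0" and "\<And>k c. k \<in> Poly_Mapping.keys x \<Longrightarrow> P (Poly_Mapping.single k c)"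
    and "\<And>x y. P x \<Longrightarrow> P y \<Longrightarrow> P (x + y)"
  shows "P (x :: 'a \<Rightarrow>\<^sub>0 'b::comm_monoid_add)"
proof -
  have "P (\<Sum>k\<in>A. Poly_Mapping.single k (Poly_Mapping.lookup x k))"
    if "finite A" "A \<subseteq> Poly_Mapping.keys x" for A
    using that by (induction A rule: finite_induct) (simp_all add: assms)
  moreover have "x = (\<Sum>k\<in>Poly_Mapping.keys x. Poly_Mapping.single k (Poly_Mapping.lookup x k))"
    by (rule poly_mapping_eqI) (simp add: lookup_sum lookup_single when_def in_keys_iff)
  ultimately show ?thesis by (metis finite_keys order_refl)
qed

lemma word_star_word_star [simp]: "word_star (word_star k) = k"
  by (cases k) (simp add: word_star_def rev_map comp_def case_prod_beta)

lemma inj_word_star [simp]: "inj word_star"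
  by (metis injI word_star_word_star)

lemma word_star_zero: "word_star 0 = 0"
  by (simp add: word_star_def zero_word_def)

lemma word_star_plus: "word_star (a + b) = word_star b + word_star a"
  by (simp add: word_star_def plus_word_def)

lemma lookup_free_scale: "Poly_Mapping.lookup (free_scale c x) k = c * Poly_Mapping.lookup x k"
  by (simp add: free_scale_def Poly_Mapping.map.rep_eq when_def)

lemma lookup_free_star:
  "Poly_Mapping.lookup (free_star x) k = cnj (Poly_Mapping.lookup x (word_star k))"
  by (simp add: free_star_def Poly_Mapping.map.rep_eq map_key.rep_eq when_def)

lemma free_scale_single: "free_scale c (Poly_Mapping.single k d) = Poly_Mapping.single k (c * d)"
  by (rule poly_mapping_eqI) (simp add: lookup_free_scale lookup_single when_def)

lemma free_star_single:
  "free_star (Poly_Mapping.single k c) = Poly_Mapping.single (word_star k) (cnj c)"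
  by (rule poly_mapping_eqI)
     (auto simp: lookup_free_star lookup_single when_def)

lemma free_star_add: "free_star (x + y) = free_star x + free_star y"
  by (rule poly_mapping_eqI) (simp add: lookup_free_star lookup_add)

lemma free_star_zero: "free_star 0 = 0"
  by (rule poly_mapping_eqI) (simp add: lookup_free_star)

lemma free_scale_conv_mult: "free_scale c x = Poly_Mapping.single 0 c * x"
  by (simp add: free_scale_def mult_map_scale_conv_mult)

text \<open>Multiples of the empty word are central. They are not in \<open>free_carrier\<close>
  (unless zero), but in the ambient unital algebra they reduce moving a scalar past a factor to
  associativity.\<close>

lemma free_scale_commute: "Poly_Mapping.single 0 c * x = x * Poly_Mapping.single 0 (c::complex)"
  for x :: "('v, 'e) free_alg"
  by (induction x rule: poly_mapping_induct_add)
     (simp_all add: distrib_left distrib_right mult_single mult.commute)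

lemma free_star_mult: "free_star (x * y) = free_star y * free_star x"
proof (induction x rule: poly_mapping_induct_add)
  case (single k c)
  show ?case
    by (induction y rule: poly_mapping_induct_add)
       (simp_all add: free_star_zero free_star_add free_star_single mult_single word_star_plus
         distrib_left distrib_right mult.commute)
qed (simp_all add: free_star_zero free_star_add distrib_left distrib_right)

definition legal_word :: "('v, 'e) pre_digraph \<Rightarrow> (('v, 'e) gen \<times> bool) word \<Rightarrow> bool" where
  "legal_word E k \<longleftrightarrow> letters k \<noteq> [] \<and> fst ` set (letters k) \<subseteq> Vert ` verts E \<union> Arc ` arcs E"

lemma free_carrier_iff: "x \<in> free_carrier E \<longleftrightarrow> (\<forall>k\<in>Poly_Mapping.keys x. legal_word E k)"
  by (simp add: free_carrier_def legal_word_def)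

lemma legal_word_star [simp]: "legal_word E (word_star k) \<longleftrightarrow> legal_word E k"
  by (auto simp: legal_word_def word_star_def image_image case_prod_beta)

lemma single_in_free_carrier: "legal_word E k \<Longrightarrow> Poly_Mapping.single k c \<in> free_carrier E"
  by (simp add: free_carrier_iff)

interpretation free: star_alg "free_carrier E" free_scale free_star for E :: "('v, 'e) pre_digraph"
proof
  fix x y :: "('v, 'e) free_alg" and c d :: complex
  show "0 \<in> free_carrier E" by (simp add: free_carrier_iff)
  show "free_scale 1 x = x" by (simp add: free_scale_conv_mult)
  show "free_scale c (x + y) = free_scale c x + free_scale c y"
    "free_scale (c + d) x = free_scale c x + free_scale d x"
    "free_scale c (free_scale d x) = free_scale (c * d) x"
    "free_star (free_scale c x) = free_scale (cnj c) (free_star x)"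
    by (rule poly_mapping_eqI,
        simp add: lookup_free_scale lookup_add distrib_left distrib_right lookup_free_star mult.assoc)+
  show "free_scale c x * y = free_scale c (x * y)"
    by (simp add: free_scale_conv_mult mult.assoc)
  show "x * free_scale c y = free_scale c (x * y)"
    by (metis free_scale_conv_mult free_scale_commute mult.assoc)
  show "free_star (x + y) = free_star x + free_star y" by (rule free_star_add)
  show "free_star (x * y) = free_star y * free_star x" by (rule free_star_mult)
  show "free_star (free_star x) = x" by (rule poly_mapping_eqI) (simp add: lookup_free_star)
  assume x: "x \<in> free_carrier E"
  then show "free_scale c x \<in> free_carrier E"
    by (auto simp: free_carrier_iff in_keys_iff lookup_free_scale)
  show "free_star x \<in> free_carrier E"
    unfolding free_carrier_iff
  proof
    fix k assume "k \<in> Poly_Mapping.keys (free_star x)"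
    then have "word_star k \<in> Poly_Mapping.keys x" by (simp add: in_keys_iff lookup_free_star)
    with x show "legal_word E k" by (metis free_carrier_iff legal_word_star)
  qed
  assume y: "y \<in> free_carrier E"
  then show "x + y \<in> free_carrier E"
    using x keys_add[of x y] by (auto simp: free_carrier_iff)
  show "x * y \<in> free_carrier E"
    unfolding free_carrier_iff
  proof
    fix k assume "k \<in> Poly_Mapping.keys (x * y)"
    then obtain a b where k: "k = a + b" and ab: "a \<in> Poly_Mapping.keys x" "b \<in> Poly_Mapping.keys y"
      using keys_mult[of x y] by blast
    from ab x y have "legal_word E a" "legal_word E b" by (simp_all add: free_carrier_iff)
    then show "legal_word E k" by (simp add: k legal_word_def plus_word_def image_Un)
  qed
qed

text \<open>The vertices and edges generate \<open>free_carrier\<close> as an algebra with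
  involution; bounds and uniqueness are both derived from this. Legal words are nonempty, so there
  is no case for 1.\<close>

lemma free_carrier_induct [consumes 1, case_names zero vert arc star mult scale add]:
  assumes "x \<in> free_carrier E"
    and zero: "P 0"
    and vert: "\<And>v. v \<in> verts E \<Longrightarrow> P (gen_vert v)"
    and arc: "\<And>e. e \<in> arcs E \<Longrightarrow> P (gen_arc e)"
    and star: "\<And>x. x \<in> free_carrier E \<Longrightarrow> P x \<Longrightarrow> P (free_star x)"
    and mult: "\<And>x y. x \<in> free_carrier E \<Longrightarrow> y \<in> free_carrier E \<Longrightarrow> P x \<Longrightarrow> P y \<Longrightarrow> P (x * y)"
    and scale: "\<And>c x. x \<in> free_carrier E \<Longrightarrow> P x \<Longrightarrow> P (free_scale c x)"
    and add: "\<And>x y. x \<in> free_carrier E \<Longrightarrow> y \<in> free_carrier E \<Longrightarrow> P x \<Longrightarrow> P y \<Longrightarrow> P (x + y)"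
  shows "P x"
proof -
  have letter: "P (Poly_Mapping.single (Word [(g, b)]) 1)" if "g \<in> Vert ` verts E \<union> Arc ` arcs E" for g b
  proof -
    have C: "Poly_Mapping.single (Word [(g, False)]) 1 \<in> free_carrier E"
      using that by (auto intro!: single_in_free_carrier simp: legal_word_def)
    have P: "P (Poly_Mapping.single (Word [(g, False)]) 1)"
      using that vert arc by (auto simp: gen_vert_def gen_arc_def)
    show ?thesis
      using P star[OF C P] by (cases b) (simp_all add: free_star_single word_star_def)
  qed
  \<comment> \<open>The induction really starts at words of one letter: the empty word is not legal,
    hence the distinction between \<open>l = []\<close> and a genuine product.\<close>
  have word: "P (Poly_Mapping.single (Word l) 1)" if "legal_word E (Word l)" for l
    using that
  proof (induction l)
    case (Cons a l)
    obtain g b where a: "a = (g, b)" by (cases a)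
    have g: "g \<in> Vert ` verts E \<union> Arc ` arcs E" using Cons.prems by (auto simp: legal_word_def a)
    show ?case
    proof (cases "l = []")
      case False
      then have l: "legal_word E (Word l)" "legal_word E (Word [a])"
        using Cons.prems by (auto simp: legal_word_def)
      have "P (Poly_Mapping.single (Word [a]) 1 * Poly_Mapping.single (Word l) 1)"
        using l letter[OF g] Cons.IH by (intro mult single_in_free_carrier) (auto simp: a)
      then show ?thesis by (simp add: mult_single plus_word_def)
    qed (use letter[OF g] a in simp)
  qed (simp add: legal_word_def)
  have "x \<in> free_carrier E \<and> P x"
  proof (induction x rule: poly_mapping_induct_add)
    case (single k c)
    then have k: "legal_word E k" using assms(1) by (auto simp: free_carrier_iff)
    have "P (free_scale c (Poly_Mapping.single k 1))"
      using word[of "letters k"] k by (intro scale single_in_free_carrier) auto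
    with k show ?case by (simp add: free_scale_single single_in_free_carrier)
  qed (auto simp: zero free.zero_in free.add_in intro: add)
  then show ?thesis ..
qed

lemma gen_vert_in: "v \<in> verts E \<Longrightarrow> gen_vert v \<in> free_carrier E"
  by (simp add: gen_vert_def single_in_free_carrier legal_word_def)

lemma gen_arc_in: "e \<in> arcs E \<Longrightarrow> gen_arc e \<in> free_carrier E"
  by (simp add: gen_arc_def single_in_free_carrier legal_word_def)

section \<open>Finiteness of the universal seminorm\<close>

lemma graph_seminorm_iff:
  "graph_seminorm E p \<longleftrightarrow>
     cstar_seminorm (free_carrier E) free_scale free_star p \<and> (\<forall>r\<in>graph_relations E. p r = 0)"
  unfolding graph_seminorm_def cstar_seminorm_def cstar_seminorm_axioms_def
  using free.star_alg_axioms by blast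

text \<open>Modulo null elements S_v is a projection, so p(S_v)^2 = p(S_v); and p(S_e)^2 is the
  value of p at the target projection of e. Both force values at most 1.\<close>

lemma graph_seminorm_gen_le_one:
  assumes E: "wf_digraph E" and p: "graph_seminorm E p"
  shows "v \<in> verts E \<Longrightarrow> p (gen_vert v) \<le> 1" and "e \<in> arcs E \<Longrightarrow> p (gen_arc e) \<le> 1"
proof -
  interpret wf_digraph E by (rule E)
  interpret cstar_seminorm "free_carrier E" free_scale free_star p
    using p by (simp add: graph_seminorm_iff)
  have null: "p r = 0" if "r \<in> graph_relations E" for r
    using p that by (simp add: graph_seminorm_iff)
  note [simp] = gen_vert_in gen_arc_in free.closed
  have le1: "x \<le> 1" if "x\<^sup>2 \<le> x" for x :: real
  proof (rule ccontr)
    assume "\<not> x \<le> 1"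
    then have "x * 1 < x * x" by (intro mult_strict_left_mono) auto
    with that show False by (simp add: power2_eq_square)
  qed
  show vert: "p (gen_vert v) \<le> 1" if v: "v \<in> verts E" for v
  proof -
    have "eqv (free_star (gen_vert v)) (gen_vert v)" "eqv (gen_vert v * gen_vert v) (gen_vert v)"
      using v by (auto simp: eqv_def intro!: null) (auto simp: graph_relations_def)
    then have "eqv (free_star (gen_vert v) * gen_vert v) (gen_vert v)"
      using eqv_mult eqv_refl eqv_trans v gen_vert_in by meson
    from eqv_p[OF this] have "(p (gen_vert v))\<^sup>2 = p (gen_vert v)"
      using v by (simp add: p_cstar)
    then show ?thesis by (intro le1) simp
  qed
  show "p (gen_arc e) \<le> 1" if e: "e \<in> arcs E"
  proof -
    have "eqv (free_star (gen_arc e) * gen_arc e) (gen_vert (head E e))"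
      using e by (auto simp: eqv_def intro!: null) (auto simp: graph_relations_def)
    from eqv_p[OF this] have "(p (gen_arc e))\<^sup>2 \<le> 1"
      using e vert[of "head E e"] by (simp add: p_cstar)
    then show ?thesis using power2_le_imp_le[of "p (gen_arc e)" 1] by simp
  qed
qed

text \<open>Uniform bounds hold on generators and are inherited by sums, products, scalar multiples
  and adjoints. They give the real supremum in \<open>graph_norm\<close> its meaning.\<close>

lemma bdd_above_graph_seminorms:
  assumes E: "wf_digraph E" and x: "x \<in> free_carrier E"
  shows "bdd_above ((\<lambda>p. p x) ` {p. graph_seminorm E p})"
proof -
  have "\<exists>B. \<forall>p. graph_seminorm E p \<longrightarrow> p x \<le> B"
    using x
  proof (induction rule: free_carrier_induct)
    case (star x)
    then show ?case
      using cstar_seminorm.p_st[where sc = free_scale and st = free_star] unfolding graph_seminorm_iff by metis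
  next
    case (vert v)
    show ?case using graph_seminorm_gen_le_one(1)[OF E _ vert] by blast
  next
    case (arc e)
    show ?case using graph_seminorm_gen_le_one(2)[OF E _ arc] by blast
  next
    case zero
    show ?case using cstar_seminorm.p_zero unfolding graph_seminorm_iff by (metis order_refl)
  next
    case (mult x y)
    then obtain B D where *: "\<And>p. graph_seminorm E p \<Longrightarrow> p x \<le> B" "\<And>p. graph_seminorm E p \<Longrightarrow> p y \<le> D"
      by blast
    have "p (x * y) \<le> \<bar>B\<bar> * \<bar>D\<bar>" if p: "graph_seminorm E p" for p
    proof -
      interpret cstar_seminorm "free_carrier E" free_scale free_star p
        using p by (simp add: graph_seminorm_iff)
      have "p x * p y \<le> \<bar>B\<bar> * \<bar>D\<bar>"
        using *[OF p] mult.hyps by (intro mult_mono p_nonneg) auto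
      with p_mult[OF mult.hyps] show ?thesis by linarith
    qed
    then show ?case by blast
  next
    case (scale c x)
    then obtain B where *: "\<And>p. graph_seminorm E p \<Longrightarrow> p x \<le> B" by blast
    have "p (free_scale c x) \<le> cmod c * B" if p: "graph_seminorm E p" for p
    proof -
      interpret cstar_seminorm "free_carrier E" free_scale free_star p
        using p by (simp add: graph_seminorm_iff)
      show ?thesis using *[OF p] scale.hyps by (simp add: p_sc mult_left_mono)
    qed
    then show ?case by blast
  next
    case (add x y)
    then obtain B D where *: "\<And>p. graph_seminorm E p \<Longrightarrow> p x \<le> B" "\<And>p. graph_seminorm E p \<Longrightarrow> p y \<le> D"
      by blast
    have "p (x + y) \<le> B + D" if p: "graph_seminorm E p" for p
    proof -
      interpret cstar_seminorm "free_carrier E" free_scale free_star p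
        using p by (simp add: graph_seminorm_iff)
      show ?thesis using *[OF p] p_add[OF add.hyps] by linarith
    qed
    then show ?case by blast
  qed
  then show ?thesis by (auto simp: bdd_above_def)
qed

lemma graph_norm_upper:
  "wf_digraph E \<Longrightarrow> graph_seminorm E p \<Longrightarrow> x \<in> free_carrier E \<Longrightarrow> p x \<le> graph_norm E x"
  unfolding graph_norm_def by (intro cSUP_upper bdd_above_graph_seminorms) auto

text \<open>Makes the family under the supremum in \<open>graph_norm\<close> nonempty.\<close>

lemma graph_seminorm_zero: "graph_seminorm E (\<lambda>_. 0)"
  by (simp add: graph_seminorm_def)

text \<open>The supremum is itself a member of the family, hence its largest one.\<close>

lemma graph_norm_seminorm:
  assumes "wf_digraph E" shows "graph_seminorm E (graph_norm E)"
proof -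
  have "cstar_seminorm (free_carrier E) free_scale free_star (graph_norm E)"
    unfolding graph_norm_def
  proof (rule cstar_seminorm_SUP)
    show "{p. graph_seminorm E p} \<noteq> {}" using graph_seminorm_zero by blast
  next
    fix x assume "x \<in> free_carrier E"
    then show "bdd_above ((\<lambda>p. p x) ` {p. graph_seminorm E p})"
      by (rule bdd_above_graph_seminorms[OF assms])
  qed (simp add: graph_seminorm_iff)
  moreover have "graph_norm E r = 0" if r: "r \<in> graph_relations E" for r
  proof -
    have "graph_norm E r = (SUP p\<in>{p. graph_seminorm E p}. 0)"
      unfolding graph_norm_def using r by (intro SUP_cong) (auto simp: graph_seminorm_iff)
    also have "\<dots> = 0" using graph_seminorm_zero by (intro cSUP_const) auto
    finally show ?thesis .
  qed
  ultimately show ?thesis by (simp add: graph_seminorm_iff)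
qed

section \<open>Homomorphisms between free algebras\<close>

definition letter_image :: "(('v, 'e) gen \<Rightarrow> ('v2, 'e2) free_alg) \<Rightarrow> ('v, 'e) gen \<times> bool \<Rightarrow> ('v2, 'e2) free_alg" where
  "letter_image T = (\<lambda>(g, b). if b then free_star (T g) else T g)"

definition word_image :: "(('v, 'e) gen \<Rightarrow> ('v2, 'e2) free_alg) \<Rightarrow> (('v, 'e) gen \<times> bool) word \<Rightarrow> ('v2, 'e2) free_alg" where
  "word_image T k = prod_list (map (letter_image T) (letters k))"

text \<open>The extension of \<open>T\<close> to the whole monoid algebra as a unital homomorphism,
  with the empty word going to 1; \<open>free_hom_in\<close> restricts it to the non-unital
  algebras.\<close>

definition free_hom :: "(('v, 'e) gen \<Rightarrow> ('v2, 'e2) free_alg) \<Rightarrow> ('v, 'e) free_alg \<Rightarrow> ('v2, 'e2) free_alg" where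
  "free_hom T x = (\<Sum>k\<in>Poly_Mapping.keys x. free_scale (Poly_Mapping.lookup x k) (word_image T k))"

text \<open>Lets the sums for x, y and x + y run over one common finite set of words, as additivity
  needs.\<close>

lemma free_hom_superset:
  "finite A \<Longrightarrow> Poly_Mapping.keys x \<subseteq> A \<Longrightarrow>
     free_hom T x = (\<Sum>k\<in>A. free_scale (Poly_Mapping.lookup x k) (word_image T k))"
  unfolding free_hom_def by (rule sum.mono_neutral_left) (auto simp: in_keys_iff)

lemma free_hom_zero [simp]: "free_hom T 0 = 0"
  by (simp add: free_hom_def)

lemma free_hom_add: "free_hom T (x + y) = free_hom T x + free_hom T y"
proof -
  let ?A = "Poly_Mapping.keys x \<union> Poly_Mapping.keys y"
  have "free_hom T z = (\<Sum>k\<in>?A. free_scale (Poly_Mapping.lookup z k) (word_image T k))"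
    if "z \<in> {x, y, x + y}" for z
    using that keys_add[of x y] by (intro free_hom_superset) auto
  then show ?thesis by (simp add: lookup_add free.add_sc sum.distrib)
qed

lemma free_hom_single: "free_hom T (Poly_Mapping.single k c) = free_scale c (word_image T k)"
  by (subst free_hom_superset[of "{k}"]) auto

lemma free_hom_scale: "free_hom T (free_scale c x) = free_scale c (free_hom T x)"
  by (induction x rule: poly_mapping_induct_add)
     (simp_all add: free_hom_add free_hom_single free_scale_single free.sc_sc free.sc_add)

lemma free_hom_minus: "free_hom T (- x) = - free_hom T x"
  using free_hom_scale[of T "- 1" x] by (simp add: free.sc_minus_one)

lemma free_hom_diff: "free_hom T (x - y) = free_hom T x - free_hom T y"
  using free_hom_add[of T x "- y"] by (simp add: free_hom_minus)

lemma free_hom_sum: "free_hom T (sum f A) = (\<Sum>i\<in>A. free_hom T (f i))"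
  by (induction A rule: infinite_finite_induct) (simp_all add: free_hom_add)

lemma word_image_plus: "word_image T (k + l) = word_image T k * word_image T l"
  by (simp add: word_image_def plus_word_def)

lemma free_star_one: "free_star 1 = 1"
  using free_star_single[of 0 1] by (simp add: word_star_zero)

lemma word_image_star: "word_image T (word_star k) = free_star (word_image T k)"
proof -
  have "prod_list (map (letter_image T) (rev (map (\<lambda>(x, b). (x, \<not> b)) l)))
      = free_star (prod_list (map (letter_image T) l))" for l
    by (induction l)
       (auto simp: free_star_one free_star_mult letter_image_def free.st_st split: prod.splits)
  then show ?thesis by (simp add: word_image_def word_star_def)
qed

lemma free_hom_mult: "free_hom T (x * y) = free_hom T x * free_hom T y"
proof (induction x rule: poly_mapping_induct_add)
  case (single k c)
  show ?case
    by (induction y rule: poly_mapping_induct_add)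
       (simp_all add: free_hom_add free_hom_single mult_single word_image_plus free.sc_sc
         free.sc_mult free.mult_sc distrib_left mult.commute)
qed (simp_all add: free_hom_add distrib_right)

lemma free_hom_star: "free_hom T (free_star x) = free_star (free_hom T x)"
  by (induction x rule: poly_mapping_induct_add)
     (simp_all add: free_star_zero free_star_add free_hom_add free_hom_single free_star_single
       word_image_star free.st_sc)

lemma free_hom_gen: "free_hom T (gen_vert v) = T (Vert v)" "free_hom T (gen_arc e) = T (Arc e)"
  by (simp_all add: gen_vert_def gen_arc_def free_hom_single free.sc_one word_image_def letter_image_def)

lemma free_hom_in:
  assumes "\<And>v. v \<in> verts E \<Longrightarrow> T (Vert v) \<in> free_carrier F"
    and "\<And>e. e \<in> arcs E \<Longrightarrow> T (Arc e) \<in> free_carrier F"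
    and "x \<in> free_carrier E"
  shows "free_hom T x \<in> free_carrier F"
  using assms(3)
  by (induction rule: free_carrier_induct)
     (simp_all add: assms(1,2) free_hom_gen free_hom_add free_hom_mult free_hom_star free_hom_scale free.closed)


section \<open>Homomorphisms between graph C*-algebras\<close>

definition cls :: "('v, 'e) pre_digraph \<Rightarrow> (nat \<Rightarrow> ('v, 'e) free_alg) \<Rightarrow> ('v, 'e) cstar_elem" where
  "cls E s = cauchy_rel E `` {s}"

locale graph_algebra =
  fixes E :: "('v, 'e) pre_digraph"
  assumes wf: "wf_digraph E"

sublocale graph_algebra \<subseteq> cstar_seminorm "free_carrier E" free_scale free_star "graph_norm E"
  using graph_norm_seminorm[OF wf] by (simp add: graph_seminorm_iff)

text \<open>Two seminorms now coexist: plain names refer to \<open>graph_norm\<close> on the free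
  algebra, the prefix \<open>L\<close> to the limit seminorm on Cauchy sequences.
  \<open>L.eqv\<close> is equality in C*(E).\<close>

sublocale graph_algebra \<subseteq> L: complete_cstar_seminorm seqs
  "\<lambda>c s i. free_scale c (s i)" "\<lambda>s i. free_star (s i)" seqs_norm
  by (rule complete_seqs)

context graph_algebra
begin

lemma cauchy_seqs_eq: "cauchy_seqs E = seqs"
  by (simp add: cauchy_seqs_def seqs_def)

lemma cauchy_rel_iff: "(s, t) \<in> cauchy_rel E \<longleftrightarrow> L.eqv s t"
proof -
  have "(\<lambda>i. graph_norm E (s i - t i)) \<longlonglongrightarrow> 0 \<longleftrightarrow> seqs_norm (s - t) = 0"
    if "s \<in> seqs" "t \<in> seqs"
    using seqs_norm_lim[OF L.diff_in[OF that]] LIMSEQ_unique by (auto simp: fun_diff_def)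
  then show ?thesis by (auto simp: cauchy_rel_def L.eqv_def cauchy_seqs_eq)
qed

lemma in_cls_iff: "t \<in> cls E s \<longleftrightarrow> L.eqv s t"
  by (simp add: cls_def cauchy_rel_iff)

lemma cls_eq_iff: "s \<in> seqs \<Longrightarrow> cls E s = cls E t \<longleftrightarrow> L.eqv s t"
  unfolding set_eq_iff in_cls_iff using L.eqv_refl L.eqv_sym L.eqv_trans by meson

lemma carrier_eq: "carrier (graph_cstar E) = cls E ` seqs"
  by (auto simp: graph_cstar_def quotient_def cauchy_seqs_eq cls_def)

lemma cls_in [simp]: "s \<in> seqs \<Longrightarrow> cls E s \<in> carrier (graph_cstar E)"
  by (simp add: carrier_eq)

lemma self_in_cls: "s \<in> seqs \<Longrightarrow> s \<in> cls E s"
  by (simp add: in_cls_iff L.eqv_refl)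

text \<open>The operations of \<open>graph_cstar\<close> are unions over all representatives; such a
  union collapses once the result is independent of the representative.\<close>

lemma UN_cls:
  assumes "s \<in> seqs" and "\<And>s'. L.eqv s s' \<Longrightarrow> f s' = f s"
  shows "(\<Union>s'\<in>cls E s. f s') = f s"
proof -
  have "(\<Union>s'\<in>cls E s. f s') = (\<Union>s'\<in>cls E s. f s)"
    by (intro SUP_cong refl assms(2)) (simp only: in_cls_iff)
  also have "\<dots> = f s" using self_in_cls[OF assms(1)] by blast
  finally show ?thesis .
qed

lemma cls_eqI: "L.eqv s t \<Longrightarrow> cls E s = cls E t"
  by (subst cls_eq_iff) (auto simp: L.eqv_def)

lemma cls_add:
  assumes "s \<in> seqs" "t \<in> seqs"
  shows "cls E s \<oplus>\<^bsub>graph_cstar E\<^esub> cls E t = cls E (s + t)"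
proof -
  have "cls E s \<oplus>\<^bsub>graph_cstar E\<^esub> cls E t = (\<Union>s'\<in>cls E s. \<Union>t'\<in>cls E t. cls E (s' + t'))"
    by (simp add: graph_cstar_def cls_def plus_fun_def)
  also have "\<dots> = (\<Union>t'\<in>cls E t. cls E (s + t'))"
  proof (intro UN_cls[OF assms(1)] SUP_cong refl)
    fix s' t' assume s': "L.eqv s s'" and "t' \<in> cls E t"
    then have t': "t' \<in> seqs" by (simp add: in_cls_iff L.eqv_def)
    show "cls E (s' + t') = cls E (s + t')"
      by (intro cls_eqI L.eqv_add L.eqv_refl t' L.eqv_sym[OF s'])
  qed
  also have "\<dots> = cls E (s + t)"
    by (intro UN_cls[OF assms(2)] cls_eqI L.eqv_add L.eqv_refl assms) (erule L.eqv_sym)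
  finally show ?thesis .
qed

lemma cls_mult:
  assumes "s \<in> seqs" "t \<in> seqs"
  shows "cls E s \<otimes>\<^bsub>graph_cstar E\<^esub> cls E t = cls E (s * t)"
proof -
  have "cls E s \<otimes>\<^bsub>graph_cstar E\<^esub> cls E t = (\<Union>s'\<in>cls E s. \<Union>t'\<in>cls E t. cls E (s' * t'))"
    by (simp add: graph_cstar_def cls_def times_fun_def)
  also have "\<dots> = (\<Union>t'\<in>cls E t. cls E (s * t'))"
  proof (intro UN_cls[OF assms(1)] SUP_cong refl)
    fix s' t' assume s': "L.eqv s s'" and "t' \<in> cls E t"
    then have t': "t' \<in> seqs" by (simp add: in_cls_iff L.eqv_def)
    show "cls E (s' * t') = cls E (s * t')"
      by (intro cls_eqI L.eqv_mult L.eqv_refl t' L.eqv_sym[OF s'])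
  qed
  also have "\<dots> = cls E (s * t)"
    by (intro UN_cls[OF assms(2)] cls_eqI L.eqv_mult L.eqv_refl assms) (erule L.eqv_sym)
  finally show ?thesis .
qed

lemma cls_scale:
  assumes "s \<in> seqs"
  shows "scale (graph_cstar E) c (cls E s) = cls E (\<lambda>i. free_scale c (s i))"
proof -
  have "scale (graph_cstar E) c (cls E s) = (\<Union>s'\<in>cls E s. cls E (\<lambda>i. free_scale c (s' i)))"
    by (simp add: graph_cstar_def cls_def)
  also have "\<dots> = cls E (\<lambda>i. free_scale c (s i))"
    by (intro UN_cls[OF assms] cls_eqI L.eqv_sc) (erule L.eqv_sym)
  finally show ?thesis .
qed

lemma cls_star:
  assumes "s \<in> seqs"
  shows "star (graph_cstar E) (cls E s) = cls E (\<lambda>i. free_star (s i))"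
proof -
  have "star (graph_cstar E) (cls E s) = (\<Union>s'\<in>cls E s. cls E (\<lambda>i. free_star (s' i)))"
    by (simp add: graph_cstar_def cls_def)
  also have "\<dots> = cls E (\<lambda>i. free_star (s i))"
    by (intro UN_cls[OF assms] cls_eqI L.eqv_st) (erule L.eqv_sym)
  finally show ?thesis .
qed

lemma cls_zero: "\<zero>\<^bsub>graph_cstar E\<^esub> = cls E 0"
  by (simp add: graph_cstar_def cls_def zero_fun_def)

lemma cls_norm:
  assumes "s \<in> seqs"
  shows "cnorm (graph_cstar E) (cls E s) = seqs_norm s"
proof -
  have "(\<lambda>i. graph_norm E (t i)) \<longlonglongrightarrow> seqs_norm s" if "t \<in> cls E s" for t
    using that seqs_norm_lim[of t] L.eqv_p[of s t] by (simp add: in_cls_iff L.eqv_def)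
  then have "(THE r. \<forall>t\<in>cls E s. (\<lambda>i. graph_norm E (t i)) \<longlonglongrightarrow> r) = seqs_norm s"
    using self_in_cls[OF assms] by (intro the_equality) (auto intro: LIMSEQ_unique)
  then show ?thesis by (simp add: graph_cstar_def)
qed

lemma carrierE:
  assumes "a \<in> carrier (graph_cstar E)" obtains s where "s \<in> seqs" "a = cls E s"
  using assms by (auto simp: carrier_eq)

lemma S_vert_cls: "S_vert E v = cls E (\<lambda>_. gen_vert v)"
  by (simp add: S_vert_def cls_def)

lemma S_arc_cls: "S_arc E e = cls E (\<lambda>_. gen_arc e)"
  by (simp add: S_arc_def cls_def)

text \<open>Equations in C*(E) between polynomials in the generators thereby follow from
  \<open>eqv\<close> in the free algebra.\<close>

lemma eqv_cls: "eqv x y \<Longrightarrow> cls E (\<lambda>_. x) = cls E (\<lambda>_. y)"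
  by (rule cls_eqI) (auto simp: L.eqv_def const_seqs fun_diff_def seqs_const_norm eqv_def)

abbreviation const_cls :: "('v, 'e) free_alg \<Rightarrow> ('v, 'e) cstar_elem" where
  "const_cls x \<equiv> cls E (\<lambda>_. x)"

lemma const_cls_ops:
  "x \<in> free_carrier E \<Longrightarrow> y \<in> free_carrier E \<Longrightarrow>
    const_cls x \<oplus>\<^bsub>graph_cstar E\<^esub> const_cls y = const_cls (x + y)"
  "x \<in> free_carrier E \<Longrightarrow> y \<in> free_carrier E \<Longrightarrow>
    const_cls x \<otimes>\<^bsub>graph_cstar E\<^esub> const_cls y = const_cls (x * y)"
  "x \<in> free_carrier E \<Longrightarrow> scale (graph_cstar E) c (const_cls x) = const_cls (free_scale c x)"
  "x \<in> free_carrier E \<Longrightarrow> star (graph_cstar E) (const_cls x) = const_cls (free_star x)"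
  by (simp_all add: cls_add cls_mult cls_scale cls_star const_seqs plus_fun_def times_fun_def)

text \<open>What the finite sums in \<open>cstar_pullback\<close> require.\<close>

lemma abelian_monoid: "abelian_monoid (graph_cstar E)"
  by (rule abelian_monoidI) (auto elim!: carrierE simp: cls_add cls_zero L.closed add_ac)

lemma finsum_const_cls:
  assumes "finite A" "\<And>i. i \<in> A \<Longrightarrow> f i \<in> free_carrier E"
  shows "(\<Oplus>\<^bsub>graph_cstar E\<^esub>i\<in>A. const_cls (f i)) = const_cls (\<Sum>i\<in>A. f i)"
proof -
  interpret abelian_monoid "graph_cstar E" by (rule abelian_monoid)
  show ?thesis
    using assms
  proof (induction A rule: finite_induct)
    case (insert a A)
    then show ?case
      by (subst finsum_insert) (auto simp: const_seqs const_cls_ops sum_in)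
  qed (simp add: cls_zero zero_fun_def)
qed

end

section \<open>Uniqueness and existence of homomorphisms out of C*(E)\<close>

locale graph_algebra_pair = E: graph_algebra E + F: graph_algebra F
  for E :: "('v, 'e) pre_digraph" and F :: "('v2, 'e2) pre_digraph"
begin

lemma star_homD:
  assumes "star_hom (graph_cstar E) (graph_cstar F) \<psi>" "s \<in> E.seqs" "t \<in> E.seqs"
  shows "\<psi> (cls E s) \<in> carrier (graph_cstar F)"
    and "\<psi> (cls E (s + t)) = \<psi> (cls E s) \<oplus>\<^bsub>graph_cstar F\<^esub> \<psi> (cls E t)"
    and "\<psi> (cls E (s * t)) = \<psi> (cls E s) \<otimes>\<^bsub>graph_cstar F\<^esub> \<psi> (cls E t)"
    and "\<psi> (cls E (\<lambda>i. free_scale c (s i))) = scale (graph_cstar F) c (\<psi> (cls E s))"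
    and "\<psi> (cls E (\<lambda>i. free_star (s i))) = star (graph_cstar F) (\<psi> (cls E s))"
  using assms E.cls_in
  by (simp_all add: star_hom_def Pi_iff E.cls_add[symmetric] E.cls_mult[symmetric]
      E.cls_scale[symmetric] E.cls_star[symmetric])

text \<open>The representatives are merely chosen: \<open>r\<close> is not claimed to be linear or
  multiplicative, and all algebra goes through \<open>star_homD\<close>.\<close>

lemma star_hom_lift:
  assumes \<psi>: "star_hom (graph_cstar E) (graph_cstar F) \<psi>"
  obtains r where "\<And>s. s \<in> E.seqs \<Longrightarrow> r s \<in> F.seqs" "\<And>s. s \<in> E.seqs \<Longrightarrow> \<psi> (cls E s) = cls F (r s)"
proof -
  have "\<forall>s\<in>E.seqs. \<exists>t\<in>F.seqs. \<psi> (cls E s) = cls F t"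
    using star_homD(1)[OF \<psi>] by (meson F.carrierE)
  then show ?thesis using that by metis
qed

text \<open>The norm of the image is a C*-seminorm on the Cauchy sequences and vanishes on null
  sequences, so \<open>E.L.dominates\<close> applies.\<close>

lemma star_hom_contractive:
  assumes \<psi>: "star_hom (graph_cstar E) (graph_cstar F) \<psi>" and "s \<in> E.seqs"
  shows "cnorm (graph_cstar F) (\<psi> (cls E s)) \<le> E.seqs_norm s"
proof -
  obtain r where rin: "\<And>s. s \<in> E.seqs \<Longrightarrow> r s \<in> F.seqs"
    and r: "\<And>s. s \<in> E.seqs \<Longrightarrow> \<psi> (cls E s) = cls F (r s)"
    using star_hom_lift[OF \<psi>] by blast
  note hom = star_homD[OF \<psi>]
  define q where "q s = cnorm (graph_cstar F) (\<psi> (cls E s))" for s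
  have q: "q s = F.seqs_norm (r s)" if "s \<in> E.seqs" for s
    by (simp add: q_def r that F.cls_norm rin)
  have q_st: "q ((\<lambda>i. free_star (s i)) * s) = F.seqs_norm ((\<lambda>i. free_star (r s i)) * r s)"
    if "s \<in> E.seqs" for s
    unfolding q_def hom(3)[OF E.L.st_in[OF that] that] hom(5)[OF that that]
    by (simp add: r rin that F.cls_star F.cls_mult F.L.closed F.cls_norm)
  have "cstar_seminorm E.seqs (\<lambda>c s i. free_scale c (s i)) (\<lambda>s i. free_star (s i)) q"
  proof
    fix s t c assume s: "s \<in> E.seqs"
    show "0 \<le> q s" by (simp add: q s rin F.L.p_nonneg)
    show "q (\<lambda>i. free_scale c (s i)) = cmod c * q s"
      unfolding q_def hom(4)[OF s s] by (simp add: r s rin F.cls_scale F.cls_norm F.L.closed F.L.p_sc)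
    show "q ((\<lambda>i. free_star (s i)) * s) = (q s)\<^sup>2"
      by (simp add: q_st s F.L.p_cstar rin q)
    assume t: "t \<in> E.seqs"
    show "q (s + t) \<le> q s + q t"
      unfolding q_def hom(2)[OF s t]
      by (simp add: r s t rin F.cls_add F.cls_norm F.L.closed F.L.p_add)
    show "q (s * t) \<le> q s * q t"
      unfolding q_def hom(3)[OF s t]
      by (simp add: r s t rin F.cls_mult F.cls_norm F.L.closed F.L.p_mult)
  qed
  moreover have "q s = 0" if s: "s \<in> E.seqs" and 0: "E.seqs_norm s = 0" for s
  proof -
    \<comment> \<open>A null sequence represents the same class as its multiple by 0, and
      homogeneity of \<psi> sends that class to zero.\<close>
    have "cls E s = cls E (\<lambda>i. free_scale 0 (s i))"
      using s 0 by (intro E.cls_eqI) (simp add: E.L.eqv_zero_iff zero_fun_def[symmetric])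
    then have "q s = cnorm (graph_cstar F) (\<psi> (cls E (\<lambda>i. free_scale 0 (s i))))"
      unfolding q_def by (rule arg_cong)
    also have "\<dots> = cnorm (graph_cstar F) (scale (graph_cstar F) 0 (\<psi> (cls E s)))"
      by (simp only: hom(4)[OF s s])
    also have "\<dots> = 0"
      by (simp add: r s rin F.cls_scale F.cls_norm F.const_seqs F.zero_in F.seqs_const_norm)
    finally show ?thesis .
  qed
  ultimately have "q s \<le> E.seqs_norm s" using assms(2) by (intro E.L.dominates) auto
  then show ?thesis by (simp add: q_def)
qed

lemma star_hom_dist:
  assumes \<psi>: "star_hom (graph_cstar E) (graph_cstar F) \<psi>"
    and in_seqs: "s \<in> E.seqs" "t \<in> E.seqs" "r \<in> F.seqs" "u \<in> F.seqs"
    and "\<psi> (cls E s) = cls F r" "\<psi> (cls E t) = cls F u"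
  shows "F.seqs_norm (r - u) \<le> E.seqs_norm (s - t)"
proof -
  have diff: "s - t = s + (\<lambda>i. free_scale (- 1) (t i))" "r - u = r + (\<lambda>i. free_scale (- 1) (u i))"
    by (auto simp: free.sc_minus_one)
  have "\<psi> (cls E (s - t)) = \<psi> (cls E s) \<oplus>\<^bsub>graph_cstar F\<^esub> scale (graph_cstar F) (- 1) (\<psi> (cls E t))"
    unfolding diff star_homD(2)[OF \<psi> in_seqs(1) E.L.sc_in[OF in_seqs(2)]]
      star_homD(4)[OF \<psi> in_seqs(2,2)] ..
  also have "\<dots> = cls F (r - u)"
    unfolding diff assms(6,7) F.cls_scale[OF in_seqs(4)]
    by (rule F.cls_add[OF in_seqs(3) F.L.sc_in[OF in_seqs(4)]])
  finally have "\<psi> (cls E (s - t)) = cls F (r - u)" .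
  with star_hom_contractive[OF \<psi> E.L.diff_in[OF in_seqs(1,2)]]
  show ?thesis by (simp add: F.cls_norm F.L.closed in_seqs)
qed

lemma star_hom_zero:
  assumes \<psi>: "star_hom (graph_cstar E) (graph_cstar F) \<psi>"
  shows "\<psi> (cls E (\<lambda>_. 0)) = cls F (\<lambda>_. 0)"
proof -
  have 0: "(\<lambda>_. 0) \<in> E.seqs" by (intro E.const_seqs E.zero_in)
  obtain r where r: "r \<in> F.seqs" "\<psi> (cls E (\<lambda>_. 0)) = cls F r"
    using F.carrierE[OF star_homD(1)[OF \<psi> 0 0]] by metis
  have "\<psi> (cls E (\<lambda>_. 0)) = scale (graph_cstar F) 0 (\<psi> (cls E (\<lambda>_. 0)))"
    using star_homD(4)[OF \<psi> 0 0, of 0] by simp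
  then show ?thesis by (simp add: r F.cls_scale)
qed

text \<open>Agreement on generators extends to constant sequences by
  \<open>free_carrier_induct\<close>, and to all of C*(E) by density, both maps being
  contractive.\<close>

lemma star_hom_unique:
  assumes \<psi>: "star_hom (graph_cstar E) (graph_cstar F) \<psi>"
    and \<psi>': "star_hom (graph_cstar E) (graph_cstar F) \<psi>'"
    and vert: "\<And>v. v \<in> verts E \<Longrightarrow> \<psi> (S_vert E v) = \<psi>' (S_vert E v)"
    and arc: "\<And>e. e \<in> arcs E \<Longrightarrow> \<psi> (S_arc E e) = \<psi>' (S_arc E e)"
    and a: "a \<in> carrier (graph_cstar E)"
  shows "\<psi> a = \<psi>' a"
proof -
  have const: "\<psi> (cls E (\<lambda>_. x)) = \<psi>' (cls E (\<lambda>_. x))" if "x \<in> free_carrier E" for x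
    using that
  proof (induction rule: free_carrier_induct)
    case zero
    show ?case by (simp add: star_hom_zero[OF \<psi>] star_hom_zero[OF \<psi>'])
  qed (use \<psi> \<psi>' in \<open>simp_all add: star_hom_def E.const_seqs
        E.const_cls_ops[symmetric] vert[unfolded E.S_vert_cls] arc[unfolded E.S_arc_cls]\<close>)
  obtain s where s: "s \<in> E.seqs" "a = cls E s" using a by (rule E.carrierE)
  obtain r where r: "r \<in> F.seqs" "\<psi> (cls E s) = cls F r"
    using F.carrierE[OF star_homD(1)[OF \<psi> s(1) s(1)]] by metis
  obtain r' where r': "r' \<in> F.seqs" "\<psi>' (cls E s) = cls F r'"
    using F.carrierE[OF star_homD(1)[OF \<psi>' s(1) s(1)]] by metis
  have "F.seqs_norm (r - r') \<le> 0"
  proof (rule field_le_epsilon)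
    fix \<epsilon> :: real assume "\<epsilon> > 0"
    then obtain k where k: "E.seqs_norm (\<lambda>i. s i - s k) < \<epsilon> / 2"
      using E.seqs_norm_tail[OF s(1), of "\<epsilon> / 2"] by auto
    \<comment> \<open>The constant sequence at a late term of \<open>s\<close>: both maps agree on
      it, so both images of \<open>s\<close> lie within \<epsilon>/2 of one element.\<close>
    let ?c = "\<lambda>_. s k"
    have c: "?c \<in> E.seqs" by (intro E.const_seqs E.seqsD s)
    obtain u where u: "u \<in> F.seqs" "\<psi> (cls E ?c) = cls F u"
      using F.carrierE[OF star_homD(1)[OF \<psi> c c]] by metis
    have u': "\<psi>' (cls E ?c) = cls F u" using const[OF E.seqsD[OF s(1)], of k] u by simp
    have "F.seqs_norm (r - u) \<le> E.seqs_norm (s - ?c)"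
      by (rule star_hom_dist[OF \<psi> s(1) c r(1) u(1) r(2) u(2)])
    moreover have "F.seqs_norm (r' - u) \<le> E.seqs_norm (s - ?c)"
      by (rule star_hom_dist[OF \<psi>' s(1) c r'(1) u(1) r'(2) u'])
    moreover have "F.seqs_norm (r - r') \<le> F.seqs_norm (r - u) + F.seqs_norm (u - r')"
      by (intro F.L.p_triangle r r' u)
    moreover have "F.seqs_norm (u - r') = F.seqs_norm (r' - u)"
      by (intro F.L.p_diff_commute r' u)
    ultimately show "F.seqs_norm (r - r') \<le> 0 + \<epsilon>"
      using k by (simp add: fun_diff_def)
  qed
  then have "F.L.eqv r r'" by (intro F.L.eqvI r r')
  then have "cls F r = cls F r'" by (rule F.cls_eqI)
  with r r' s show ?thesis by simp
qed

text \<open>Pulled back along \<open>free_hom T\<close>, the norm of \<open>F\<close> is one of the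
  seminorms of which \<open>graph_norm E\<close> is the supremum.\<close>

lemma free_hom_norm_le:
  assumes T: "\<And>v. v \<in> verts E \<Longrightarrow> T (Vert v) \<in> free_carrier F"
      "\<And>e. e \<in> arcs E \<Longrightarrow> T (Arc e) \<in> free_carrier F"
    and null: "\<And>r. r \<in> graph_relations E \<Longrightarrow> F.eqv (free_hom T r) 0"
    and x: "x \<in> free_carrier E"
  shows "graph_norm F (free_hom T x) \<le> graph_norm E x"
proof -
  note [simp] = free_hom_in[where E = E, OF T]
  have "cstar_seminorm (free_carrier E) free_scale free_star (\<lambda>x. graph_norm F (free_hom T x))"
    by standard
       (simp_all add: F.p_nonneg free_hom_add F.p_add free_hom_scale F.p_sc free_hom_mult F.p_mult
         free_hom_star F.p_cstar)
  then have "graph_seminorm E (\<lambda>x. graph_norm F (free_hom T x))"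
    using null by (simp add: graph_seminorm_iff F.eqv_zero_iff)
  then show ?thesis using graph_norm_upper[OF E.wf _ x] by fast
qed

text \<open>The universal property: existence by applying \<open>free_hom T\<close> termwise,
  uniqueness by \<open>star_hom_unique\<close>, which together resolve the definite description. The
  last clause evaluates the map on every polynomial in the generators, so that composites can be
  computed in free algebras.\<close>

theorem cstar_hom_of_free_hom:
  assumes T: "\<And>v. v \<in> verts E \<Longrightarrow> T (Vert v) \<in> free_carrier F"
      "\<And>e. e \<in> arcs E \<Longrightarrow> T (Arc e) \<in> free_carrier F"
    and null: "\<And>r. r \<in> graph_relations E \<Longrightarrow> F.eqv (free_hom T r) 0"
    and tv: "\<And>v. v \<in> verts E \<Longrightarrow> tv v = F.const_cls (T (Vert v))"
    and te: "\<And>e. e \<in> arcs E \<Longrightarrow> te e = F.const_cls (T (Arc e))"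
  shows "star_hom (graph_cstar E) (graph_cstar F) (cstar_hom_of E (graph_cstar F) tv te)"
    and "v \<in> verts E \<Longrightarrow> cstar_hom_of E (graph_cstar F) tv te (S_vert E v) = F.const_cls (T (Vert v))"
    and "e \<in> arcs E \<Longrightarrow> cstar_hom_of E (graph_cstar F) tv te (S_arc E e) = F.const_cls (T (Arc e))"
    and "x \<in> free_carrier E \<Longrightarrow>
      cstar_hom_of E (graph_cstar F) tv te (E.const_cls x) = F.const_cls (free_hom T x)"
proof -
  note hom_in = free_hom_in[where E = E, OF T]
  note le = free_hom_norm_le[OF T null]
  define H where "H s = (\<lambda>i. free_hom T (s i))" for s :: "nat \<Rightarrow> ('v, 'e) free_alg"
  have H_ops: "H (s + t) = H s + H t" "H (s * t) = H s * H t" "H (s - t) = H s - H t"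
    "H (\<lambda>i. free_scale c (s i)) = (\<lambda>i. free_scale c (H s i))"
    "H (\<lambda>i. free_star (s i)) = (\<lambda>i. free_star (H s i))" for s t c
    by (auto simp: H_def free_hom_add free_hom_mult free_hom_diff free_hom_scale free_hom_star)
  have H_in: "H s \<in> F.seqs" if s: "s \<in> E.seqs" for s
    unfolding F.seqs_def
  proof (intro CollectI conjI allI impI)
    show "H s i \<in> free_carrier F" for i by (simp add: H_def hom_in E.seqsD s)
    fix r :: real assume "r > 0"
    then obtain N where N: "\<forall>i\<ge>N. \<forall>j\<ge>N. graph_norm E (s i - s j) < r"
      using s unfolding E.seqs_def by blast
    have "graph_norm F (H s i - H s j) \<le> graph_norm E (s i - s j)" for i j
      using le[of "s i - s j"] s by (simp add: H_def free_hom_diff E.seqsD free.closed)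
    with N show "\<exists>N. \<forall>i\<ge>N. \<forall>j\<ge>N. graph_norm F (H s i - H s j) < r"
      by (meson order.strict_trans1)
  qed
  have H_norm: "F.seqs_norm (H s) \<le> E.seqs_norm s" if s: "s \<in> E.seqs" for s
    by (rule LIMSEQ_le[OF F.seqs_norm_lim[OF H_in[OF s]] E.seqs_norm_lim[OF s]])
       (auto simp: H_def le E.seqsD s)
  have H_eqv: "F.L.eqv (H s) (H t)" if st: "E.L.eqv s t" for s t
    using st H_norm[of "s - t"]
    by (intro F.L.eqvI) (auto simp: H_in H_ops E.L.eqv_def E.L.closed)
  \<comment> \<open>Restricted to the carrier because the description asks for an extensional
    function.\<close>
  define \<Psi> where "\<Psi> = (\<lambda>a\<in>carrier (graph_cstar E). \<Union>s\<in>a. cls F (H s))"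
  have \<Psi>: "\<Psi> (cls E s) = cls F (H s)" if s: "s \<in> E.seqs" for s
  proof -
    have "(\<Union>s'\<in>cls E s. cls F (H s')) = cls F (H s)"
      by (intro E.UN_cls s F.cls_eqI H_eqv) (erule E.L.eqv_sym)
    with s show ?thesis by (simp add: \<Psi>_def)
  qed
  have hom: "star_hom (graph_cstar E) (graph_cstar F) \<Psi>"
    unfolding star_hom_def
    by (auto elim!: E.carrierE simp: \<Psi> H_in E.cls_add F.cls_add E.cls_mult F.cls_mult
        E.cls_scale F.cls_scale E.cls_star F.cls_star E.L.closed H_ops)
  have const: "\<Psi> (E.const_cls x) = F.const_cls (free_hom T x)" if "x \<in> free_carrier E" for x
    using that by (simp add: \<Psi> E.const_seqs) (simp add: H_def)
  have vert: "\<Psi> (S_vert E v) = F.const_cls (T (Vert v))" if "v \<in> verts E" for v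
    using that by (simp add: E.S_vert_cls const gen_vert_in free_hom_gen)
  have arc: "\<Psi> (S_arc E e) = F.const_cls (T (Arc e))" if "e \<in> arcs E" for e
    using that by (simp add: E.S_arc_cls const gen_arc_in free_hom_gen)
  have "cstar_hom_of E (graph_cstar F) tv te = \<Psi>"
    unfolding cstar_hom_of_def
  proof (rule the_equality)
    show "\<Psi> \<in> extensional (carrier (graph_cstar E)) \<and> star_hom (graph_cstar E) (graph_cstar F) \<Psi>
        \<and> (\<forall>v\<in>verts E. \<Psi> (S_vert E v) = tv v) \<and> (\<forall>e\<in>arcs E. \<Psi> (S_arc E e) = te e)"
      using hom by (simp add: vert arc tv te) (simp add: \<Psi>_def)
    fix \<psi>
    assume \<psi>: "\<psi> \<in> extensional (carrier (graph_cstar E)) \<and> star_hom (graph_cstar E) (graph_cstar F) \<psi>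
        \<and> (\<forall>v\<in>verts E. \<psi> (S_vert E v) = tv v) \<and> (\<forall>e\<in>arcs E. \<psi> (S_arc E e) = te e)"
    show "\<psi> = \<Psi>"
    proof (rule extensionalityI)
      show "\<psi> \<in> extensional (carrier (graph_cstar E))" using \<psi> by blast
      show "\<Psi> \<in> extensional (carrier (graph_cstar E))" by (simp add: \<Psi>_def)
      show "\<psi> a = \<Psi> a" if "a \<in> carrier (graph_cstar E)" for a
        using \<psi> by (intro star_hom_unique[OF _ hom _ _ that]) (simp_all add: vert arc tv te)
    qed
  qed
  then show "star_hom (graph_cstar E) (graph_cstar F) (cstar_hom_of E (graph_cstar F) tv te)"
    "v \<in> verts E \<Longrightarrow> cstar_hom_of E (graph_cstar F) tv te (S_vert E v) = F.const_cls (T (Vert v))"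
    "e \<in> arcs E \<Longrightarrow> cstar_hom_of E (graph_cstar F) tv te (S_arc E e) = F.const_cls (T (Arc e))"
    "x \<in> free_carrier E \<Longrightarrow>
      cstar_hom_of E (graph_cstar F) tv te (E.const_cls x) = F.const_cls (free_hom T x)"
    by (simp_all add: hom vert arc const)
qed

end

lemma star_hom_compose:
  "star_hom A B f \<Longrightarrow> star_hom B C g \<Longrightarrow> star_hom A C (\<lambda>x. g (f x))"
  by (simp add: star_hom_def Pi_iff)

lemma star_hom_id: "star_hom A A (\<lambda>x. x)"
  by (simp add: star_hom_def)


section \<open>Pullback along coverings of graphs\<close>

lemmas gens_closed = gen_vert_in gen_arc_in free.closed

section \<open>Consequences of the defining relations\<close>

context graph_algebra
begin

lemma verts_in [simp]: "e \<in> arcs E \<Longrightarrow> head E e \<in> verts E" "e \<in> arcs E \<Longrightarrow> tail E e \<in> verts E"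
  using wf by (auto simp: wf_digraph_def)

lemma relation_eqv:
  assumes "x - y \<in> graph_relations E" "x \<in> free_carrier E" "y \<in> free_carrier E"
  shows "eqv x y"
  using assms graph_norm_seminorm[OF wf] by (simp add: eqv_def graph_seminorm_iff)

lemma vert_star: "v \<in> verts E \<Longrightarrow> eqv (free_star (gen_vert v)) (gen_vert v)"
  by (rule relation_eqv) (auto simp: graph_relations_def gens_closed)

lemma vert_idem: "v \<in> verts E \<Longrightarrow> eqv (gen_vert v * gen_vert v) (gen_vert v)"
  by (rule relation_eqv) (auto simp: graph_relations_def gens_closed)

lemma vert_orth: "u \<in> verts E \<Longrightarrow> v \<in> verts E \<Longrightarrow> u \<noteq> v \<Longrightarrow> eqv (gen_vert u * gen_vert v) 0"
  by (rule relation_eqv) (auto simp: graph_relations_def gens_closed)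

lemma arc_isometry: "e \<in> arcs E \<Longrightarrow> eqv (free_star (gen_arc e) * gen_arc e) (gen_vert (head E e))"
  by (rule relation_eqv) (auto simp: graph_relations_def gens_closed)

lemma arc_orth: "e \<in> arcs E \<Longrightarrow> e' \<in> arcs E \<Longrightarrow> e \<noteq> e' \<Longrightarrow> eqv (free_star (gen_arc e) * gen_arc e') 0"
  by (rule relation_eqv) (auto simp: graph_relations_def gens_closed)

lemma tail_arc: "e \<in> arcs E \<Longrightarrow> eqv (gen_vert (tail E e) * gen_arc e) (gen_arc e)"
  by (rule relation_eqv) (auto simp: graph_relations_def gens_closed)

lemma vert_sum:
  "v \<in> regular_verts E \<Longrightarrow> eqv (gen_vert v) (\<Sum>e\<in>out_arcs E v. gen_arc e * free_star (gen_arc e))"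
proof (rule relation_eqv)
  assume "v \<in> regular_verts E"
  then show "gen_vert v - (\<Sum>e\<in>out_arcs E v. gen_arc e * free_star (gen_arc e)) \<in> graph_relations E"
    unfolding graph_relations_def by blast
  show "(\<Sum>e\<in>out_arcs E v. gen_arc e * free_star (gen_arc e)) \<in> free_carrier E"
    by (intro gens_closed) auto
  show "gen_vert v \<in> free_carrier E"
    using \<open>v \<in> regular_verts E\<close> by (intro gens_closed) (simp add: regular_verts_def)
qed

lemma eqv_mult_left: "eqv x y \<Longrightarrow> z \<in> free_carrier E \<Longrightarrow> eqv (z * x) (z * y)"
  by (intro eqv_mult eqv_refl)

lemma eqv_mult_right: "eqv x y \<Longrightarrow> z \<in> free_carrier E \<Longrightarrow> eqv (x * z) (y * z)"
  by (intro eqv_mult eqv_refl)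

text \<open>This identity is not among the relations. For x = S_e S_t - S_e with t the target of e,
  the product x^* x cancels by S_e^* S_e = S_t, and the C*-identity gives x = 0 modulo null
  elements.\<close>

lemma arc_head:
  assumes e: "e \<in> arcs E" shows "eqv (gen_arc e * gen_vert (head E e)) (gen_arc e)"
proof -
  let ?e = "gen_arc e :: ('v, 'e) free_alg" and ?h = "gen_vert (head E e) :: ('v, 'e) free_alg"
  have C: "?e \<in> free_carrier E" "?h \<in> free_carrier E" using e by (auto simp: gens_closed)
  have h: "head E e \<in> verts E" using e by simp
  let ?x = "?e * ?h - ?e"
  have "free_star ?x * ?x = (free_star ?h * (free_star ?e * ?e) * ?h - free_star ?h * (free_star ?e * ?e))
      - ((free_star ?e * ?e) * ?h - free_star ?e * ?e)"
    by (simp add: free.st_diff free.st_mult algebra_simps)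
  also have "eqv \<dots> ((?h * ?h * ?h - ?h * ?h) - (?h * ?h - ?h))"
    using C by (intro eqv_diff eqv_mult arc_isometry e vert_star h eqv_refl)
  also have "eqv \<dots> ((?h * ?h - ?h) - (?h - ?h))"
    using C by (intro eqv_diff eqv_mult_right vert_idem h eqv_refl)
  also have "eqv \<dots> ((?h - ?h) - (?h - ?h))"
    using C by (intro eqv_diff vert_idem h eqv_refl)
  finally have "eqv (free_star ?x * ?x) 0" by simp
  from eqv_p[OF this] have "graph_norm E ?x = 0"
    using C by (simp add: p_cstar gens_closed)
  then show ?thesis using C by (simp add: eqv_def gens_closed)
qed

lemma head_arc_star:
  assumes e: "e \<in> arcs E"
  shows "eqv (gen_vert (head E e) * free_star (gen_arc e)) (free_star (gen_arc e))"
proof -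
  have "eqv (gen_vert (head E e) * free_star (gen_arc e)) (free_star (gen_vert (head E e)) * free_star (gen_arc e))"
    using e by (intro eqv_mult_right eqv_sym[OF vert_star] gens_closed) auto
  also have "eqv \<dots> (free_star (gen_arc e))"
    using eqv_st[OF arc_head[OF e]] by (simp add: free.st_mult)
  finally show ?thesis .
qed

text \<open>Inserting the source projection of the edge brings two distinct vertex projections
  together; the next two orthogonality statements insert target projections in the same way.\<close>

lemma vert_arc_orth:
  assumes "e \<in> arcs E" "v \<in> verts E" "tail E e \<noteq> v"
  shows "eqv (gen_vert v * gen_arc e) 0"
proof -
  have "eqv (gen_vert v * gen_arc e) (gen_vert v * (gen_vert (tail E e) * gen_arc e))"
    using assms by (intro eqv_mult_left eqv_sym[OF tail_arc] gens_closed)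
  also have "\<dots> = gen_vert v * gen_vert (tail E e) * gen_arc e" by (simp add: mult.assoc)
  also have "eqv \<dots> (0 * gen_arc e)"
    using assms by (intro eqv_mult_right vert_orth gens_closed) auto
  finally show ?thesis by simp
qed

lemma arc_vert_orth:
  assumes "e \<in> arcs E" "v \<in> verts E" "head E e \<noteq> v"
  shows "eqv (gen_arc e * gen_vert v) 0"
proof -
  have "eqv (gen_arc e * gen_vert v) (gen_arc e * gen_vert (head E e) * gen_vert v)"
    using assms by (intro eqv_mult_right eqv_sym[OF arc_head] gens_closed)
  also have "\<dots> = gen_arc e * (gen_vert (head E e) * gen_vert v)" by (simp add: mult.assoc)
  also have "eqv \<dots> (gen_arc e * 0)"
    using assms by (intro eqv_mult_left vert_orth gens_closed) auto
  finally show ?thesis by simp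
qed

lemma arc_star_orth:
  assumes "e \<in> arcs E" "e' \<in> arcs E" "head E e \<noteq> head E e'"
  shows "eqv (gen_arc e * free_star (gen_arc e')) 0"
proof -
  have "eqv (gen_arc e * free_star (gen_arc e')) (gen_arc e * (gen_vert (head E e') * free_star (gen_arc e')))"
    using assms by (intro eqv_mult_left eqv_sym[OF head_arc_star] gens_closed)
  also have "\<dots> = gen_arc e * gen_vert (head E e') * free_star (gen_arc e')" by (simp add: mult.assoc)
  also have "eqv \<dots> (0 * free_star (gen_arc e'))"
    using assms by (intro eqv_mult_right arc_vert_orth gens_closed) auto
  finally show ?thesis by simp
qed

text \<open>Off-diagonal products vanish. Equal index sets give idempotence, disjoint ones
  orthogonality, so one statement covers both relations.\<close>

lemma eqv_double_sum:
  assumes "finite A" "finite B"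
    and "\<And>i j. i \<in> A \<Longrightarrow> j \<in> B \<Longrightarrow> eqv (f i * g j) (if i = j then h i else 0)"
  shows "eqv (sum f A * sum g B) (sum h (A \<inter> B))"
proof -
  have "sum f A * sum g B = (\<Sum>i\<in>A. \<Sum>j\<in>B. f i * g j)" by (rule sum_product)
  also have "eqv \<dots> (\<Sum>i\<in>A. \<Sum>j\<in>B. if i = j then h i else 0)"
    by (intro eqv_sum assms)
  also have "\<dots> = sum h (A \<inter> B)"
    using assms by (simp add: sum.inter_restrict)
  finally show ?thesis .
qed

end

section \<open>Fibre sums along graph maps\<close>

lemma (in graph_algebra_pair) relations_preservedI:
  assumes "\<And>v. v \<in> verts E \<Longrightarrow> F.eqv (free_star (T (Vert v))) (T (Vert v))"
    and "\<And>v. v \<in> verts E \<Longrightarrow> F.eqv (T (Vert v) * T (Vert v)) (T (Vert v))"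
    and "\<And>u v. u \<in> verts E \<Longrightarrow> v \<in> verts E \<Longrightarrow> u \<noteq> v \<Longrightarrow> F.eqv (T (Vert u) * T (Vert v)) 0"
    and "\<And>e. e \<in> arcs E \<Longrightarrow> F.eqv (free_star (T (Arc e)) * T (Arc e)) (T (Vert (head E e)))"
    and "\<And>e e'. e \<in> arcs E \<Longrightarrow> e' \<in> arcs E \<Longrightarrow> e \<noteq> e' \<Longrightarrow> F.eqv (free_star (T (Arc e)) * T (Arc e')) 0"
    and "\<And>e. e \<in> arcs E \<Longrightarrow> F.eqv (T (Vert (tail E e)) * T (Arc e)) (T (Arc e))"
    and "\<And>v. v \<in> regular_verts E \<Longrightarrow>
      F.eqv (T (Vert v)) (\<Sum>e\<in>out_arcs E v. T (Arc e) * free_star (T (Arc e)))"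
    and "r \<in> graph_relations E"
  shows "F.eqv (free_hom T r) 0"
  using assms(8) unfolding graph_relations_def
  by (elim UnE CollectE exE conjE)
     (simp_all add: assms(1-7) free_hom_diff free_hom_star free_hom_mult free_hom_gen free_hom_sum
       F.eqv_diff_zero_iff[THEN iffD1, THEN conjunct2, THEN conjunct2])

text \<open>The conditions under which fibre sums satisfy the relations, shared by f and g. By
  \<open>head_bij\<close>, each vertex over the target of \<open>e\<close> receives exactly one edge
  over \<open>e\<close>. By \<open>regular\<close>, the summation relation is available at every
  vertex over a regular one.\<close>

locale graph_cover = G: graph_algebra G + H: graph_algebra H
  for G :: "('v1, 'e1) pre_digraph" and H :: "('v, 'e) pre_digraph" +
  fixes h :: "('v1, 'e1, 'v, 'e) graph_map"
  assumes pe_arcs: "x \<in> arcs G \<Longrightarrow> snd h x \<in> arcs H"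
    and pe_tail: "x \<in> arcs G \<Longrightarrow> tail H (snd h x) = fst h (tail G x)"
    and finite_V: "v \<in> verts H \<Longrightarrow> finite {u \<in> verts G. fst h u = v}"
    and head_bij: "e \<in> arcs H \<Longrightarrow>
      bij_betw (head G) {x \<in> arcs G. snd h x = e} {u \<in> verts G. fst h u = head H e}"
    and regular: "u \<in> verts G \<Longrightarrow> fst h u \<in> regular_verts H \<Longrightarrow> u \<in> regular_verts G"
begin

sublocale graph_algebra_pair H G ..

abbreviation V :: "'v \<Rightarrow> 'v1 set" where
  "V v \<equiv> {u \<in> verts G. fst h u = v}"

abbreviation A :: "'e \<Rightarrow> 'e1 set" where
  "A e \<equiv> {x \<in> arcs G. snd h x = e}"

definition T :: "('v, 'e) gen \<Rightarrow> ('v1, 'e1) free_alg" where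
  "T g = (case g of Vert v \<Rightarrow> \<Sum>u\<in>V v. gen_vert u | Arc e \<Rightarrow> \<Sum>x\<in>A e. gen_arc x)"

lemma T_simps: "T (Vert v) = (\<Sum>u\<in>V v. gen_vert u)" "T (Arc e) = (\<Sum>x\<in>A e. gen_arc x)"
  by (simp_all add: T_def)

lemma finite_A: "e \<in> arcs H \<Longrightarrow> finite (A e)"
  using bij_betw_finite[OF head_bij] finite_V[OF H.verts_in(1)] by blast

lemma T_in: "T (Vert v) \<in> free_carrier G" "T (Arc e) \<in> free_carrier G"
  by (auto simp: T_simps intro!: free.sum_in gen_vert_in gen_arc_in)

text \<open>Distinct edges over \<open>e\<close> have distinct targets by \<open>head_bij\<close>,
  so the cross terms S_x S_y^* vanish.\<close>

lemma arc_star_sum: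
  assumes "e \<in> arcs H"
  shows "G.eqv (T (Arc e) * free_star (T (Arc e))) (\<Sum>x\<in>A e. gen_arc x * free_star (gen_arc x))"
proof -
  have "G.eqv (T (Arc e) * free_star (T (Arc e))) (\<Sum>x\<in>A e \<inter> A e. gen_arc x * free_star (gen_arc x))"
    unfolding T_simps free.st_sum
  proof (rule G.eqv_double_sum)
    fix x y assume xy: "x \<in> A e" "y \<in> A e"
    show "G.eqv (gen_arc x * free_star (gen_arc y)) (if x = y then gen_arc x * free_star (gen_arc x) else 0)"
    proof (cases "x = y")
      case False
      then have "head G x \<noteq> head G y"
        using head_bij[OF assms] xy by (auto simp: bij_betw_def dest: inj_onD)
      with False xy show ?thesis by (simp add: G.arc_star_orth)
    qed (use xy in \<open>auto intro!: G.eqv_refl gens_closed\<close>)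
  qed (simp_all only: finite_A assms)
  then show ?thesis by simp
qed

text \<open>The edges of \<open>G\<close> over those emitted by \<open>v\<close>, grouped once by
  source and once by image.\<close>

lemma sum_out_fibre:
  assumes v: "v \<in> verts H" and fin: "\<And>u. u \<in> V v \<Longrightarrow> finite (out_arcs G u)" "finite (out_arcs H v)"
  shows "(\<Sum>u\<in>V v. sum f (out_arcs G u)) = (\<Sum>e\<in>out_arcs H v. sum f (A e))"
proof -
  have "(\<Sum>u\<in>V v. sum f (out_arcs G u)) = sum f (\<Union>u\<in>V v. out_arcs G u)"
    using fin finite_V[OF v] by (intro sum.UNION_disjoint[symmetric]) auto
  also have "(\<Union>u\<in>V v. out_arcs G u) = (\<Union>e\<in>out_arcs H v. A e)"
    using pe_arcs pe_tail by auto
  also have "sum f \<dots> = (\<Sum>e\<in>out_arcs H v. sum f (A e))"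
    using fin finite_A by (intro sum.UNION_disjoint) auto
  finally show ?thesis .
qed

lemma relations_preserved:
  assumes "r \<in> graph_relations H" shows "G.eqv (free_hom T r) 0"
  using _ _ _ _ _ _ _ assms
proof (rule relations_preservedI)
  fix v assume v: "v \<in> verts H"
  show "G.eqv (free_star (T (Vert v))) (T (Vert v))"
    unfolding T_simps free.st_sum by (intro G.eqv_sum G.vert_star) simp
  have "G.eqv (T (Vert v) * T (Vert v)) (\<Sum>u\<in>V v \<inter> V v. gen_vert u)"
    unfolding T_simps
    by (rule G.eqv_double_sum) (simp_all only: finite_V v, auto simp: G.vert_idem G.vert_orth)
  then show "G.eqv (T (Vert v) * T (Vert v)) (T (Vert v))" by (simp add: T_simps)
next
  fix u v assume uv: "u \<in> verts H" "v \<in> verts H" "u \<noteq> v"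
  have "G.eqv (T (Vert u) * T (Vert v)) (\<Sum>u\<in>V u \<inter> V v. gen_vert u)"
    unfolding T_simps
    by (rule G.eqv_double_sum) (simp_all only: finite_V uv, auto simp: G.vert_idem G.vert_orth)
  moreover have "V u \<inter> V v = {}" using uv by auto
  ultimately show "G.eqv (T (Vert u) * T (Vert v)) 0" by simp
next
  fix e assume e: "e \<in> arcs H"
  have "G.eqv (free_star (T (Arc e)) * T (Arc e)) (\<Sum>x\<in>A e \<inter> A e. gen_vert (head G x))"
    unfolding T_simps free.st_sum
    by (rule G.eqv_double_sum) (simp_all only: finite_A e, auto simp: G.arc_isometry G.arc_orth)
  also have "(\<Sum>x\<in>A e \<inter> A e. gen_vert (head G x)) = T (Vert (head H e))"
    using sum.reindex_bij_betw[OF head_bij[OF e], of gen_vert] by (simp add: T_simps)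
  finally show "G.eqv (free_star (T (Arc e)) * T (Arc e)) (T (Vert (head H e)))" .
  have "G.eqv (T (Vert (tail H e)) * T (Arc e)) (\<Sum>x\<in>A e. gen_arc x)"
  proof -
    have "T (Vert (tail H e)) * T (Arc e) = (\<Sum>x\<in>A e. \<Sum>u\<in>V (tail H e). gen_vert u * gen_arc x)"
      unfolding T_simps by (subst sum.swap) (rule sum_product)
    also have "G.eqv \<dots> (\<Sum>x\<in>A e. \<Sum>u\<in>V (tail H e). if u = tail G x then gen_arc x else 0)"
      by (intro G.eqv_sum) (auto simp: G.tail_arc G.vert_arc_orth)
    also have "\<dots> = (\<Sum>x\<in>A e. gen_arc x)"
      using finite_V[of "tail H e"] e pe_tail by (intro sum.cong) (auto simp: sum.delta)
    finally show ?thesis .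
  qed
  then show "G.eqv (T (Vert (tail H e)) * T (Arc e)) (T (Arc e))" by (simp add: T_simps)
next
  fix e e' assume ee: "e \<in> arcs H" "e' \<in> arcs H" "e \<noteq> e'"
  have "G.eqv (free_star (T (Arc e)) * T (Arc e')) (\<Sum>x\<in>A e \<inter> A e'. gen_vert (head G x))"
    unfolding T_simps free.st_sum
    by (rule G.eqv_double_sum) (simp_all only: finite_A ee, auto simp: G.arc_isometry G.arc_orth)
  moreover have "A e \<inter> A e' = {}" using ee by auto
  ultimately show "G.eqv (free_star (T (Arc e)) * T (Arc e')) 0" by simp
next
  fix v assume v: "v \<in> regular_verts H"
  then have vH: "v \<in> verts H" and fin: "finite (out_arcs H v)" by (auto simp: regular_verts_def)
  have reg: "u \<in> regular_verts G" if "u \<in> V v" for u using that v regular by auto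
  have "G.eqv (T (Vert v)) (\<Sum>u\<in>V v. \<Sum>x\<in>out_arcs G u. gen_arc x * free_star (gen_arc x))"
    unfolding T_simps by (intro G.eqv_sum G.vert_sum reg)
  also have "\<dots> = (\<Sum>e\<in>out_arcs H v. \<Sum>x\<in>A e. gen_arc x * free_star (gen_arc x))"
    using reg by (intro sum_out_fibre vH fin) (auto simp: regular_verts_def)
  also have "G.eqv \<dots> (\<Sum>e\<in>out_arcs H v. T (Arc e) * free_star (T (Arc e)))"
    by (intro G.eqv_sum G.eqv_sym[OF arc_star_sum]) simp
  finally show "G.eqv (T (Vert v)) (\<Sum>e\<in>out_arcs H v. T (Arc e) * free_star (T (Arc e)))" .
qed

theorem pullback:
  shows "star_hom (graph_cstar H) (graph_cstar G) (cstar_pullback G H h)"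
    and "x \<in> free_carrier H \<Longrightarrow> cstar_pullback G H h (H.const_cls x) = G.const_cls (free_hom T x)"
proof -
  have "S_vert G = (\<lambda>u. G.const_cls (gen_vert u))" "S_arc G = (\<lambda>x. G.const_cls (gen_arc x))"
    by (simp_all add: fun_eq_iff G.S_vert_cls G.S_arc_cls)
  then have *: "v \<in> verts H \<Longrightarrow> (\<Oplus>\<^bsub>graph_cstar G\<^esub>u\<in>V v. S_vert G u) = G.const_cls (T (Vert v))"
    "e \<in> arcs H \<Longrightarrow> (\<Oplus>\<^bsub>graph_cstar G\<^esub>x\<in>A e. S_arc G x) = G.const_cls (T (Arc e))" for v e
    by (simp_all only: T_simps)
       (rule G.finsum_const_cls; auto simp: finite_V finite_A gen_vert_in gen_arc_in)+
  note hom = cstar_hom_of_free_hom[of T, OF T_in(1) T_in(2) relations_preserved *]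
  show "star_hom (graph_cstar H) (graph_cstar G) (cstar_pullback G H h)"
    unfolding cstar_pullback_def by (rule hom(1))
  show "cstar_pullback G H h (H.const_cls x) = G.const_cls (free_hom T x)" if "x \<in> free_carrier H"
    unfolding cstar_pullback_def by (rule hom(4)) (assumption | rule that)+
qed

end


section \<open>The combinatorics of out-splits\<close>

locale multi_split =
  fixes E :: "('v, 'e) pre_digraph" and m :: "'v \<Rightarrow> nat" and \<epsilon> :: "'v \<Rightarrow> nat \<Rightarrow> 'e set"
  assumes wf: "wf_digraph E" and data: "multi_split_data E m \<epsilon>"
begin

text \<open>Names the index that the tail map of \<open>multi_out_split\<close> hides in a definite
  description.\<close>

definition out_class :: "'e \<Rightarrow> nat" where
  "out_class e = (THE j. 1 \<le> j \<and> j \<le> m (tail E e) \<and> e \<in> \<epsilon> (tail E e) j)"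

abbreviation S :: "('v \<times> nat, 'e \<times> nat) pre_digraph" where
  "S \<equiv> multi_out_split E m \<epsilon>"

lemma tail_head_in: "e \<in> arcs E \<Longrightarrow> tail E e \<in> verts E" "e \<in> arcs E \<Longrightarrow> head E e \<in> verts E"
  using wf by (auto simp: wf_digraph_def)

lemma class_data:
  assumes "v \<in> verts E" "out_arcs E v \<noteq> {}"
  shows "(\<Union>i\<in>{1..m v}. \<epsilon> v i) = out_arcs E v" and "\<forall>i\<in>{1..m v}. \<epsilon> v i \<noteq> {}"
    and "\<forall>i\<in>{1..m v}. \<forall>j\<in>{1..m v}. i \<noteq> j \<longrightarrow> \<epsilon> v i \<inter> \<epsilon> v j = {}"
  using bspec[OF data[unfolded multi_split_data_def] assms(1)] assms(2)
  by (simp_all only: if_False simp_thms) (elim conjE, assumption)+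

lemma m_pos: "v \<in> verts E \<Longrightarrow> 1 \<le> m v"
  using data by (auto simp: multi_split_data_def split: if_splits)

lemma class_unique:
  assumes "e \<in> arcs E" shows "\<exists>!j. 1 \<le> j \<and> j \<le> m (tail E e) \<and> e \<in> \<epsilon> (tail E e) j"
proof -
  let ?v = "tail E e"
  have v: "?v \<in> verts E" and e: "e \<in> out_arcs E ?v" using assms tail_head_in by auto
  then have "out_arcs E ?v \<noteq> {}" by blast
  note U = class_data(1)[OF v this] and D = class_data(3)[OF v this]
  from e obtain j where j: "j \<in> {1..m ?v}" "e \<in> \<epsilon> ?v j" unfolding U[symmetric] by blast
  have unique: "i = j" if "i \<in> {1..m ?v}" "e \<in> \<epsilon> ?v i" for i
    using D that j by (metis disjoint_iff)
  show ?thesis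
  proof (rule ex1I[of _ j])
    show "1 \<le> j \<and> j \<le> m ?v \<and> e \<in> \<epsilon> ?v j" using j by simp
    show "i = j" if "1 \<le> i \<and> i \<le> m ?v \<and> e \<in> \<epsilon> ?v i" for i
      by (rule unique) (use that in simp_all)
  qed
qed

lemma out_class:
  assumes "e \<in> arcs E"
  shows "1 \<le> out_class e" "out_class e \<le> m (tail E e)" "e \<in> \<epsilon> (tail E e) (out_class e)"
  using theI'[OF class_unique[OF assms]] by (simp_all add: out_class_def)

lemma out_classI:
  "e \<in> arcs E \<Longrightarrow> 1 \<le> j \<Longrightarrow> j \<le> m (tail E e) \<Longrightarrow> e \<in> \<epsilon> (tail E e) j \<Longrightarrow> out_class e = j"
  using class_unique[of e] unfolding out_class_def by (intro the1_equality) auto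

lemma \<epsilon>_eq:
  assumes "v \<in> verts E" "out_arcs E v \<noteq> {}" "1 \<le> i" "i \<le> m v"
  shows "\<epsilon> v i = {e \<in> out_arcs E v. out_class e = i}"
proof -
  note U = class_data(1)[OF assms(1,2)]
  have sub: "e \<in> arcs E \<and> tail E e = v" if "e \<in> \<epsilon> v i" for e
  proof -
    have "e \<in> (\<Union>i\<in>{1..m v}. \<epsilon> v i)" using that assms by auto
    then show ?thesis unfolding U by simp
  qed
  show ?thesis using sub assms out_class(3) out_classI[of _ i] by auto
qed

lemma class_surj:
  assumes "v \<in> verts E" "out_arcs E v \<noteq> {}" "1 \<le> i" "i \<le> m v"
  shows "\<exists>e\<in>out_arcs E v. out_class e = i"
proof -
  have "\<epsilon> v i \<noteq> {}" using class_data(2)[OF assms(1,2)] assms(3,4) by simp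
  then show ?thesis using \<epsilon>_eq[OF assms] by blast
qed

lemma verts_S: "(v, i) \<in> verts S \<longleftrightarrow> v \<in> verts E \<and> 1 \<le> i \<and> i \<le> m v"
  by (simp add: multi_out_split_def)

lemma arcs_S: "(e, i) \<in> arcs S \<longleftrightarrow> e \<in> arcs E \<and> 1 \<le> i \<and> i \<le> m (head E e)"
  by (simp add: multi_out_split_def)

lemma tail_S: "tail S (e, i) = (tail E e, out_class e)"
  by (simp add: multi_out_split_def out_class_def)

lemma head_S: "head S (e, i) = (head E e, i)"
  by (simp add: multi_out_split_def)

lemma wf_S: "wf_digraph S"
proof
  fix x assume "x \<in> arcs S"
  then show "tail S x \<in> verts S" "head S x \<in> verts S"
    using out_class tail_head_in by (cases x; simp add: arcs_S tail_S head_S verts_S)+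
qed

lemma out_arcs_S:
  "out_arcs S (v, i) = (SIGMA e:{e \<in> out_arcs E v. out_class e = i}. {1..m (head E e)})"
  by (auto simp: arcs_S tail_S)

text \<open>For each edge of class \<open>i\<close>, the copy \<open>(v, i)\<close> emits one edge
  per copy of the target: at least one and finitely many. So finiteness is that of the class, and as
  classes are nonempty the copy is a sink only if \<open>v\<close> is.\<close>

lemma regular_S:
  assumes "(v, i) \<in> verts S"
  shows "(v, i) \<in> regular_verts S \<longleftrightarrow>
    finite {e \<in> out_arcs E v. out_class e = i} \<and> out_arcs E v \<noteq> {}"
proof -
  let ?B = "{e \<in> out_arcs E v. out_class e = i}"
  have v: "v \<in> verts E" "1 \<le> i" "i \<le> m v" using assms by (auto simp: verts_S)
  have B: "?B = fst ` out_arcs S (v, i)"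
    unfolding out_arcs_S using m_pos[OF tail_head_in(2)] by (force simp: image_iff)
  have "finite (out_arcs S (v, i)) \<longleftrightarrow> finite ?B"
  proof
    show "finite ?B" if "finite (out_arcs S (v, i))" unfolding B by (rule finite_imageI[OF that])
    show "finite (out_arcs S (v, i))" if "finite ?B" unfolding out_arcs_S using that by (rule finite_SigmaI) simp
  qed
  moreover have "out_arcs S (v, i) \<noteq> {} \<longleftrightarrow> ?B \<noteq> {}" unfolding B by simp
  moreover have "?B \<noteq> {} \<longleftrightarrow> out_arcs E v \<noteq> {}" using class_surj[OF v(1) _ v(2,3)] by blast
  ultimately show ?thesis using assms by (simp add: regular_verts_def)
qed

lemma split_proj_cover: "graph_cover S E split_proj"
proof (intro graph_cover.intro graph_algebra.intro graph_cover_axioms.intro)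
  let ?h = "split_proj :: ('v \<times> nat, 'e \<times> nat, 'v, 'e) graph_map"
  show "wf_digraph S" by (rule wf_S)
  show "wf_digraph E" by (rule wf)
  show "snd ?h x \<in> arcs E" if "x \<in> arcs S" for x
    using that by (cases x) (simp add: arcs_S split_proj_def)
  show "tail E (snd ?h x) = fst ?h (tail S x)" if "x \<in> arcs S" for x
    using that by (cases x) (simp add: tail_S split_proj_def)
  show "finite {u \<in> verts S. fst ?h u = v}" for v
    by (rule finite_subset[of _ "{v} \<times> {1..m v}"]) (auto simp: verts_S split_proj_def)
  \<comment> \<open>A copy of \<open>e\<close> is determined by the index of its target copy; this
    gives the inverse.\<close>
  show "bij_betw (head S) {x \<in> arcs S. snd ?h x = e} {u \<in> verts S. fst ?h u = head E e}"
    if "e \<in> arcs E" for e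
    by (rule bij_betwI[where g = "\<lambda>u. (e, snd u)"])
       (use that tail_head_in in \<open>auto simp: split_proj_def arcs_S verts_S head_S\<close>)
  show "u \<in> regular_verts S" if u: "u \<in> verts S" and reg: "fst ?h u \<in> regular_verts E" for u
  proof -
    obtain v i where [simp]: "u = (v, i)" by (cases u)
    have "finite {e \<in> out_arcs E v. out_class e = i}"
      by (rule finite_subset[of _ "out_arcs E v"]) (use reg in \<open>auto simp: split_proj_def regular_verts_def\<close>)
    then show ?thesis using u reg by (simp add: regular_S) (simp add: split_proj_def regular_verts_def)
  qed
qed

end

section \<open>The two out-splits at w and the map g\<close>

locale split_at =
  fixes E :: "('v, 'e) pre_digraph" and w :: 'v and m :: "'v \<Rightarrow> nat" and \<epsilon> :: "'v \<Rightarrow> nat \<Rightarrow> 'e set"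
    and n :: nat and en :: "nat \<Rightarrow> 'e"
  assumes wf: "wf_digraph E" and w: "w \<in> regular_verts E" and data: "out_split_data E w m \<epsilon>"
    and en: "bij_betw en {1..n} (out_arcs E w)"
begin

definition mM :: "'v \<Rightarrow> nat" where
  "mM v = (if v = w then n else 1)"

definition \<epsilon>M :: "'v \<Rightarrow> nat \<Rightarrow> 'e set" where
  "\<epsilon>M v i = (if v = w then {en i} else out_arcs E v)"

lemma w_in: "w \<in> verts E" and finite_out_w: "finite (out_arcs E w)" and out_w: "out_arcs E w \<noteq> {}"
  using w by (auto simp: regular_verts_def)

lemma en_in: "1 \<le> j \<Longrightarrow> j \<le> n \<Longrightarrow> en j \<in> out_arcs E w"
  using bij_betwE[OF en] by simp

lemma en_surj: "e \<in> out_arcs E w \<Longrightarrow> \<exists>j. 1 \<le> j \<and> j \<le> n \<and> en j = e"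
  using bij_betw_imp_surj_on[OF en] by (metis atLeastAtMost_iff imageE)

lemma en_inj: "1 \<le> i \<Longrightarrow> i \<le> n \<Longrightarrow> 1 \<le> j \<Longrightarrow> j \<le> n \<Longrightarrow> en i = en j \<Longrightarrow> i = j"
  using bij_betw_imp_inj_on[OF en] by (auto dest: inj_onD)

lemma n_pos: "1 \<le> n"
  using en_surj out_w by fastforce

end

sublocale split_at \<subseteq> O: multi_split E m \<epsilon>
  using wf data by (simp add: multi_split_def out_split_data_def)

sublocale split_at \<subseteq> M: multi_split E mM \<epsilon>M
proof
  have "(\<Union>i\<in>{1..n}. {en i}) = out_arcs E w"
    using bij_betw_imp_surj_on[OF en] by auto
  then show "multi_split_data E mM \<epsilon>M"
    using n_pos out_w en_inj by (auto simp: multi_split_data_def mM_def \<epsilon>M_def simp del: in_out_arcs_conv)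
qed (use wf in \<open>auto simp: wf_digraph_def\<close>)

context split_at
begin

lemma maximal_eq: "maximal_out_split E w n en = M.S"
  by (simp add: maximal_out_split_def mM_def[abs_def] \<epsilon>M_def[abs_def])

lemma m_other: "v \<in> verts E \<Longrightarrow> v \<noteq> w \<Longrightarrow> m v = 1"
  using data by (simp add: out_split_data_def)

lemma mM_simps [simp]: "mM w = n" "v \<noteq> w \<Longrightarrow> mM v = 1"
  by (simp_all add: mM_def)

lemma M_class_en: "1 \<le> j \<Longrightarrow> j \<le> n \<Longrightarrow> M.out_class (en j) = j"
  using en_in[of j] by (intro M.out_classI) (auto simp: mM_def \<epsilon>M_def)

lemma en_M_class: "e \<in> out_arcs E w \<Longrightarrow> en (M.out_class e) = e"
  using en_surj M_class_en by metis

lemma M_class_other: "e \<in> arcs E \<Longrightarrow> tail E e \<noteq> w \<Longrightarrow> M.out_class e = 1"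
  using M.out_class(1,2)[of e] by simp

lemma O_class_other: "e \<in> arcs E \<Longrightarrow> tail E e \<noteq> w \<Longrightarrow> O.out_class e = 1"
  using O.out_class(1,2)[of e] m_other[OF O.tail_head_in(1)] by simp

definition block :: "'v \<Rightarrow> nat \<Rightarrow> nat" where
  "block v j = (if v = w then O.out_class (en j) else 1)"

lemma block_in:
  assumes "v \<in> verts E" "1 \<le> j" "j \<le> mM v"
  shows "1 \<le> block v j" "block v j \<le> m v"
  using assms O.out_class(1,2)[of "en j"] en_in[of j] O.m_pos[of v]
  by (auto simp: block_def split: if_splits)

text \<open>The reason why \<open>g\<close> respects sources: in the maximal split the source of a
  copy of an edge e from w carries the number of e, and \<open>block\<close> turns it into the index
  of the class of e.\<close>

lemma block_M_class: "e \<in> arcs E \<Longrightarrow> block (tail E e) (M.out_class e) = O.out_class e"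
  by (simp add: block_def en_M_class O_class_other)

definition g :: "('v \<times> nat, 'e \<times> nat, 'v \<times> nat, 'e \<times> nat) graph_map" where
  "g = (\<lambda>(v, j). (v, block v j), \<lambda>(e, j). (e, block (head E e) j))"

lemma g_simps [simp]: "fst g (v, j) = (v, block v j)" "snd g (e, j) = (e, block (head E e) j)"
  by (simp_all add: g_def)

text \<open>The pullback along \<open>g\<close> is handled through this; that \<open>g\<close> is a
  multi-out-split homomorphism is settled separately in \<open>g_split_hom\<close>.\<close>

lemma g_cover: "graph_cover M.S O.S g"
proof (intro graph_cover.intro graph_algebra.intro graph_cover_axioms.intro M.wf_S O.wf_S)
  show "snd g x \<in> arcs O.S" if "x \<in> arcs M.S" for x
    using that block_in M.tail_head_in by (cases x) (simp add: M.arcs_S O.arcs_S)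
  show "tail O.S (snd g x) = fst g (tail M.S x)" if "x \<in> arcs M.S" for x
    using that by (cases x) (simp add: M.arcs_S M.tail_S O.tail_S block_M_class)
  show "finite {u \<in> verts M.S. fst g u = y}" for y
    by (rule finite_subset[of _ "{fst y} \<times> {1..mM (fst y)}"]) (auto simp: M.verts_S)
  show "bij_betw (head M.S) {x \<in> arcs M.S. snd g x = y} {u \<in> verts M.S. fst g u = head O.S y}"
    if "y \<in> arcs O.S" for y
  proof -
    obtain e i where [simp]: "y = (e, i)" by (cases y)
    show ?thesis
      by (rule bij_betwI[where g = "\<lambda>u. (e, snd u)"])
         (use that M.tail_head_in in \<open>auto simp: M.arcs_S O.arcs_S M.verts_S M.head_S O.head_S\<close>)
  qed
  show "u \<in> regular_verts M.S" if u: "u \<in> verts M.S" and reg: "fst g u \<in> regular_verts O.S" for u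
  proof -
    obtain v j where u_def [simp]: "u = (v, j)" by (cases u)
    have v: "v \<in> verts E" "1 \<le> j" "j \<le> mM v" using u by (simp_all add: M.verts_S)
    then have "(v, block v j) \<in> verts O.S" using block_in by (simp add: O.verts_S)
    then have fin: "finite {e \<in> out_arcs E v. O.out_class e = block v j}" and ne: "out_arcs E v \<noteq> {}"
      using reg by (simp_all only: u_def g_simps O.regular_S simp_thms)
    have "finite {e \<in> out_arcs E v. M.out_class e = j}"
    \<comment> \<open>At w finiteness comes from the regularity of w; elsewhere both splits have the
      single class 1, so the two sets of edges coincide.\<close>
    proof (cases "v = w")
      case True
      then show ?thesis using finite_out_w by (auto intro: finite_subset[of _ "out_arcs E w"])
    next
      case False
      then have "{e \<in> out_arcs E v. M.out_class e = j} = {e \<in> out_arcs E v. O.out_class e = block v j}"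
        using v by (auto simp: M_class_other O_class_other block_def)
      with fin show ?thesis by simp
    qed
    with u ne show ?thesis by (simp only: u_def M.regular_S simp_thms)
  qed
qed

section \<open>Realising g as a multi-out-split of E_O\<close>

definition en_block :: "nat \<Rightarrow> nat \<Rightarrow> 'e" where
  "en_block i = (SOME f. bij_betw f {1..card (\<epsilon> w i)} (\<epsilon> w i))"

text \<open>Position of an edge inside its class at w. The underlying enumeration is arbitrary,
  which is harmless because \<open>g\<close> is identified only up to isomorphism over E_O.\<close>

definition pos :: "'e \<Rightarrow> nat" where
  "pos e = inv_into {1..card (\<epsilon> w (O.out_class e))} (en_block (O.out_class e)) e"

lemma \<epsilon>w: "1 \<le> i \<Longrightarrow> i \<le> m w \<Longrightarrow> \<epsilon> w i = {e \<in> out_arcs E w. O.out_class e = i}"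
  by (rule O.\<epsilon>_eq[OF w_in out_w])

lemma en_block:
  assumes "1 \<le> i" "i \<le> m w" shows "bij_betw (en_block i) {1..card (\<epsilon> w i)} (\<epsilon> w i)"
proof -
  have "finite (\<epsilon> w i)" 
    using finite_out_w unfolding \<epsilon>w[OF assms] by (rule rev_finite_subset) blast
  from someI_ex[OF ex_bij_betw_nat_finite_1[OF this]] show ?thesis unfolding en_block_def .
qed

lemma pos:
  assumes e: "e \<in> out_arcs E w"
  shows "1 \<le> pos e" "pos e \<le> card (\<epsilon> w (O.out_class e))" "en_block (O.out_class e) (pos e) = e"
proof -
  let ?i = "O.out_class e"
  have i: "1 \<le> ?i" "?i \<le> m w" using e O.out_class(1,2)[of e] by auto
  have eq: "en_block ?i ` {1..card (\<epsilon> w ?i)} = \<epsilon> w ?i"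
    by (rule bij_betw_imp_surj_on[OF en_block[OF i]])
  have "e \<in> \<epsilon> w ?i" using e \<epsilon>w[OF i] by simp
  then have "e \<in> en_block ?i ` {1..card (\<epsilon> w ?i)}" by (simp only: eq)
  from inv_into_into[OF this] f_inv_into_f[OF this]
  show "1 \<le> pos e" "pos e \<le> card (\<epsilon> w ?i)" "en_block ?i (pos e) = e" by (simp_all add: pos_def)
qed

lemma pos_en_block:
  assumes "1 \<le> i" "i \<le> m w" "1 \<le> k" "k \<le> card (\<epsilon> w i)"
  shows "en_block i k \<in> out_arcs E w" "O.out_class (en_block i k) = i" "pos (en_block i k) = k"
proof -
  note bij = en_block[OF assms(1,2)]
  have "en_block i k \<in> \<epsilon> w i" using bij_betwE[OF bij] assms by simp
  then show *: "en_block i k \<in> out_arcs E w" "O.out_class (en_block i k) = i"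
    unfolding \<epsilon>w[OF assms(1,2)] by blast+
  show "pos (en_block i k) = k"
    unfolding pos_def * using assms by (intro inv_into_f_f bij_betw_imp_inj_on[OF bij]) simp
qed

definition m2 :: "'v \<times> nat \<Rightarrow> nat" where
  "m2 = (\<lambda>(v, i). if v = w then card (\<epsilon> w i) else 1)"

text \<open>All copies \<open>e\<^sup>j\<close> of an edge \<open>e\<close> emitted by \<open>w\<close> stay in one class, also when \<open>e\<close> is a loop.\<close>

definition \<epsilon>2 :: "'v \<times> nat \<Rightarrow> nat \<Rightarrow> ('e \<times> nat) set" where
  "\<epsilon>2 = (\<lambda>(v, i) k. if v = w then {en_block i k} \<times> {1..m (head E (en_block i k))} else out_arcs O.S (v, i))"

definition sub_pos :: "'v \<Rightarrow> nat \<Rightarrow> nat" where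
  "sub_pos v j = (if v = w then pos (en j) else 1)"

lemma m2_data: "multi_split_data O.S m2 \<epsilon>2"
  unfolding multi_split_data_def
proof
  fix u assume u: "u \<in> verts O.S"
  obtain v i where u_def: "u = (v, i)" by (cases u)
  have v: "v \<in> verts E" "1 \<le> i" "i \<le> m v" using u by (simp_all add: u_def O.verts_S)
  show "if out_arcs O.S u = {} then m2 u = 1
        else 1 \<le> m2 u
           \<and> (\<Union>k\<in>{1..m2 u}. \<epsilon>2 u k) = out_arcs O.S u
           \<and> (\<forall>k\<in>{1..m2 u}. \<epsilon>2 u k \<noteq> {})
           \<and> (\<forall>k\<in>{1..m2 u}. \<forall>l\<in>{1..m2 u}. k \<noteq> l \<longrightarrow> \<epsilon>2 u k \<inter> \<epsilon>2 u l = {})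
           \<and> (\<forall>k\<in>{1..m2 u}. \<forall>l\<in>{1..m2 u}. infinite (\<epsilon>2 u k) \<and> infinite (\<epsilon>2 u l) \<longrightarrow> k = l)"
  proof (cases "v = w")
    case False
    then have "m2 u = 1" "\<epsilon>2 u k = out_arcs O.S u" for k
      by (simp_all add: m2_def \<epsilon>2_def u_def)
    then show ?thesis by simp
  next
    case True
    then have i: "1 \<le> i" "i \<le> m w" using v by simp_all
    have m2: "m2 u = card (\<epsilon> w i)" and \<epsilon>2: "\<epsilon>2 u k = {en_block i k} \<times> {1..m (head E (en_block i k))}" for k
      by (simp_all add: m2_def \<epsilon>2_def u_def True)
    obtain e where "e \<in> out_arcs E w" "O.out_class e = i"
      using O.class_surj[OF w_in out_w i] by blast
    then have "1 \<le> card (\<epsilon> w i)" using pos(1,2)[of e] by simp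
    moreover have "(\<Union>k\<in>{1..card (\<epsilon> w i)}. \<epsilon>2 u k) = out_arcs O.S u"
    proof -
      have "(\<Union>k\<in>{1..card (\<epsilon> w i)}. \<epsilon>2 u k) = (SIGMA e:en_block i ` {1..card (\<epsilon> w i)}. {1..m (head E e)})"
        unfolding \<epsilon>2 by blast
      also have "\<dots> = out_arcs O.S u"
        by (simp only: bij_betw_imp_surj_on[OF en_block[OF i]])
           (simp only: \<epsilon>w[OF i] u_def True O.out_arcs_S)
      finally show ?thesis .
    qed
    moreover have "\<epsilon>2 u k \<noteq> {}" if "k \<in> {1..card (\<epsilon> w i)}" for k
    proof -
      have "1 \<le> m (head E (en_block i k))"
        using pos_en_block(1)[OF i, of k] that by (intro O.m_pos O.tail_head_in) auto
      then show ?thesis by (simp add: \<epsilon>2)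
    qed
    moreover have "\<epsilon>2 u k \<inter> \<epsilon>2 u l = {}" if "k \<in> {1..card (\<epsilon> w i)}" "l \<in> {1..card (\<epsilon> w i)}" "k \<noteq> l" for k l
    proof -
      have "en_block i k \<noteq> en_block i l"
        using bij_betw_imp_inj_on[OF en_block[OF i]] that by (auto dest: inj_onD)
      then show ?thesis by (auto simp: \<epsilon>2)
    qed
    \<comment> \<open>At copies of w all new classes are finite, so the condition on infinite
      classes is vacuous there.\<close>
    moreover have "finite (\<epsilon>2 u k)" for k by (simp add: \<epsilon>2)
    ultimately show ?thesis using m2 by auto
  qed
qed

end

sublocale split_at \<subseteq> N: multi_split O.S m2 \<epsilon>2
  by (intro multi_split.intro O.wf_S m2_data)

context split_at
begin

text \<open>Splitting w into classes, and then each class into single edges, amounts to splitting w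
  into edges at once: the number of an edge corresponds to its class together with its position
  there.\<close>

lemma block_sub_pos_bij:
  assumes v: "v \<in> verts E"
  shows "bij_betw (\<lambda>j. (block v j, sub_pos v j)) {1..mM v} (SIGMA i:{1..m v}. {1..m2 (v, i)})"
proof (cases "v = w")
  case False
  then show ?thesis using m_other[OF v]
    by (simp add: bij_betw_def block_def sub_pos_def m2_def)
next
  case True
  show ?thesis unfolding True
  proof (rule bij_betwI')
    fix i j assume ij: "i \<in> {1..mM w}" "j \<in> {1..mM w}"
    have "i = j" if eq: "block w i = block w j" "sub_pos w i = sub_pos w j"
    proof -
      have "en i = en_block (O.out_class (en i)) (pos (en i))" using pos(3)[OF en_in[of i]] ij by simp
      also have "\<dots> = en_block (O.out_class (en j)) (pos (en j))" using eq by (simp add: block_def sub_pos_def)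
      also have "\<dots> = en j" using pos(3)[OF en_in[of j]] ij by simp
      finally show ?thesis using en_inj[of i j] ij by simp
    qed
    then show "((block w i, sub_pos w i) = (block w j, sub_pos w j)) = (i = j)" by auto
  next
    fix j assume j: "j \<in> {1..mM w}"
    then have e: "en j \<in> out_arcs E w" using en_in by simp
    have "O.out_class (en j) \<in> {1..m w}" using e O.out_class(1,2)[of "en j"] by auto
    then show "(block w j, sub_pos w j) \<in> (SIGMA i:{1..m w}. {1..m2 (w, i)})"
      using pos(1,2)[OF e] by (simp add: block_def sub_pos_def m2_def)
  next
    fix y assume "y \<in> (SIGMA i:{1..m w}. {1..m2 (w, i)})"
    then obtain i k where y: "y = (i, k)" and ik: "1 \<le> i" "i \<le> m w" "1 \<le> k" "k \<le> card (\<epsilon> w i)"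
      by (auto simp: m2_def)
    note e = pos_en_block[OF ik]
    obtain j where "1 \<le> j" "j \<le> n" "en j = en_block i k" using en_surj[OF e(1)] by blast
    with e show "\<exists>j\<in>{1..mM w}. y = (block w j, sub_pos w j)"
      by (intro bexI[of _ j]) (simp_all add: y block_def sub_pos_def)
  qed
qed

lemma g_split_hom: "multi_out_split_hom M.S O.S g"
proof -
  \<comment> \<open>The last two fields are copied from \<open>N.S\<close>, so that
    \<open>app_iso\<close> produces literally that record.\<close>
  define \<sigma> :: "('v \<times> nat, 'e \<times> nat, ('v \<times> nat) \<times> nat, ('e \<times> nat) \<times> nat) digraph_isomorphism" where
    "\<sigma> = \<lparr> iso_verts = (\<lambda>(v, j). ((v, block v j), sub_pos v j)),
           iso_arcs = (\<lambda>(e, j). ((e, block (head E e) j), sub_pos (head E e) j)),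
           iso_head = head N.S, iso_tail = tail N.S \<rparr>"
  have \<sigma> [simp]: "iso_verts \<sigma> (v, j) = ((v, block v j), sub_pos v j)"
    "iso_arcs \<sigma> (e, j) = ((e, block (head E e) j), sub_pos (head E e) j)"
    "iso_head \<sigma> = head N.S" "iso_tail \<sigma> = tail N.S" for v j e
    by (simp_all add: \<sigma>_def)
  note bij = block_sub_pos_bij
  have inj: "i = j" if "v \<in> verts E" "i \<in> {1..mM v}" "j \<in> {1..mM v}"
      "block v i = block v j" "sub_pos v i = sub_pos v j" for v i j
    using bij_betw_imp_inj_on[OF bij[OF that(1)]] that(2-5) by (auto dest!: inj_onD)
  have surj: "\<exists>j\<in>{1..mM v}. block v j = i \<and> sub_pos v j = k"
    if "v \<in> verts E" "1 \<le> i" "i \<le> m v" "1 \<le> k" "k \<le> m2 (v, i)" for v i k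
  proof -
    have "(i, k) \<in> (\<lambda>j. (block v j, sub_pos v j)) ` {1..mM v}"
      unfolding bij_betw_imp_surj_on[OF bij[OF that(1)]] using that by simp
    then show ?thesis by auto
  qed
  have sub_pos_in: "1 \<le> sub_pos v j" "sub_pos v j \<le> m2 (v, block v j)"
    if "v \<in> verts E" "1 \<le> j" "j \<le> mM v" for v j
    using bij_betwE[OF bij[OF that(1)]] that by auto
  have tail_eq: "iso_verts \<sigma> (tail M.S x) = tail N.S (iso_arcs \<sigma> x)" if x: "x \<in> arcs M.S" for x
  proof -
    obtain e j where x_def: "x = (e, j)" by (cases x)
    have e: "e \<in> arcs E" "1 \<le> j" "j \<le> mM (head E e)" using x by (simp_all add: x_def M.arcs_S)
    let ?v = "tail E e" and ?i = "block (head E e) j"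
    have v: "?v \<in> verts E" and M: "1 \<le> M.out_class e" "M.out_class e \<le> mM ?v"
      using e M.tail_head_in M.out_class by auto
    have a: "(e, ?i) \<in> arcs O.S" using e block_in[OF M.tail_head_in(2)[OF e(1)]] by (simp add: O.arcs_S)
    \<comment> \<open>The class of a copy of \<open>e\<close> in the second split depends on
      \<open>e\<close> alone, not on the copy; this makes \<open>\<sigma>\<close> compatible with
      sources.\<close>
    have "N.out_class (e, ?i) = sub_pos ?v (M.out_class e)"
    proof (rule N.out_classI[OF a])
      show "1 \<le> sub_pos ?v (M.out_class e)" by (rule sub_pos_in[OF v M])
      show "sub_pos ?v (M.out_class e) \<le> m2 (tail O.S (e, ?i))"
        using sub_pos_in(2)[OF v M] by (simp add: O.tail_S block_M_class[OF e(1)])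
      show "(e, ?i) \<in> \<epsilon>2 (tail O.S (e, ?i)) (sub_pos ?v (M.out_class e))"
      proof (cases "?v = w")
        case True
        then have "e \<in> out_arcs E w" using e by simp
        with True a show ?thesis
          by (simp add: \<epsilon>2_def O.tail_S sub_pos_def en_M_class pos(3) O.arcs_S)
      next
        case False
        with a show ?thesis by (simp add: \<epsilon>2_def O.tail_S)
      qed
    qed
    then show ?thesis
      using e by (simp add: x_def M.tail_S N.tail_S O.tail_S block_M_class)
  qed
  have head_eq: "iso_verts \<sigma> (head M.S x) = head N.S (iso_arcs \<sigma> x)" for x
    by (cases x) (simp add: M.head_S N.head_S O.head_S)
  have "pre_digraph.digraph_isomorphism M.S \<sigma>"
    unfolding pre_digraph.digraph_isomorphism_def
  proof (intro conjI ballI M.wf_S inj_onI)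
    show "x = y" if "x \<in> verts M.S" "y \<in> verts M.S" "iso_verts \<sigma> x = iso_verts \<sigma> y" for x y
    proof -
      obtain v i v' j where xy: "x = (v, i)" "y = (v', j)" by (metis surj_pair)
      have "v' = v" using that(3) by (simp add: xy)
      moreover have "i = j"
        by (rule inj[of v]) (use that calculation in \<open>simp_all add: xy M.verts_S\<close>)
      ultimately show ?thesis by (simp add: xy)
    qed
    show "x = y" if "x \<in> arcs M.S" "y \<in> arcs M.S" "iso_arcs \<sigma> x = iso_arcs \<sigma> y" for x y
    proof -
      obtain e i e' j where xy: "x = (e, i)" "y = (e', j)" by (metis surj_pair)
      have "e' = e" using that(3) by (simp add: xy)
      moreover have "i = j"
        by (rule inj[of "head E e"])
           (use that calculation in \<open>simp_all add: xy M.arcs_S M.tail_head_in\<close>)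
      ultimately show ?thesis by (simp add: xy)
    qed
  qed (simp_all add: tail_eq head_eq del: \<sigma>(1,2))
  moreover have "app_iso \<sigma> M.S = N.S"
  proof -
    have "iso_verts \<sigma> ` verts M.S = verts N.S"
    proof (intro equalityI subsetI)
      fix y assume "y \<in> iso_verts \<sigma> ` verts M.S"
      then show "y \<in> verts N.S"
        using block_in sub_pos_in by (auto simp: M.verts_S N.verts_S O.verts_S)
    next
      fix y assume y: "y \<in> verts N.S"
      obtain v i k where y_def: "y = ((v, i), k)" by (metis surj_pair)
      obtain j where "j \<in> {1..mM v}" "block v j = i" "sub_pos v j = k"
        using surj[of v i k] y by (auto simp: y_def N.verts_S O.verts_S)
      with y show "y \<in> iso_verts \<sigma> ` verts M.S"
        by (intro image_eqI[of _ _ "(v, j)"]) (simp_all add: y_def N.verts_S O.verts_S M.verts_S)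
    qed
    moreover have "iso_arcs \<sigma> ` arcs M.S = arcs N.S"
    proof (intro equalityI subsetI)
      fix y assume "y \<in> iso_arcs \<sigma> ` arcs M.S"
      then show "y \<in> arcs N.S"
        using block_in[OF M.tail_head_in(2)] sub_pos_in[OF M.tail_head_in(2)]
        by (auto simp: M.arcs_S N.arcs_S O.arcs_S O.head_S)
    next
      fix y assume y: "y \<in> arcs N.S"
      obtain e i k where y_def: "y = ((e, i), k)" by (metis surj_pair)
      obtain j where "j \<in> {1..mM (head E e)}" "block (head E e) j = i" "sub_pos (head E e) j = k"
        using surj[OF M.tail_head_in(2), of e i k] y by (auto simp: y_def N.arcs_S O.arcs_S O.head_S)
      with y show "y \<in> iso_arcs \<sigma> ` arcs M.S"
        by (intro image_eqI[of _ _ "(e, j)"]) (simp_all add: y_def N.arcs_S O.arcs_S M.arcs_S)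
    qed
    ultimately show ?thesis
      by (intro pre_digraph.equality) (simp_all add: app_iso_def)
  qed
  ultimately have "isomorphic_over M.S g N.S split_proj"
    unfolding isomorphic_over_def
    by (intro exI[of _ \<sigma>]) (auto simp: split_proj_def)
  then show ?thesis unfolding multi_out_split_hom_def using m2_data by blast
qed

end


section \<open>The pushforward and the two compositions\<close>

sublocale split_at \<subseteq> GE: graph_algebra E
  by (rule graph_algebra.intro) (rule wf)

sublocale split_at \<subseteq> GO: graph_algebra O.S
  by (rule graph_algebra.intro) (rule O.wf_S)

sublocale split_at \<subseteq> GM: graph_algebra M.S
  by (rule graph_algebra.intro) (rule M.wf_S)

sublocale split_at \<subseteq> F: graph_cover O.S E split_proj
  by (rule O.split_proj_cover)

sublocale split_at \<subseteq> C: graph_cover M.S O.S g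
  by (rule g_cover)

sublocale split_at \<subseteq> ME: graph_algebra_pair M.S E ..

section \<open>Images of the generators under the pushforward\<close>

context split_at
begin

text \<open>A representative of the image of S_u under \<phi>_*: since \<phi> sends the idempotent
  of w^j to the pair (e_j, e_j), a copy of w goes to a range projection.\<close>

definition P :: "'v \<times> nat \<Rightarrow> ('v, 'e) free_alg" where
  "P = (\<lambda>(v, j). if v = w then gen_arc (en j) * free_star (gen_arc (en j)) else gen_vert v)"

text \<open>For a target w^j this is S_e S_{e_j} S_{e_j}^*, the element of the pair (e e_j, e_j);
  for other targets it is S_e modulo the relations.\<close>

definition T :: "('v \<times> nat, 'e \<times> nat) gen \<Rightarrow> ('v, 'e) free_alg" where
  "T x = (case x of Vert u \<Rightarrow> P u | Arc (e, j) \<Rightarrow> gen_arc e * P (head E e, j))"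

lemma P_simps: "P (w, j) = gen_arc (en j) * free_star (gen_arc (en j))" "v \<noteq> w \<Longrightarrow> P (v, j) = gen_vert v"
  by (simp_all add: P_def)

lemma T_simps: "T (Vert u) = P u" "T (Arc (e, j)) = gen_arc e * P (head E e, j)"
  by (simp_all add: T_def)

lemma en_arc: "(w, j) \<in> verts M.S \<Longrightarrow> en j \<in> arcs E" "(w, j) \<in> verts M.S \<Longrightarrow> tail E (en j) = w"
  using en_in[of j] by (auto simp: M.verts_S)

lemma P_in: "u \<in> verts M.S \<Longrightarrow> P u \<in> free_carrier E"
  by (cases u; cases "fst u = w") (auto simp: P_simps en_arc M.verts_S intro!: gens_closed dest: en_in)

lemma P_star:
  assumes "u \<in> verts M.S" shows "GE.eqv (free_star (P u)) (P u)"
proof (cases "fst u = w")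
  case True
  then have "free_star (P u) = P u" by (cases u) (simp add: P_simps free.st_mult free.st_st)
  then show ?thesis using P_in[OF assms] by (simp add: GE.eqv_refl)
next
  case False
  then show ?thesis using assms by (cases u) (simp add: P_simps M.verts_S GE.vert_star)
qed

lemma vert_P:
  assumes "(v, j) \<in> verts M.S" shows "GE.eqv (gen_vert v * P (v, j)) (P (v, j))"
proof (cases "v = w")
  case True
  note e = en_arc[OF assms[unfolded True]]
  have "gen_vert w * P (w, j) = (gen_vert (tail E (en j)) * gen_arc (en j)) * free_star (gen_arc (en j))"
    by (simp add: P_simps e mult.assoc)
  also have "GE.eqv \<dots> (P (w, j))"
    unfolding P_simps using e by (intro GE.eqv_mult_right GE.tail_arc gens_closed)
  finally show ?thesis by (simp add: True)
next
  case False
  with assms show ?thesis by (simp add: P_simps M.verts_S GE.vert_idem)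
qed

lemma P_vert:
  assumes u: "(v, j) \<in> verts M.S" shows "GE.eqv (P (v, j) * gen_vert v) (P (v, j))"
proof -
  have v: "v \<in> verts E" using u by (simp add: M.verts_S)
  have "GE.eqv (P (v, j) * gen_vert v) (free_star (P (v, j)) * free_star (gen_vert v))"
    by (intro GE.eqv_mult GE.eqv_sym[OF P_star] GE.eqv_sym[OF GE.vert_star] u v)
  also have "\<dots> = free_star (gen_vert v * P (v, j))" by (simp add: free.st_mult)
  also have "GE.eqv \<dots> (free_star (P (v, j)))" by (intro GE.eqv_st vert_P u)
  also have "GE.eqv \<dots> (P (v, j))" by (intro P_star u)
  finally show ?thesis .
qed

text \<open>Different vertices are separated by their projections S_v. Two copies of one vertex can
  exist only at w, where distinct edges have orthogonal ranges.\<close>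

lemma P_orth:
  assumes u: "(v, i) \<in> verts M.S" and u': "(v', j) \<in> verts M.S" and ne: "(v, i) \<noteq> (v', j)"
  shows "GE.eqv (P (v, i) * P (v', j)) 0"
proof (cases "v = v'")
  case False
  have v: "v \<in> verts E" "v' \<in> verts E" using u u' by (simp_all add: M.verts_S)
  have "GE.eqv (P (v, i) * P (v', j)) ((P (v, i) * gen_vert v) * (gen_vert v' * P (v', j)))"
    by (intro GE.eqv_mult GE.eqv_sym[OF P_vert] GE.eqv_sym[OF vert_P] u u')
  also have "\<dots> = P (v, i) * (gen_vert v * gen_vert v') * P (v', j)" by (simp add: mult.assoc)
  also have "GE.eqv \<dots> (P (v, i) * 0 * P (v', j))"
    by (intro GE.eqv_mult_left GE.eqv_mult_right GE.vert_orth P_in u u' v False)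
  finally show ?thesis by simp
next
  case True
  have [simp]: "v = w"
  proof (rule ccontr)
    assume "v \<noteq> w"
    with u u' ne True show False by (simp add: M.verts_S)
  qed
  have [simp]: "v' = w" using True by simp
  have "i \<noteq> j" using ne by simp
  then have "en i \<noteq> en j" using u u' en_inj by (auto simp: M.verts_S)
  note e = en_arc(1)[OF u[simplified]] en_arc(1)[OF u'[simplified]]
  have "P (v, i) * P (v', j)
      = gen_arc (en i) * (free_star (gen_arc (en i)) * gen_arc (en j)) * free_star (gen_arc (en j))"
    by (simp add: P_simps mult.assoc)
  also have "GE.eqv \<dots> (gen_arc (en i) * 0 * free_star (gen_arc (en j)))"
    by (intro GE.eqv_mult_right GE.eqv_mult_left GE.arc_orth gens_closed e \<open>en i \<noteq> en j\<close>)
  finally show ?thesis by simp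
qed

lemma P_idem:
  assumes u: "(v, i) \<in> verts M.S" shows "GE.eqv (P (v, i) * P (v, i)) (P (v, i))"
proof (cases "v = w")
  case False
  with u show ?thesis by (simp add: P_simps M.verts_S GE.vert_idem)
next
  case True
  note e = en_arc(1)[OF u[unfolded True]]
  let ?e = "gen_arc (en i) :: ('v, 'e) free_alg"
  have "P (w, i) * P (w, i) = ?e * (free_star ?e * ?e) * free_star ?e"
    by (simp add: P_simps mult.assoc)
  also have "GE.eqv \<dots> (?e * gen_vert (head E (en i)) * free_star ?e)"
    by (intro GE.eqv_mult_right GE.eqv_mult_left GE.arc_isometry gens_closed e)
  also have "GE.eqv \<dots> (?e * free_star ?e)"
    by (intro GE.eqv_mult_right GE.arc_head gens_closed e)
  finally show ?thesis by (simp add: True P_simps)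
qed

text \<open>At w this is the summation relation of the regular vertex w, reindexed by
  \<open>en\<close>; elsewhere there is one copy.\<close>

lemma P_sum:
  assumes v: "v \<in> verts E" shows "GE.eqv (\<Sum>j\<in>{1..mM v}. P (v, j)) (gen_vert v)"
proof (cases "v = w")
  case False
  then show ?thesis using v by (simp add: P_simps GE.eqv_refl gens_closed)
next
  case True
  have "(\<Sum>j\<in>{1..mM v}. P (v, j)) = (\<Sum>e\<in>out_arcs E w. gen_arc e * free_star (gen_arc e))"
    using sum.reindex_bij_betw[OF en, of "\<lambda>e. gen_arc e * free_star (gen_arc e)"]
    by (simp add: True P_simps)
  then show ?thesis using GE.eqv_sym[OF GE.vert_sum[OF w]] True by simp
qed

text \<open>If e starts at w, its class index in the maximal split is its own number, so the
  projection is S_e S_e^* and fixes S_e.\<close>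

lemma tail_P:
  assumes e: "e \<in> arcs E"
  shows "GE.eqv (P (tail E e, M.out_class e) * gen_arc e) (gen_arc e)"
proof (cases "tail E e = w")
  case False
  then show ?thesis using e by (simp add: P_simps GE.tail_arc)
next
  case True
  then have "P (tail E e, M.out_class e) * gen_arc e = gen_arc e * (free_star (gen_arc e) * gen_arc e)"
    using e by (simp add: P_simps en_M_class mult.assoc)
  also have "GE.eqv \<dots> (gen_arc e * gen_vert (head E e))"
    by (intro GE.eqv_mult_left GE.arc_isometry gens_closed e)
  also have "GE.eqv \<dots> (gen_arc e)" by (rule GE.arc_head[OF e])
  finally show ?thesis .
qed

lemma M_arcD:
  assumes "(e, j) \<in> arcs M.S"
  shows "e \<in> arcs E" "(head E e, j) \<in> verts M.S"
  using assms M.tail_head_in by (auto simp: M.arcs_S M.verts_S)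

lemma T_in: "u \<in> verts M.S \<Longrightarrow> T (Vert u) \<in> free_carrier E" "x \<in> arcs M.S \<Longrightarrow> T (Arc x) \<in> free_carrier E"
  by (simp_all add: T_simps P_in) (cases x; auto simp: T_simps dest: M_arcD intro!: gens_closed P_in)

text \<open>Serves both relations on edges: equal copies leave an idempotent, distinct copies of one
  edge a product killed by \<open>P_orth\<close>.\<close>

lemma arc_star_T:
  assumes "(e, i) \<in> arcs M.S" "(e', j) \<in> arcs M.S"
  shows "GE.eqv (free_star (T (Arc (e, i))) * T (Arc (e', j)))
    (if e = e' then P (head E e, i) * P (head E e, j) else 0)"
proof -
  note d = M_arcD[OF assms(1)] M_arcD[OF assms(2)]
  let ?P = "P (head E e, i)" and ?Q = "P (head E e', j)"
  have eq: "free_star (T (Arc (e, i))) * T (Arc (e', j))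
      = free_star ?P * (free_star (gen_arc e) * gen_arc e') * ?Q"
    by (simp add: T_simps free.st_mult mult.assoc)
  show ?thesis
  proof (cases "e = e'")
    case False
    have "GE.eqv (free_star ?P * (free_star (gen_arc e) * gen_arc e') * ?Q) (free_star ?P * 0 * ?Q)"
      by (intro GE.eqv_mult_right GE.eqv_mult_left GE.arc_orth gens_closed P_in d False)
    with False show ?thesis by (simp add: eq)
  next
    case True
    have "GE.eqv (free_star ?P * (free_star (gen_arc e) * gen_arc e') * ?Q) (?P * gen_vert (head E e) * ?Q)"
      unfolding True[symmetric]
      by (intro GE.eqv_mult P_star GE.arc_isometry d GE.eqv_refl P_in d(2)[unfolded True] d(4)[folded True])
    also have "GE.eqv \<dots> (?P * ?Q)"
      by (intro GE.eqv_mult_right P_vert P_in d)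
    finally show ?thesis unfolding eq using True by simp
  qed
qed

text \<open>Summed over the copies of the target, the projections give S_t by \<open>P_sum\<close>.
  This feeds the summation relation at the vertices of the maximal split.\<close>

lemma sum_T_star:
  assumes e: "e \<in> arcs E"
  shows "GE.eqv (\<Sum>j\<in>{1..mM (head E e)}. T (Arc (e, j)) * free_star (T (Arc (e, j))))
    (gen_arc e * free_star (gen_arc e))"
proof -
  let ?h = "head E e" and ?e = "gen_arc e :: ('v, 'e) free_alg"
  have h: "?h \<in> verts E" using e by (rule M.tail_head_in)
  have "GE.eqv (\<Sum>j\<in>{1..mM ?h}. T (Arc (e, j)) * free_star (T (Arc (e, j))))
      (\<Sum>j\<in>{1..mM ?h}. ?e * P (?h, j) * free_star ?e)"
  proof (rule GE.eqv_sum)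
    fix j assume "j \<in> {1..mM ?h}"
    then have u: "(?h, j) \<in> verts M.S" using h by (simp add: M.verts_S)
    have "T (Arc (e, j)) * free_star (T (Arc (e, j))) = ?e * (P (?h, j) * free_star (P (?h, j))) * free_star ?e"
      by (simp add: T_simps free.st_mult mult.assoc)
    also have "GE.eqv \<dots> (?e * (P (?h, j) * P (?h, j)) * free_star ?e)"
      by (intro GE.eqv_mult_right GE.eqv_mult_left P_star gens_closed P_in u e)
    also have "GE.eqv \<dots> (?e * P (?h, j) * free_star ?e)"
      by (intro GE.eqv_mult_right GE.eqv_mult_left P_idem gens_closed u e)
    finally show "GE.eqv (T (Arc (e, j)) * free_star (T (Arc (e, j)))) (?e * P (?h, j) * free_star ?e)" .
  qed
  also have "(\<Sum>j\<in>{1..mM ?h}. ?e * P (?h, j) * free_star ?e) = ?e * (\<Sum>j\<in>{1..mM ?h}. P (?h, j)) * free_star ?e"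
    by (simp add: sum_distrib_left sum_distrib_right)
  also have "GE.eqv \<dots> (?e * gen_vert ?h * free_star ?e)"
    by (intro GE.eqv_mult_right GE.eqv_mult_left P_sum gens_closed h e)
  also have "GE.eqv \<dots> (?e * free_star ?e)"
    by (intro GE.eqv_mult_right GE.arc_head gens_closed e)
  finally show ?thesis .
qed

lemma sum_T:
  assumes e: "e \<in> arcs E"
  shows "GE.eqv (\<Sum>j\<in>{1..mM (head E e)}. T (Arc (e, j))) (gen_arc e)"
proof -
  have h: "head E e \<in> verts E" using e by (rule M.tail_head_in)
  have "(\<Sum>j\<in>{1..mM (head E e)}. T (Arc (e, j))) = gen_arc e * (\<Sum>j\<in>{1..mM (head E e)}. P (head E e, j))"
    by (simp add: T_simps sum_distrib_left)
  also have "GE.eqv \<dots> (gen_arc e * gen_vert (head E e))"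
    by (intro GE.eqv_mult_left P_sum gens_closed h e)
  also have "GE.eqv \<dots> (gen_arc e)" by (rule GE.arc_head[OF e])
  finally show ?thesis .
qed

lemma T_relations:
  assumes "r \<in> graph_relations M.S" shows "GE.eqv (free_hom T r) 0"
  using _ _ _ _ _ _ _ assms
proof (rule ME.relations_preservedI)
  fix u assume u: "u \<in> verts M.S"
  show "GE.eqv (free_star (T (Vert u))) (T (Vert u))" using P_star[OF u] by (simp add: T_simps)
  show "GE.eqv (T (Vert u) * T (Vert u)) (T (Vert u))" using u by (cases u) (simp add: T_simps P_idem)
next
  fix u u' assume "u \<in> verts M.S" "u' \<in> verts M.S" "u \<noteq> u'"
  then show "GE.eqv (T (Vert u) * T (Vert u')) 0"
    by (cases u; cases u') (simp add: T_simps P_orth)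
next
  fix x assume x: "x \<in> arcs M.S"
  obtain e j where x_def: "x = (e, j)" by (cases x)
  note d = M_arcD[OF x[unfolded x_def]]
  have "GE.eqv (free_star (T (Arc x)) * T (Arc x)) (P (head E e, j) * P (head E e, j))"
    using arc_star_T[of e j e j] x by (simp add: x_def)
  also have "GE.eqv \<dots> (P (head E e, j))" by (rule P_idem[OF d(2)])
  finally show "GE.eqv (free_star (T (Arc x)) * T (Arc x)) (T (Vert (head M.S x)))"
    by (simp add: x_def T_simps M.head_S)
  have "T (Vert (tail M.S x)) * T (Arc x) = P (tail E e, M.out_class e) * gen_arc e * P (head E e, j)"
    by (simp add: x_def T_simps M.tail_S mult.assoc)
  also have "GE.eqv \<dots> (gen_arc e * P (head E e, j))"
    by (intro GE.eqv_mult_right tail_P P_in d)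
  finally show "GE.eqv (T (Vert (tail M.S x)) * T (Arc x)) (T (Arc x))"
    by (simp add: x_def T_simps)
next
  fix x x' assume x: "x \<in> arcs M.S" "x' \<in> arcs M.S" "x \<noteq> x'"
  obtain e i e' j where x_def: "x = (e, i)" "x' = (e', j)" by (cases x, cases x')
  note * = arc_star_T[OF x(1,2)[unfolded x_def]]
  show "GE.eqv (free_star (T (Arc x)) * T (Arc x')) 0"
  proof (cases "e = e'")
    case False
    with * show ?thesis by (simp add: x_def)
  next
    case True
    have "GE.eqv (P (head E e, i) * P (head E e, j)) 0"
      using M_arcD(2)[OF x(1)[unfolded x_def]] M_arcD(2)[OF x(2)[unfolded x_def]] x(3)
      by (intro P_orth) (auto simp: x_def True)
    with * show ?thesis using GE.eqv_trans by (simp add: x_def True)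
  qed
next
  fix u assume u: "u \<in> regular_verts M.S"
  obtain v i where u_def: "u = (v, i)" by (cases u)
  have uM: "(v, i) \<in> verts M.S" using u by (simp add: u_def regular_verts_def)
  let ?B = "{e \<in> out_arcs E v. M.out_class e = i}"
  have B: "finite ?B" "out_arcs E v \<noteq> {}" using u uM M.regular_S[OF uM] by (simp_all only: u_def simp_thms)
  \<comment> \<open>Emitted edges are grouped by underlying edge, so that \<open>sum_T_star\<close>
    applies to each group.\<close>
  have "(\<Sum>x\<in>out_arcs M.S u. T (Arc x) * free_star (T (Arc x)))
      = (\<Sum>e\<in>?B. \<Sum>j\<in>{1..mM (head E e)}. T (Arc (e, j)) * free_star (T (Arc (e, j))))"
    unfolding u_def M.out_arcs_S using B(1) by (subst sum.Sigma) (auto simp: case_prod_beta)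
  also have "GE.eqv \<dots> (\<Sum>e\<in>?B. gen_arc e * free_star (gen_arc e))"
    by (intro GE.eqv_sum sum_T_star) simp
  also have "GE.eqv \<dots> (P (v, i))"
  \<comment> \<open>At a copy of w the class is the single edge \<open>en i\<close>, and the sum is
    P by definition; elsewhere the class is all that v emits, and v is regular in E.\<close>
  proof (cases "v = w")
    case True
    then have "i \<in> {1..n}" using uM by (simp add: M.verts_S)
    then have i: "en i \<in> out_arcs E w" "M.out_class (en i) = i"
      using en_in M_class_en by simp_all
    have "?B = {en i}"
    proof (intro equalityI subsetI)
      fix e assume "e \<in> ?B"
      then show "e \<in> {en i}" using en_M_class[of e] True by simp
    qed (use i True in simp)
    then have "(\<Sum>e\<in>?B. gen_arc e * free_star (gen_arc e)) = P (v, i)" by (simp add: P_simps True)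
    then show ?thesis using P_in[OF uM] by (simp add: GE.eqv_refl)
  next
    case False
    then have eq: "?B = out_arcs E v" using uM by (auto simp: M.verts_S M_class_other)
    then have "v \<in> regular_verts E" using B uM by (simp add: regular_verts_def M.verts_S)
    from GE.eqv_sym[OF GE.vert_sum[OF this]] show ?thesis unfolding eq by (simp add: P_simps False)
  qed
  finally show "GE.eqv (T (Vert u)) (\<Sum>x\<in>out_arcs M.S u. T (Arc x) * free_star (T (Arc x)))"
    unfolding T_simps u_def by (rule GE.eqv_sym)
qed

lemma pushforward:
  assumes \<phi>_w: "\<And>i. 1 \<le> i \<Longrightarrow> i \<le> n \<Longrightarrow>
           \<phi> (Some (vert_path (w, i), vert_path (w, i))) = Some (arc_path E (en i), arc_path E (en i))"
    and \<phi>_vert: "\<And>v. v \<in> verts E \<Longrightarrow> v \<noteq> w \<Longrightarrow>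
           \<phi> (Some (vert_path (v, 1), vert_path (v, 1))) = Some (vert_path v, vert_path v)"
    and \<phi>_arc: "\<And>e. e \<in> arcs E \<Longrightarrow> head E e \<noteq> w \<Longrightarrow>
           \<phi> (Some (arc_path M.S (e, 1), vert_path (head M.S (e, 1))))
             = Some (arc_path E e, vert_path (head E e))"
    and \<phi>_arc_w: "\<And>e i. e \<in> arcs E \<Longrightarrow> head E e = w \<Longrightarrow> 1 \<le> i \<Longrightarrow> i \<le> n \<Longrightarrow>
           \<phi> (Some (arc_path M.S (e, i), vert_path (w, i)))
             = Some ((tail E e, [e, en i]), arc_path E (en i))"
  shows "star_hom (graph_cstar M.S) (graph_cstar E) (cstar_pushforward M.S E \<phi>)"
    and "x \<in> free_carrier M.S \<Longrightarrow>
      cstar_pushforward M.S E \<phi> (GM.const_cls x) = GE.const_cls (free_hom T x)"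
proof -
  have tv: "S_gis E (\<phi> (Some (vert_path u, vert_path u))) = GE.const_cls (T (Vert u))"
    if u: "u \<in> verts M.S" for u
  proof -
    obtain v i where u_def: "u = (v, i)" by (cases u)
    show ?thesis
    proof (cases "v = w")
      case True
      with u en_arc(1)[of i] show ?thesis
        by (simp add: u_def M.verts_S \<phi>_w T_simps P_simps arc_path_def GE.S_arc_cls GE.const_cls_ops
            gens_closed)
    next
      case False
      with u have v: "v \<in> verts E" and i: "i = 1" by (simp_all add: u_def M.verts_S)
      have "S_gis E (\<phi> (Some (vert_path u, vert_path u)))
          = GE.const_cls (gen_vert v * free_star (gen_vert v))"
        using v unfolding u_def i \<phi>_vert[OF v False]
        by (simp add: vert_path_def GE.S_vert_cls GE.const_cls_ops gens_closed)
      \<comment> \<open>\<open>S_gis\<close> yields S_v S_v^*, which agrees with S_v only modulo the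
        relations.\<close>
      also have "\<dots> = GE.const_cls (gen_vert v)"
      proof (rule GE.eqv_cls)
        have "GE.eqv (gen_vert v * free_star (gen_vert v)) (gen_vert v * gen_vert v)"
          by (intro GE.eqv_mult_left GE.vert_star gens_closed v)
        also have "GE.eqv \<dots> (gen_vert v)" by (rule GE.vert_idem[OF v])
        finally show "GE.eqv (gen_vert v * free_star (gen_vert v)) (gen_vert v)" .
      qed
      finally show ?thesis by (simp add: T_simps P_simps False u_def)
    qed
  qed
  have te: "S_gis E (\<phi> (Some (arc_path M.S x, vert_path (head M.S x)))) = GE.const_cls (T (Arc x))"
    if x: "x \<in> arcs M.S" for x
  proof -
    obtain e i where x_def: "x = (e, i)" by (cases x)
    note d = M_arcD[OF x[unfolded x_def]]
    show ?thesis
    proof (cases "head E e = w")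
      case True
      note ei = en_arc[OF d(2)[unfolded True]]
      have i: "1 \<le> i" "i \<le> n" using d(2) by (simp_all add: True M.verts_S)
      have "S_gis E (\<phi> (Some (arc_path M.S x, vert_path (head M.S x))))
          = S_gis E (Some ((tail E e, [e, en i]), arc_path E (en i)))"
        using \<phi>_arc_w[OF d(1) True i] by (simp add: x_def M.head_S True)
      also have "\<dots> = GE.const_cls (gen_arc e * gen_arc (en i) * free_star (gen_arc (en i)))"
        using d(1) ei by (simp add: arc_path_def GE.S_arc_cls GE.const_cls_ops gens_closed)
      finally show ?thesis by (simp add: x_def T_simps P_simps True mult.assoc)
    next
      case False
      have i: "i = 1" using d(2) False by (simp add: M.verts_S)
      have h: "head E e \<in> verts E" using d(1) by simp
      have "S_gis E (\<phi> (Some (arc_path M.S x, vert_path (head M.S x))))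
          = GE.const_cls (gen_arc e * free_star (gen_vert (head E e)))"
        using d(1) h unfolding x_def i \<phi>_arc[OF d(1) False]
        by (simp add: arc_path_def vert_path_def GE.S_arc_cls GE.S_vert_cls GE.const_cls_ops gens_closed)
      also have "\<dots> = GE.const_cls (gen_arc e * gen_vert (head E e))"
        by (intro GE.eqv_cls GE.eqv_mult_left GE.vert_star h gens_closed d)
      finally show ?thesis by (simp add: x_def T_simps P_simps False)
    qed
  qed
  note hom = ME.cstar_hom_of_free_hom[of T, OF T_in T_relations tv te]
  show "star_hom (graph_cstar M.S) (graph_cstar E) (cstar_pushforward M.S E \<phi>)"
    unfolding cstar_pushforward_def by (rule hom(1))
  show "cstar_pushforward M.S E \<phi> (GM.const_cls x) = GE.const_cls (free_hom T x)"
    if "x \<in> free_carrier M.S"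
    unfolding cstar_pushforward_def by (rule hom(4)) (assumption | rule that)+
qed

section \<open>The two compositions on generators\<close>

lemma section_vert:
  assumes v: "v \<in> verts E"
  shows "GE.eqv (free_hom T (free_hom C.T (F.T (Vert v)))) (gen_vert v)"
proof -
  have "free_hom T (free_hom C.T (F.T (Vert v))) = (\<Sum>u\<in>F.V v. \<Sum>z\<in>C.V u. P z)"
    by (simp add: F.T_simps C.T_simps T_simps free_hom_sum free_hom_gen)
  also have "\<dots> = (\<Sum>z\<in>(\<Union>u\<in>F.V v. C.V u). P z)"
    using F.finite_V[OF v] C.finite_V by (intro sum.UNION_disjoint[symmetric]) auto
  \<comment> \<open>The fibres of g over the fibre of f are disjoint and make up all copies of v in
    the maximal split, so the double sum becomes that of \<open>P_sum\<close>.\<close>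
  also have "(\<Union>u\<in>F.V v. C.V u) = Pair v ` {1..mM v}"
    using v block_in by (auto simp: split_proj_def M.verts_S O.verts_S image_iff)
  also have "(\<Sum>z\<in>Pair v ` {1..mM v}. P z) = (\<Sum>j\<in>{1..mM v}. P (v, j))"
    by (subst sum.reindex) (auto simp: inj_on_def)
  also have "GE.eqv \<dots> (gen_vert v)" by (rule P_sum[OF v])
  finally show ?thesis .
qed

lemma section_arc:
  assumes e: "e \<in> arcs E"
  shows "GE.eqv (free_hom T (free_hom C.T (F.T (Arc e)))) (gen_arc e)"
proof -
  have h: "head E e \<in> verts E" using e by simp
  have "free_hom T (free_hom C.T (F.T (Arc e))) = (\<Sum>x\<in>F.A e. \<Sum>y\<in>C.A x. T (Arc y))"
    by (simp add: F.T_simps C.T_simps free_hom_sum free_hom_gen)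
  also have "\<dots> = (\<Sum>y\<in>(\<Union>x\<in>F.A e. C.A x). T (Arc y))"
    using F.finite_A[OF e] C.finite_A by (intro sum.UNION_disjoint[symmetric]) auto
  also have "(\<Union>x\<in>F.A e. C.A x) = Pair e ` {1..mM (head E e)}"
    using e block_in[OF h] by (auto simp: split_proj_def M.arcs_S O.arcs_S image_iff)
  also have "(\<Sum>y\<in>Pair e ` {1..mM (head E e)}. T (Arc y)) = (\<Sum>j\<in>{1..mM (head E e)}. T (Arc (e, j)))"
    by (subst sum.reindex) (auto simp: inj_on_def)
  also have "GE.eqv \<dots> (gen_arc e)" by (rule sum_T[OF e])
  finally show ?thesis .
qed

lemma en_bij_class:
  "bij_betw en {j \<in> {1..n}. O.out_class (en j) = i} {e \<in> out_arcs E w. O.out_class e = i}"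
proof (rule bij_betwI')
  fix j k assume "j \<in> {j \<in> {1..n}. O.out_class (en j) = i}" "k \<in> {j \<in> {1..n}. O.out_class (en j) = i}"
  then show "en j = en k \<longleftrightarrow> j = k" using en_inj[of j k] by auto
next
  fix j assume "j \<in> {j \<in> {1..n}. O.out_class (en j) = i}"
  then show "en j \<in> {e \<in> out_arcs E w. O.out_class e = i}" using en_in[of j] by simp
next
  fix e assume e: "e \<in> {e \<in> out_arcs E w. O.out_class e = i}"
  then obtain j where "1 \<le> j" "j \<le> n" "en j = e" using en_surj[of e] by blast
  with e show "\<exists>j\<in>{j \<in> {1..n}. O.out_class (en j) = i}. e = en j" by auto
qed

text \<open>At a copy of w the fibre of g is indexed by the edges of one class, and f^* turns each
  S_e S_e^* into the sum over the copies of e. Together these are all edges emitted by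
  \<open>u\<close> in E_O, and the summation relation at \<open>u\<close> gives back S_u.\<close>

lemma retraction_P:
  assumes u: "u \<in> verts O.S"
  shows "GO.eqv (\<Sum>z\<in>C.V u. free_hom F.T (P z)) (gen_vert u)"
proof -
  obtain v i where u_def: "u = (v, i)" by (cases u)
  have v: "v \<in> verts E" "1 \<le> i" "i \<le> m v" using u by (simp_all add: u_def O.verts_S)
  show ?thesis
  proof (cases "v = w")
    case False
    then have i: "i = 1" and m1: "m v = 1" using v m_other by auto
    have "C.V u = {(v, 1)}" using False v by (auto simp: u_def M.verts_S i block_def)
    moreover have "F.V v = {(v, 1)}" using v m1 by (auto simp: O.verts_S split_proj_def)
    ultimately have "(\<Sum>z\<in>C.V u. free_hom F.T (P z)) = gen_vert u"
      using False by (simp add: P_simps free_hom_gen F.T_simps u_def i)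
    then show ?thesis using u by (simp add: GO.eqv_refl gens_closed)
  next
    case True
    let ?J = "{j \<in> {1..n}. O.out_class (en j) = i}" and ?B = "{e \<in> out_arcs E w. O.out_class e = i}"
    let ?f = "\<lambda>x. gen_arc x * free_star (gen_arc x)"
    have V: "C.V u = Pair w ` ?J" using w_in by (auto simp: u_def True M.verts_S block_def image_iff)
    have B: "finite ?B" using finite_out_w by (rule rev_finite_subset) blast
    have "(\<Sum>z\<in>C.V u. free_hom F.T (P z)) = (\<Sum>j\<in>?J. free_hom F.T (P (w, j)))"
      unfolding V by (subst sum.reindex) (auto simp: inj_on_def)
    also have "\<dots> = (\<Sum>j\<in>?J. F.T (Arc (en j)) * free_star (F.T (Arc (en j))))"
      by (simp add: P_simps free_hom_mult free_hom_star free_hom_gen)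
    also have "\<dots> = (\<Sum>e\<in>?B. F.T (Arc e) * free_star (F.T (Arc e)))"
      by (rule sum.reindex_bij_betw[OF en_bij_class])
    also have "GO.eqv \<dots> (\<Sum>e\<in>?B. \<Sum>x\<in>F.A e. ?f x)"
      by (intro GO.eqv_sum F.arc_star_sum) simp
    also have "(\<Sum>e\<in>?B. \<Sum>x\<in>F.A e. ?f x) = (\<Sum>e\<in>?B. \<Sum>j\<in>{1..m (head E e)}. ?f (e, j))"
    proof (rule sum.cong[OF refl])
      fix e assume "e \<in> ?B"
      then have "F.A e = Pair e ` {1..m (head E e)}"
        by (auto simp: O.arcs_S split_proj_def image_iff)
      then show "(\<Sum>x\<in>F.A e. ?f x) = (\<Sum>j\<in>{1..m (head E e)}. ?f (e, j))"
        by (simp only:) (subst sum.reindex, auto simp: inj_on_def)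
    qed
    also have "\<dots> = (\<Sum>x\<in>out_arcs O.S u. ?f x)"
      unfolding u_def True O.out_arcs_S using B by (subst sum.Sigma) (auto simp: case_prod_beta)
    also have "GO.eqv (\<Sum>x\<in>out_arcs O.S u. ?f x) (gen_vert u)"
    proof (rule GO.eqv_sym[OF GO.vert_sum])
      show "u \<in> regular_verts O.S"
        using O.regular_S[of w i] u out_w B unfolding u_def True by blast
    qed
    finally show ?thesis .
  qed
qed

lemma retraction_vert:
  assumes "u \<in> verts O.S"
  shows "GO.eqv (free_hom F.T (free_hom T (C.T (Vert u)))) (gen_vert u)"
  using retraction_P[OF assms] by (simp add: C.T_simps T_simps free_hom_sum free_hom_gen)

text \<open>f^* replaces S_e by the sum of all copies of e, while the projections add up to that of
  the target of \<open>x\<close> by \<open>retraction_P\<close>. Multiplying by it selects the only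
  copy with that target, \<open>x\<close> itself.\<close>

lemma retraction_arc:
  assumes x: "x \<in> arcs O.S"
  shows "GO.eqv (free_hom F.T (free_hom T (C.T (Arc x)))) (gen_arc x)"
proof -
  obtain e i where x_def: "x = (e, i)" by (cases x)
  have e: "e \<in> arcs E" using x by (simp add: x_def O.arcs_S)
  have h: "head O.S x \<in> verts O.S" using x by simp
  have "free_hom F.T (free_hom T (C.T (Arc x))) = (\<Sum>y\<in>C.A x. F.T (Arc e) * free_hom F.T (P (head M.S y)))"
    unfolding C.T_simps free_hom_sum free_hom_gen
    by (rule sum.cong) (auto simp: x_def T_simps M.head_S free_hom_mult free_hom_gen)
  also have "\<dots> = F.T (Arc e) * (\<Sum>z\<in>C.V (head O.S x). free_hom F.T (P z))"
    by (simp only: sum_distrib_left[symmetric]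
        sum.reindex_bij_betw[OF C.head_bij[OF x], of "\<lambda>z. free_hom F.T (P z)"])
  also have "GO.eqv \<dots> (F.T (Arc e) * gen_vert (head O.S x))"
    by (intro GO.eqv_mult_left retraction_P h F.T_in)
  also have "F.T (Arc e) * gen_vert (head O.S x) = (\<Sum>y\<in>F.A e. gen_arc y * gen_vert (head O.S x))"
    by (simp add: F.T_simps sum_distrib_right)
  also have "GO.eqv \<dots> (\<Sum>y\<in>F.A e. if y = x then gen_arc x else 0)"
  proof (rule GO.eqv_sum)
    fix y assume y: "y \<in> F.A e"
    show "GO.eqv (gen_arc y * gen_vert (head O.S x)) (if y = x then gen_arc x else 0)"
    proof (cases "y = x")
      case True
      with x show ?thesis by (simp add: GO.arc_head)
    next
      case False
      have "x \<in> F.A e" using x by (simp add: x_def split_proj_def)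
      then have "head O.S y \<noteq> head O.S x"
        using False y F.head_bij[OF e] by (auto simp: bij_betw_def dest: inj_onD)
      with False y h show ?thesis by (simp add: GO.arc_vert_orth)
    qed
  qed
  also have "\<dots> = gen_arc x"
    using F.finite_A[OF e] x by (simp add: sum.delta x_def split_proj_def)
  finally show ?thesis .
qed

end

theorem corollary5p11:
  fixes E :: "('v, 'e) pre_digraph" and w :: 'v
    and m :: "'v \<Rightarrow> nat" and \<epsilon> :: "'v \<Rightarrow> nat \<Rightarrow> 'e set"
    and n :: nat and en :: "nat \<Rightarrow> 'e"
    and EO EM :: "('v \<times> nat, 'e \<times> nat) pre_digraph"
    and \<phi> :: "('v \<times> nat, 'e \<times> nat) gis \<Rightarrow> ('v, 'e) gis"
  assumes "wf_digraph E"
    and "w \<in> regular_verts E"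
    and "out_split_data E w m \<epsilon>"
    and "EO = multi_out_split E m \<epsilon>"
    and "bij_betw en {1..n} (out_arcs E w)"
    and "EM = maximal_out_split E w n en"
    and "regular_extended_path_hom EM E \<phi>"
    and "\<And>i. 1 \<le> i \<Longrightarrow> i \<le> n \<Longrightarrow>
           \<phi> (Some (vert_path (w, i), vert_path (w, i))) = Some (arc_path E (en i), arc_path E (en i))"
    and "\<And>v. v \<in> verts E \<Longrightarrow> v \<noteq> w \<Longrightarrow>
           \<phi> (Some (vert_path (v, 1), vert_path (v, 1))) = Some (vert_path v, vert_path v)"
    and "\<And>e. e \<in> arcs E \<Longrightarrow> head E e \<noteq> w \<Longrightarrow>
           \<phi> (Some (arc_path EM (e, 1), vert_path (head EM (e, 1))))
             = Some (arc_path E e, vert_path (head E e))"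
    and "\<And>e i. e \<in> arcs E \<Longrightarrow> head E e = w \<Longrightarrow> 1 \<le> i \<Longrightarrow> i \<le> n \<Longrightarrow>
           \<phi> (Some (arc_path EM (e, i), vert_path (w, i)))
             = Some ((tail E e, [e, en i]), arc_path E (en i))"
  shows "star_iso (graph_cstar E) (graph_cstar EO) (cstar_pullback EO E split_proj)
    \<and> (\<exists>g :: ('v \<times> nat, 'e \<times> nat, 'v \<times> nat, 'e \<times> nat) graph_map.
          multi_out_split_hom EM EO g
        \<and> (\<forall>y \<in> carrier (graph_cstar EO).
              inv_into (carrier (graph_cstar E)) (cstar_pullback EO E split_proj) y
                = cstar_pushforward EM E \<phi> (cstar_pullback EM EO g y)))"
proof -
  interpret split_at E w m \<epsilon> n en
    by (intro split_at.intro assms)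
  have EM: "EM = M.S" using assms(6) by (simp add: maximal_eq)
  let ?f = "cstar_pullback O.S E split_proj" and ?g = "cstar_pullback M.S O.S g"
    and ?\<phi> = "cstar_pushforward M.S E \<phi>"
  note push = pushforward[OF assms(8-11)[unfolded EM]]
  have f: "star_hom (graph_cstar E) (graph_cstar O.S) ?f" by (rule F.pullback(1))
  have \<phi>g: "star_hom (graph_cstar O.S) (graph_cstar E) (\<lambda>y. ?\<phi> (?g y))"
    by (rule star_hom_compose[OF C.pullback(1) push(1)])
  have \<phi>g_const: "?\<phi> (?g (GO.const_cls x)) = GE.const_cls (free_hom T (free_hom C.T x))"
    if "x \<in> free_carrier O.S" for x
    using that by (simp add: C.pullback(2) push(2) free_hom_in[OF C.T_in])
  \<comment> \<open>The composite is compared with the identity by \<open>star_hom_unique\<close>,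
    which leaves only generators to check; likewise for \<open>right\<close>.\<close>
  have left: "?\<phi> (?g (?f a)) = a" if a: "a \<in> carrier (graph_cstar E)" for a
  proof (rule graph_algebra_pair.star_hom_unique[OF _ star_hom_compose[OF f \<phi>g] star_hom_id _ _ a])
    show "graph_algebra_pair E E" ..
    show "?\<phi> (?g (?f (S_vert E v))) = S_vert E v" if "v \<in> verts E" for v
      using that section_vert[OF that]
      by (simp add: GE.S_vert_cls F.pullback(2) \<phi>g_const F.T_in gens_closed free_hom_gen GE.eqv_cls)
    show "?\<phi> (?g (?f (S_arc E e))) = S_arc E e" if "e \<in> arcs E" for e
      using that section_arc[OF that]
      by (simp add: GE.S_arc_cls F.pullback(2) \<phi>g_const F.T_in gens_closed free_hom_gen GE.eqv_cls)
  qed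
  have right: "?f (?\<phi> (?g y)) = y" if y: "y \<in> carrier (graph_cstar O.S)" for y
  proof (rule graph_algebra_pair.star_hom_unique[OF _ star_hom_compose[OF \<phi>g f] star_hom_id _ _ y])
    show "graph_algebra_pair O.S O.S" ..
    have T: "free_hom T (C.T x) \<in> free_carrier E" for x
      by (rule free_hom_in[OF T_in]) (simp_all, cases x, simp_all add: C.T_in)
    show "?f (?\<phi> (?g (S_vert O.S u))) = S_vert O.S u" if "u \<in> verts O.S" for u
      using that retraction_vert[OF that]
      by (simp add: GO.S_vert_cls F.pullback(2) \<phi>g_const T gens_closed free_hom_gen GO.eqv_cls)
    show "?f (?\<phi> (?g (S_arc O.S x))) = S_arc O.S x" if "x \<in> arcs O.S" for x
      using that retraction_arc[OF that]
      by (simp add: GO.S_arc_cls F.pullback(2) \<phi>g_const T gens_closed free_hom_gen GO.eqv_cls)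
  qed
  have \<phi>g_in: "?\<phi> (?g y) \<in> carrier (graph_cstar E)" if "y \<in> carrier (graph_cstar O.S)" for y
    using \<phi>g that by (auto simp: star_hom_def)
  have f_in: "?f a \<in> carrier (graph_cstar O.S)" if "a \<in> carrier (graph_cstar E)" for a
    using f that by (auto simp: star_hom_def)
  \<comment> \<open>The two-sided inverse yields the bijectivity of f^*, hence
    \<open>star_iso\<close>, and identifies \<open>inv_into\<close> with the composite.\<close>
  have bij: "bij_betw ?f (carrier (graph_cstar E)) (carrier (graph_cstar O.S))"
    by (rule bij_betwI[where g = "\<lambda>y. ?\<phi> (?g y)"]) (auto simp: left right \<phi>g_in f_in)
  have inv: "inv_into (carrier (graph_cstar E)) ?f y = ?\<phi> (?g y)"
    if y: "y \<in> carrier (graph_cstar O.S)" for y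
    using inv_into_f_f[OF bij_betw_imp_inj_on[OF bij] \<phi>g_in[OF y]] by (simp add: right y)
  show ?thesis
    unfolding EM assms(4) star_iso_def using f bij g_split_hom inv by blast
qed

end
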